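(* Let $k \geq 1$. There exist constants $c, C > 0$ depending only on $k$ such that for every $\epsilon > 0$ the following holds, with implied constants depending only on $k$ and $\epsilon$. Let $f(x) = \alpha_1 x + \cdots + \alpha_k x^k$ with real coefficients and $\alpha_k \neq 0$, let $N$ be a positive integer, let $m$ be a positive integer and $M \geq 1$ a real number with $m, M \leq N^{c}$, and let $b$ be an integer with $0 \leq b < m$ and $\gcd(b,m)=1$. Suppose \[ \left| \sum_{n=1}^{N} \lambda_{m,b}(n) e(f(n)) \right| \geq \frac{N}{M}. \] Then there is an integer $1 \leq q \ll (Mm)^{C} N^{\epsilon}$ such that \[ \|q \alpha_j\| \ll (Mm)^{C} N^{\epsilon - j} \] for every $j = 1, \ldots, k$.
   Context: $e(x) = e^{2\pi i x}$ and $\|x\|$ denotes the distance from the real number $x$ to the nearest integer. For a positive integer $m$ and an integer $b$ with $0 \leq b < m$ and $\gcd(b,m)=1$, the weight $\lambda_{m,b}(n)$ is defined by $\lambda_{m,b}(n) = \log(mn+b)$ if $mn+b$ is prime, and $\lambda_{m,b}(n) = 0$ otherwise. *)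

theory Defs
  imports "HOL-Analysis.Analysis" "HOL-Computational_Algebra.Primes"
begin

definition e2pi :: "real \<Rightarrow> complex" where
  "e2pi x = exp (2 * of_real pi * \<i> * of_real x)"

definition dist_nearest_int :: "real \<Rightarrow> real" where
  "dist_nearest_int x = \<bar>x - of_int (round x)\<bar>"

definition prime_weight :: "nat \<Rightarrow> nat \<Rightarrow> nat \<Rightarrow> real" where
  "prime_weight m b n = (if prime (m * n + b) then ln (real (m * n + b)) else 0)"

end

theory Submission
  imports Defs "HOL-Analysis.Kronecker_Approximation_Theorem" "HOL-Analysis.Harmonic_Numbers"
    "HOL-Computational_Algebra.Squarefree" "HOL-Number_Theory.Prime_Powers"
begin

text \<open>
  Since \<open>C\<close> may be large and a factor \<open>N powr \<epsilon>\<close> may be lost, a single parameter \<open>Q\<close> exceeding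
  \<open>M\<close>, \<open>m\<close> and \<open>ln N\<close> is carried along, and every loss is a power of \<open>Q\<close>. Weyl differencing and
  linear recurrence show that a large polynomial exponential sum forces its leading coefficient
  to be close to a fraction of small denominator. Vaughan's identity reduces a sum of
  \<open>\<Lambda>(x) e(F(x))\<close> to sums over products; as only powers of \<open>Q\<close> matter, its cutoffs can be powers of
  \<open>Q\<close>, so that the type I moduli are negligible and both variables of the type II sums are long
  enough for Weyl's inequality in one and polynomial recurrence in the other. This determines
  the leading coefficient. On residue classes in short intervals the leading term is then almost
  constant modulo \<open>1\<close>, and induction on the degree reaches the remaining coefficients.
\<close>

text \<open>Every step is an inverse statement: a lower bound for a sum, or for the size of a set,
  produces an integer multiplier. Multipliers found at successive stages are multiplied together and
  never reduced, so the denominators remain powers of one parameter and no coprimality has to be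
  carried along. Differencing sees only the top coefficient, and this is why the lower ones cannot
  be read off together with it. Two devices keep the bookkeeping short. Parameters are at least 2,
  so numerical constants are absorbed into exponents. When the length is at most a fixed power of
  the parameter, the claimed bound on the distance is at least 1 and the multiplier 1 is enough; in
  the remaining range the length exceeds whatever power of the parameter an argument requires, which
  is what makes room for the cutoffs and for the short intervals. At the end \<open>Q\<close> is a
  constant times \<open>M * m * N powr (\<epsilon> / C)\<close>: the power of \<open>N\<close> pays
  for \<open>ln N\<close>, and raising \<open>Q\<close> to the power \<open>C\<close> turns it into
  the permitted loss \<open>N powr \<epsilon>\<close>.\<close>

section \<open>Distance to the nearest integer\<close>

lemma dist_nearest_int_le: "dist_nearest_int x \<le> \<bar>x - of_int n\<bar>"
  unfolding dist_nearest_int_def by (rule round_diff_minimal)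

lemma dist_nearest_int_nonneg [simp]: "0 \<le> dist_nearest_int x"
  by (simp add: dist_nearest_int_def)

lemma dist_nearest_int_le_half: "dist_nearest_int x \<le> 1/2"
  unfolding dist_nearest_int_def using of_int_round_abs_le[of x] by (simp add: abs_minus_commute)

lemma dist_nearest_int_add_int [simp]: "dist_nearest_int (x + of_int n) = dist_nearest_int x"
proof (rule antisym)
  show "dist_nearest_int (x + of_int n) \<le> dist_nearest_int x"
    using dist_nearest_int_le[of "x + of_int n" "round x + n"] by (simp add: dist_nearest_int_def[of x])
  show "dist_nearest_int x \<le> dist_nearest_int (x + of_int n)"
    using dist_nearest_int_le[of x "round (x + of_int n) - n"]
    by (simp add: dist_nearest_int_def[of "x + of_int n"] algebra_simps)
qed

lemma dist_nearest_int_add: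
  "dist_nearest_int (x + y) \<le> dist_nearest_int x + dist_nearest_int y"
  using dist_nearest_int_le[of "x + y" "round x + round y"] by (simp add: dist_nearest_int_def)

lemma dist_nearest_int_minus [simp]: "dist_nearest_int (- x) = dist_nearest_int x"
proof -
  have "dist_nearest_int (- y) \<le> dist_nearest_int y" for y
    using dist_nearest_int_le[of "- y" "- round y"] by (simp add: dist_nearest_int_def[of y])
  from this[of x] this[of "- x"] show ?thesis by simp
qed

lemma dist_nearest_int_diff:
  "dist_nearest_int (x - y) \<le> dist_nearest_int x + dist_nearest_int y"
  using dist_nearest_int_add[of x "- y"] by simp

lemma dist_nearest_int_mult:
  "dist_nearest_int (of_int n * x) \<le> \<bar>of_int n\<bar> * dist_nearest_int x"
proof -
  have "of_int n * x - of_int (n * round x) = of_int n * (x - of_int (round x))"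
    by (simp add: algebra_simps)
  then show ?thesis
    using dist_nearest_int_le[of "of_int n * x" "n * round x"]
    by (simp add: dist_nearest_int_def[of x] abs_mult)
qed

lemma dist_nearest_int_sum:
  "finite A \<Longrightarrow> dist_nearest_int (\<Sum>i\<in>A. f i) \<le> (\<Sum>i\<in>A. dist_nearest_int (f i))"
proof (induction A rule: finite_induct)
  case empty
  then show ?case using dist_nearest_int_le[of 0 0] by simp
next
  case (insert a A)
  then show ?case using dist_nearest_int_add[of "f a" "sum f A"] by simp
qed

section \<open>The additive character\<close>

lemma e2pi_cis: "e2pi x = cis (2 * pi * x)"
  by (simp add: e2pi_def cis_conv_exp mult_ac)

lemma norm_e2pi [simp]: "norm (e2pi x) = 1"
  by (simp add: e2pi_cis)

lemma e2pi_add: "e2pi (x + y) = e2pi x * e2pi y"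
  by (simp add: e2pi_cis cis_mult distrib_left)

lemma cnj_e2pi: "cnj (e2pi x) = e2pi (- x)"
  by (simp add: e2pi_cis cis_cnj)

lemma e2pi_diff: "e2pi (x - y) = e2pi x * cnj (e2pi y)"
  using e2pi_add[of x "- y"] by (simp add: cnj_e2pi)

lemma e2pi_of_int [simp]: "e2pi (of_int n) = 1"
  by (simp add: e2pi_cis)

lemma e2pi_add_int [simp]: "e2pi (x + of_int n) = e2pi x"
  by (simp add: e2pi_add)

lemma e2pi_mult_of_nat: "e2pi (of_nat n * x) = e2pi x ^ n"
  by (simp add: e2pi_cis Complex.DeMoivre mult_ac)

lemma norm_e2pi_minus_1: "norm (e2pi x - 1) = 2 * \<bar>sin (pi * x)\<bar>"
proof -
  have "norm (e2pi x - 1) = norm (exp (\<i> * of_real (2 * pi * x)) - 1)"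
    by (simp add: e2pi_def mult_ac)
  also have "\<dots> = 2 * \<bar>sin (2 * pi * x / 2)\<bar>" by (rule dist_exp_i_1)
  finally show ?thesis by simp
qed

lemma norm_e2pi_diff_le: "norm (e2pi x - e2pi y) \<le> 2 * pi * \<bar>x - y\<bar>"
proof -
  have "norm (e2pi x - e2pi y) = norm (e2pi y * (e2pi (x - y) - 1))"
    using e2pi_add[of y "x - y"] by (simp add: algebra_simps)
  also have "\<dots> = 2 * \<bar>sin (pi * (x - y))\<bar>" by (simp only: norm_mult norm_e2pi norm_e2pi_minus_1 mult_1)
  also have "\<dots> \<le> 2 * \<bar>pi * (x - y)\<bar>" using abs_sin_x_le_abs_x[of "pi * (x - y)"] by linarith
  finally show ?thesis by (simp add: abs_mult)
qed

text \<open>The sharp constant is 4; with constant 1 it is enough that \<open>sin t\<close> is at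
  least half of \<open>\<bar>y\<bar>\<close>. Up to \<open>pi / 3\<close> the mean value theorem
  gives \<open>sin t \<ge> t / 2\<close>, because the cosine is at least 1/2 there; beyond that
  point the sine itself is at least 1/2.\<close>

lemma norm_e2pi_minus_1_ge: "norm (e2pi x - 1) \<ge> dist_nearest_int x"
proof -
  define y where "y = x - of_int (round x)"
  have y: "\<bar>y\<bar> \<le> 1/2" "dist_nearest_int x = \<bar>y\<bar>"
    using dist_nearest_int_le_half[of x] by (auto simp: y_def dist_nearest_int_def)
  have "e2pi x = e2pi y" using e2pi_add_int[of y "round x"] by (simp add: y_def)
  then have eq: "norm (e2pi x - 1) = 2 * \<bar>sin (pi * y)\<bar>" by (simp add: norm_e2pi_minus_1)
  have eq2: "\<bar>sin (pi * y)\<bar> = \<bar>sin (pi * \<bar>y\<bar>)\<bar>" by (cases "y \<ge> 0") auto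
  define t where "t = pi * \<bar>y\<bar>"
  have t: "0 \<le> t" "t \<le> pi / 2" "\<bar>y\<bar> \<le> t"
    using y pi_ge_two mult_mono[of 1 pi "\<bar>y\<bar>" "\<bar>y\<bar>"] by (auto simp: t_def field_simps)
  have "\<bar>y\<bar> / 2 \<le> sin t"
  proof (cases "t \<le> pi / 3")
    case True
    have "t / 2 \<le> sin t"
    proof (cases "t = 0")
      case False
      with t have "0 < t" by simp
      then obtain z where z: "0 < z" "z < t" "sin t - sin 0 = (t - 0) * cos z"
        using MVT2[of 0 t sin cos] DERIV_sin by blast
      have "cos (pi / 3) \<le> cos z"
        using z True pi_gt_zero by (intro cos_monotone_0_pi_le) auto
      then have "t * (1/2) \<le> t * cos z" using t by (intro mult_left_mono) (auto simp: cos_60)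
      with z show ?thesis by simp
    qed auto
    with t show ?thesis by simp
  next
    case False
    have "sin (pi / 6) \<le> sin t"
      using False t pi_gt_zero by (intro sin_monotone_2pi_le) auto
    then show ?thesis using y by (simp add: sin_30)
  qed
  with eq eq2 y show ?thesis unfolding t_def by linarith
qed

section \<open>Linear recurrence\<close>

text \<open>Approximate \<open>\<gamma>\<close> by \<open>a / q\<close> with \<open>q \<le> 4 N\<close>. Each \<open>h \<in> S\<close> makes \<open>h a\<close> close to \<open>0\<close> modulo \<open>q\<close>,
  which for large \<open>q\<close> holds for too few \<open>h\<close>; for small \<open>q\<close> it forces \<open>q\<close> to divide \<open>h a\<close>.\<close>
lemma linear_recurrence:
  fixes \<gamma> \<delta> M :: real and N :: nat and S :: "int set"
  assumes M: "M \<ge> 1" and N: "real N \<ge> 2 * M"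
    and S: "S \<subseteq> {-int N..int N}" "real (card S) \<ge> real N / M"
    and close: "\<And>h. h \<in> S \<Longrightarrow> dist_nearest_int (of_int h * \<gamma>) \<le> \<delta>"
    and \<delta>: "0 \<le> \<delta>" "\<delta> * (50 * M) \<le> 1"
  obtains q :: int where "1 \<le> q" "real_of_int q \<le> 25 * M"
    "dist_nearest_int (of_int q * \<gamma>) \<le> 200 * M\<^sup>2 * \<delta> / real N"
proof -
  have N0: "real N > 0" "N > 0" using M N by (auto intro: Nat.gr0I)
  \<comment> \<open>The denominator bound \<open>4 * N\<close> keeps \<open>h * e\<close> within 1/4
    for all \<open>h\<close> up to \<open>N\<close>, which leaves room to force the integer
    \<open>t h\<close> to be 0 later.\<close>
  obtain a q where aq: "coprime a q" "0 < q" "q \<le> int (4 * N)" 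
    "\<bar>of_int q * \<gamma> - of_int a\<bar> < 1 / real (4 * N)"
    using Dirichlet_approx_coprime[of "4 * N" \<gamma>] N0 by auto
  define e where "e = of_int q * \<gamma> - of_int a"
  have e: "\<bar>e\<bar> * (4 * real N) < 1" using aq N0 by (simp add: e_def field_simps)
  have rq: "real_of_int q \<ge> 1" using aq by simp
  have finS: "finite S" using S finite_subset by blast
  \<comment> \<open>An integer congruent to \<open>h * a\<close> modulo \<open>q\<close>;
    \<open>t_eq\<close> shows that it is small.\<close>
  define t where "t h = h * a - q * round (of_int h * \<gamma>)" for h
  define T where "T = \<lfloor>of_int q * \<delta> + 1/4\<rfloor>"
  define \<eta> where "\<eta> h = of_int h * \<gamma> - of_int (round (of_int h * \<gamma>))" for h :: int
  have \<eta>: "\<bar>\<eta> h\<bar> \<le> \<delta>" if "h \<in> S" for h using close[OF that] by (simp add: \<eta>_def dist_nearest_int_def)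
  have t_eq: "of_int (t h) = of_int q * \<eta> h - of_int h * e" for h
    by (simp add: t_def \<eta>_def e_def algebra_simps)
  have he: "\<bar>of_int h * e\<bar> \<le> 1/4" if "h \<in> S" for h
  proof -
    have "h \<in> {- int N..int N}" using S(1) that by blast
    then have "\<bar>of_int h :: real\<bar> \<le> real N" by (auto simp: abs_le_iff)
    then have "\<bar>of_int h * e\<bar> \<le> real N * \<bar>e\<bar>" by (simp add: abs_mult mult_right_mono)
    with e show ?thesis by (simp add: algebra_simps)
  qed
  have qe: "\<bar>of_int q * \<eta> h\<bar> \<le> of_int q * \<delta>" if "h \<in> S" for h
    using \<eta>[OF that] rq by (simp add: abs_mult)
  have t_le: "\<bar>real_of_int (t h)\<bar> \<le> of_int q * \<delta> + 1/4" if "h \<in> S" for h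
    using qe[OF that] he[OF that] unfolding t_eq by linarith
  \<comment> \<open>The value \<open>t h\<close> fixes \<open>h * a\<close>, hence \<open>h\<close>,
    modulo \<open>q\<close>, and \<open>h div q\<close> selects the block of length
    \<open>q\<close>. Counting the pairs therefore bounds \<open>card S\<close>, and the bound
    contradicts its density when \<open>q\<close> is large.\<close>
  have inj: "inj_on (\<lambda>h. (h div q, t h)) S"
  proof (rule inj_onI)
    fix h h' assume eq: "(h div q, t h) = (h' div q, t h')"
    then have "(h - h') * a = q * (round (of_int h * \<gamma>) - round (of_int h' * \<gamma>))"
      by (simp add: t_def algebra_simps)
    then have "q dvd (h - h') * a" by simp
    then have "q dvd h - h'" using aq(1) coprime_dvd_mult_left_iff coprime_commute by blast
    then have "h mod q = h' mod q" by (simp add: mod_eq_dvd_iff)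
    with eq show "h = h'" by (metis div_mult_mod_eq prod.inject)
  qed
  define D where "D = {(-int N) div q..int N div q}"
  have "(\<lambda>h. (h div q, t h)) ` S \<subseteq> D \<times> {-T..T}"
  proof clarify
    fix h assume h: "h \<in> S"
    then have "\<bar>t h\<bar> \<le> T" using t_le[OF h] unfolding T_def by (simp add: le_floor_iff)
    moreover have "- int N \<le> h" "h \<le> int N" using h S(1) by auto
    then have "h div q \<in> D" using aq(2) zdiv_mono1[of "- int N" h q] zdiv_mono1[of h "int N" q] by (simp add: D_def)
    ultimately show "h div q \<in> D \<and> t h \<in> {-T..T}" by auto
  qed
  then have "card ((\<lambda>h. (h div q, t h)) ` S) \<le> card (D \<times> {-T..T})"
    by (intro card_mono) (auto simp: D_def)
  then have "card S \<le> card (D \<times> {-T..T})" by (simp only: card_image[OF inj])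
  then have card_le: "real (card S) \<le> real (card D) * real (card {-T..T})"
    by (metis card_cartesian_product of_nat_le_iff of_nat_mult)
  have cardD: "real (card D) \<le> 10 * real N / of_int q"
  proof -
    have 1: "real_of_int (int N div q) \<le> real N / of_int q"
      by (metis floor_divide_of_int_eq of_int_floor_le of_int_of_nat_eq)
    have 2: "real_of_int ((- int N) div q) \<ge> - real N / of_int q - 1"
      by (metis floor_divide_of_int_eq of_int_minus of_int_of_nat_eq real_of_int_floor_ge_diff_one)
    have "(- int N) div q \<le> int N div q" using aq by (intro zdiv_mono1) auto
    then have "real (card D) = of_int (int N div q) - of_int ((- int N) div q) + 1"
      by (simp add: D_def)
    also have "\<dots> \<le> 2 * real N / of_int q + 2" using 1 2 by simp
    also have "\<dots> \<le> 10 * real N / of_int q"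
    proof -
      have "real_of_int q \<le> 4 * real N" using aq(3) by linarith
      then show ?thesis using rq by (simp add: field_simps)
    qed
    finally show ?thesis .
  qed
  have cardT: "real (card {-T..T}) \<le> 2 * (of_int q * \<delta>) + 3/2"
  proof -
    have "0 \<le> of_int q * \<delta>" using rq \<delta> by simp
    then have "T \<ge> 0" by (simp add: T_def)
    then have "real (card {-T..T}) = 2 * of_int T + 1" by simp
    also have "of_int T \<le> of_int q * \<delta> + 1/4" unfolding T_def by linarith
    finally show ?thesis by simp
  qed
  have "real N / M \<le> (10 * real N / of_int q) * (2 * (of_int q * \<delta>) + 3/2)"
    using S(2) card_le mult_mono[OF cardD cardT] rq by fastforce
  also have "\<dots> = real N * (20 * \<delta> + 15 / of_int q)" using rq by (simp add: field_simps)
  finally have "real N * (1 / M) \<le> real N * (20 * \<delta> + 15 / of_int q)" by simp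
  then have "1 / M \<le> 20 * \<delta> + 15 / of_int q" using N0(1) by (simp only: mult_le_cancel_left_pos)
  moreover have "20 * \<delta> \<le> 2/5 / M" using \<delta> M by (simp add: field_simps)
  ultimately have "3/5 / M \<le> 15 / of_int q" by simp
  then have qM: "of_int q \<le> 25 * M" using rq M by (simp add: field_simps)
  have "of_int q * \<delta> \<le> 25 * M * \<delta>" using qM \<delta> by (intro mult_right_mono) auto
  then have q\<delta>: "of_int q * \<delta> \<le> 1/2" using \<delta>(2) by (simp add: mult_ac)
  have he_le: "\<bar>of_int h * e\<bar> \<le> of_int q * \<delta>" if "h \<in> S" for h
  proof -
    \<comment> \<open>Now \<open>q * \<delta>\<close> is at most 1/2, so the integer
      \<open>t h\<close> is below 3/4 + 1/4 in absolute value and vanishes. The error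
      \<open>e\<close> of the Dirichlet approximation is thereby tied to
      \<open>\<delta>\<close>.\<close>
    have "\<bar>real_of_int (t h)\<bar> < 1" using t_le[OF that] q\<delta> by simp
    then have "t h = 0" by linarith
    then have "of_int q * \<eta> h = of_int h * e" using t_eq[of h] by simp
    then show ?thesis using qe[OF that] by simp
  qed
  \<comment> \<open>\<open>S\<close> has too many elements to lie close to 0. Dividing the bound for
    \<open>h * e\<close> by a large \<open>h\<close> is what gains the factor
    \<open>1 / N\<close>.\<close>
  have "\<exists>h\<in>S. \<bar>real_of_int h\<bar> \<ge> real N / (8 * M)"
  proof (rule ccontr)
    assume "\<not> ?thesis"
    then have *: "\<bar>real_of_int h\<bar> < real N / (8 * M)" if "h \<in> S" for h using that by auto
    define L where "L = \<lfloor>real N / (8 * M)\<rfloor>"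
    have L0: "L \<ge> 0" using M by (simp add: L_def)
    have "S \<subseteq> {-L..L}"
    proof
      fix h assume "h \<in> S"
      from *[OF this] have "\<bar>h\<bar> \<le> L" unfolding L_def by (simp add: le_floor_iff)
      then show "h \<in> {-L..L}" by auto
    qed
    then have "real (card S) \<le> real (card {-L..L})" using card_mono by (metis finite_atLeastAtMost_int of_nat_le_iff)
    also have "\<dots> = 2 * of_int L + 1" using L0 by simp
    also have "\<dots> \<le> 2 * (real N / (8 * M)) + 1" unfolding L_def by linarith
    also have "\<dots> < real N / M" using N M by (simp add: field_simps)
    finally show False using S(2) by simp
  qed
  then obtain h where h: "h \<in> S" "\<bar>real_of_int h\<bar> \<ge> real N / (8 * M)" by blast
  have "real N / (8 * M) * \<bar>e\<bar> \<le> \<bar>of_int h * e\<bar>" unfolding abs_mult using h(2) by (intro mult_right_mono) auto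
  also have "\<dots> \<le> of_int q * \<delta>" using he_le[OF h(1)] .
  also have "\<dots> \<le> 25 * M * \<delta>" using qM \<delta> by (intro mult_right_mono) auto
  finally have "\<bar>e\<bar> \<le> 200 * M\<^sup>2 * \<delta> / real N" using N0 M by (simp add: field_simps power2_eq_square)
  then have "dist_nearest_int (of_int q * \<gamma>) \<le> 200 * M\<^sup>2 * \<delta> / real N"
    using dist_nearest_int_le[of "of_int q * \<gamma>" a] by (simp add: e_def)
  moreover have "1 \<le> q" using aq by simp
  ultimately show ?thesis using that qM by blast
qed

section \<open>Counting\<close>

lemma pigeonhole_fiber:
  fixes M :: real
  assumes "finite S" "finite T" "f ` S \<subseteq> T" "real (card T) \<le> M" "M > 0"
  shows "\<exists>q. real (card S) / M \<le> real (card {h \<in> S. f h = q})"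
proof (rule ccontr)
  assume "\<not> ?thesis"
  then have *: "real (card {h \<in> S. f h = q}) < real (card S) / M" for q
    by (simp add: not_le)
  have eq: "card S = (\<Sum>q\<in>T. card {h \<in> S. f h = q})"
    using sum.group[OF assms(1-3), of "\<lambda>_. 1::nat"] by simp
  show False
  proof (cases "T = {}")
    case True
    then show False using *[of undefined] assms(3,5) by auto
  next
    case False
    have "real (card S) = (\<Sum>q\<in>T. real (card {h \<in> S. f h = q}))" using eq by (simp flip: of_nat_sum)
    also have "\<dots> < (\<Sum>q\<in>T. real (card S) / M)" using False assms(2) * by (intro sum_strict_mono) auto
    also have "\<dots> \<le> M * (real (card S) / M)" using assms(4,5) mult_right_mono[of "real (card T)" M "real (card S) / M"] by simp
    finally show False using assms(5) by simp
  qed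
qed

lemma exists_large_term:
  fixes f :: "'a \<Rightarrow> real"
  assumes "finite A" "real (card A) \<le> M" "M > 0" "sum f A \<ge> T" "T > 0"
  shows "\<exists>x\<in>A. f x \<ge> T / M"
proof (rule ccontr)
  assume "\<not> ?thesis"
  then have *: "f x < T / M" if "x \<in> A" for x using that by auto
  have "A \<noteq> {}" using assms by auto
  then have "sum f A < (\<Sum>x\<in>A. T / M)" using assms * by (intro sum_strict_mono) auto
  also have "\<dots> \<le> M * (T / M)" using assms(2,3,5) mult_right_mono[of "real (card A)" M "T / M"] by simp
  finally show False using assms by simp
qed

text \<open>Popularity argument: terms below \<open>t\<close> account for at most half of
  \<open>T\<close>, so the others, none above \<open>N\<close>, must carry the other half.\<close>

lemma many_large_terms:
  fixes f :: "'a \<Rightarrow> real"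
  assumes "finite A" "\<And>x. x \<in> A \<Longrightarrow> f x \<le> N" "sum f A \<ge> T" "real (card A) * t \<le> T / 2" "0 \<le> t"
  shows "real (card {x \<in> A. f x \<ge> t}) * N \<ge> T / 2"
proof -
  have "sum f A \<le> (\<Sum>x\<in>A. (if f x \<ge> t then N else 0) + t)"
  proof (intro sum_mono)
    fix x assume "x \<in> A"
    then show "f x \<le> (if f x \<ge> t then N else 0) + t" using assms(2)[of x] assms(5) by auto
  qed
  also have "\<dots> = (\<Sum>x\<in>A. if f x \<ge> t then N else 0) + real (card A) * t"
    by (simp add: sum.distrib)
  also have "(\<Sum>x\<in>A. if f x \<ge> t then N else 0) = real (card {x \<in> A. f x \<ge> t}) * N"
    by (simp add: sum.inter_filter[OF assms(1), symmetric])
  finally show ?thesis using assms(3,4) by linarith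
qed

text \<open>The expansion common to both differencing arguments: with \<open>F = 1\<close> it counts
  pairs of a dense set by their difference, with characters it is Weyl's squaring step.\<close>

lemma sum_pairs_by_difference:
  fixes F :: "int \<Rightarrow> int \<Rightarrow> 'b :: comm_monoid_add"
  assumes I: "I \<subseteq> {a<..a + int N}"
  shows "(\<Sum>n\<in>I. \<Sum>m\<in>I. F m n) = (\<Sum>h\<in>{-int N..int N}. \<Sum>n\<in>{n\<in>I. n + h \<in> I}. F (n + h) n)"
proof -
  have fin: "finite I" using I finite_subset by blast
  have "(\<Sum>m\<in>I. F m n) = (\<Sum>h\<in>{h\<in>{-int N..int N}. n + h \<in> I}. F (n + h) n)" if n: "n \<in> I" for n
  proof (rule sum.reindex_bij_witness[of _ "\<lambda>h. n + h" "\<lambda>m. m - n"])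
    fix m assume m: "m \<in> I"
    with n I have "m \<in> {a<..a + int N}" "n \<in> {a<..a + int N}" by auto
    then have "m - n \<in> {-int N..int N}" by auto
    with m show "m - n \<in> {h \<in> {-int N..int N}. n + h \<in> I}" by simp
  qed auto
  then have "(\<Sum>n\<in>I. \<Sum>m\<in>I. F m n) = (\<Sum>n\<in>I. \<Sum>h\<in>{h\<in>{-int N..int N}. n + h \<in> I}. F (n + h) n)"
    by simp
  also have "\<dots> = (\<Sum>h\<in>{-int N..int N}. \<Sum>n\<in>{n\<in>I. n + h \<in> I}. F (n + h) n)"
    using fin by (intro sum.swap_restrict) auto
  finally show ?thesis .
qed

text \<open>These inequalities absorb numerical constants and differing exponents into a single
  power of \<open>M\<close>.\<close>

lemma power_bounds:
  fixes M :: real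
  assumes "M \<ge> 2"
  shows "i \<le> j \<Longrightarrow> M ^ i \<le> M ^ j" "1 \<le> M ^ j" "2 ^ j \<le> M ^ j" "0 < M ^ j"
  using assms by (auto intro: power_increasing power_mono one_le_power)

text \<open>There are at most \<open>3 * N\<close> values of \<open>h\<close>, so those below the
  threshold \<open>N / (6 * M\<^sup>2)\<close> carry at most half of the given lower bound.\<close>

lemma many_large_differences:
  fixes f :: "int \<Rightarrow> real"
  assumes "M \<ge> 2" "N \<ge> 1" "\<And>h. f h \<le> real N" "(\<Sum>h\<in>{-int N..int N}. f h) \<ge> (real N / M)\<^sup>2"
  shows "real (card {h \<in> {-int N..int N}. f h \<ge> real N / (6 * M\<^sup>2)}) \<ge> real N / (2 * M\<^sup>2)"
proof -
  have "real (card {-int N..int N}) * (real N / (6 * M\<^sup>2)) \<le> (3 * real N) * (real N / (6 * M\<^sup>2))"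
    using assms(2) by (intro mult_right_mono) auto
  also have "\<dots> = (real N / M)\<^sup>2 / 2" by (simp add: power2_eq_square power_divide)
  finally have "real (card {h \<in> {-int N..int N}. f h \<ge> real N / (6 * M\<^sup>2)}) * real N \<ge> (real N / M)\<^sup>2 / 2"
    using assms(3,4) by (intro many_large_terms) auto
  then show ?thesis using assms(1,2) by (simp add: power2_eq_square field_simps)
qed

lemma six_times_square_le_power:
  fixes M :: real
  assumes "M \<ge> 2"
  shows "6 * M\<^sup>2 \<le> M ^ 5"
proof -
  have "6 * M\<^sup>2 \<le> M ^ 3 * M\<^sup>2" using power_bounds(3)[OF assms, of 3] by (intro mult_right_mono) auto
  also have "M ^ 3 * M\<^sup>2 = M ^ 5" by (simp flip: power_add)
  finally show ?thesis .
qed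

lemma Suc_le_power:
  fixes M :: real
  assumes "M \<ge> 2"
  shows "real (Suc k) \<le> M ^ k"
proof -
  have "Suc k \<le> 2 ^ k" by (rule Suc_leI) (rule less_exp)
  then have "real (Suc k) \<le> 2 ^ k" by (metis of_nat_le_iff of_nat_numeral of_nat_power)
  with power_bounds(3)[OF assms, of k] show ?thesis by linarith
qed

text \<open>A major arc condition: \<open>\<gamma>\<close> is within \<open>\<delta> / q\<close> of
  a fraction with denominator \<open>q \<le> B\<close>. The fraction need not be in lowest terms, so
  multipliers can be composed freely.\<close>

abbreviation near_fraction :: "real \<Rightarrow> real \<Rightarrow> real \<Rightarrow> bool" where
  "near_fraction B \<delta> \<gamma> \<equiv> \<exists>q::int. 1 \<le> q \<and> of_int q \<le> B \<and> dist_nearest_int (of_int q * \<gamma>) \<le> \<delta>"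

text \<open>In the inductions on the degree each \<open>h\<close> comes with its own multiplier. One
  of the at most \<open>M\<close> possible values is shared by a proportion \<open>1 / M\<close> of
  \<open>S\<close>, and recurrence for that value times \<open>\<gamma>\<close>, with density
  \<open>1 / M\<^sup>2\<close>, gives the result.\<close>

lemma linear_recurrence_multiplier:
  fixes \<gamma> \<delta> M :: real and N :: nat and S :: "int set"
  assumes M: "M \<ge> 1" and N: "real N \<ge> 2 * M\<^sup>2"
    and S: "S \<subseteq> {-int N..int N}" "real (card S) \<ge> real N / M"
    and close: "\<And>h. h \<in> S \<Longrightarrow> near_fraction M \<delta> (of_int h * \<gamma>)"
    and \<delta>: "0 \<le> \<delta>" "\<delta> * (50 * M\<^sup>2) \<le> 1"
  obtains q :: int where "1 \<le> q" "real_of_int q \<le> 25 * M ^ 3"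
    "dist_nearest_int (of_int q * \<gamma>) \<le> 200 * M ^ 4 * \<delta> / real N"
proof -
  obtain f :: "int \<Rightarrow> int" where f: "\<And>h. h \<in> S \<Longrightarrow> 1 \<le> f h \<and> of_int (f h) \<le> M \<and> dist_nearest_int (of_int (f h) * (of_int h * \<gamma>)) \<le> \<delta>"
    using close by metis
  have fin: "finite S" using S finite_subset by blast
  have "f ` S \<subseteq> {1..\<lfloor>M\<rfloor>}" using f by (auto simp: le_floor_iff)
  moreover have "real (card {1..\<lfloor>M\<rfloor>}) \<le> M" using M by simp
  ultimately obtain q1 where q1: "real (card S) / M \<le> real (card {h \<in> S. f h = q1})"
    using pigeonhole_fiber[OF fin _, of "{1..\<lfloor>M\<rfloor>}" f M] M by auto
  define S' where "S' = {h \<in> S. f h = q1}"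
  have "real N / M\<^sup>2 \<le> real (card S) / M" using S(2) M by (simp add: power2_eq_square field_simps)
  then have card: "real N / M\<^sup>2 \<le> real (card S')" using q1 unfolding S'_def by linarith
  have M2: "M\<^sup>2 \<ge> 1" using M by simp
  then have "0 < real N / M\<^sup>2" using N by (intro divide_pos_pos) linarith+
  then have "card S' \<noteq> 0" using card by linarith
  \<comment> \<open>The pigeonhole lemma says nothing about the common value itself; any element of
    its fibre supplies the bounds on \<open>q1\<close>.\<close>
  then obtain h0 where "h0 \<in> S'" by (metis card.empty ex_in_conv)
  then have q1b: "1 \<le> q1" "of_int q1 \<le> M" using f unfolding S'_def by auto
  have "dist_nearest_int (of_int h * (of_int q1 * \<gamma>)) \<le> \<delta>" if "h \<in> S'" for h
    using f[of h] that by (auto simp: S'_def mult_ac)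
  then obtain q where q: "1 \<le> q" "real_of_int q \<le> 25 * M\<^sup>2"
    "dist_nearest_int (of_int q * (of_int q1 * \<gamma>)) \<le> 200 * (M\<^sup>2)\<^sup>2 * \<delta> / real N"
    using linear_recurrence[of "M\<^sup>2" N S' "of_int q1 * \<gamma>" \<delta>] M2 N S card \<delta> unfolding S'_def by blast
  have "1 \<le> q * q1" using q q1b by (simp add: mult_pos_pos int_one_le_iff_zero_less)
  moreover have "real_of_int (q * q1) \<le> 25 * M ^ 3"
    using mult_mono[OF q(2) q1b(2)] q1b M by (simp add: power2_eq_square power3_eq_cube mult_ac)
  moreover have "dist_nearest_int (of_int (q * q1) * \<gamma>) \<le> 200 * M ^ 4 * \<delta> / real N"
    using q(3) by (simp add: mult_ac flip: power_mult)
  ultimately show ?thesis using that by blast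
qed

section \<open>Polynomial functions on the integers\<close>

text \<open>\<open>poly_fun k \<gamma> g\<close>: the function \<open>g\<close> is a polynomial of degree at most \<open>k\<close> whose coefficient
  of degree \<open>k\<close> is \<open>\<gamma>\<close>. The recursion through differences is the one of Weyl differencing.\<close>
fun poly_fun :: "nat \<Rightarrow> real \<Rightarrow> (int \<Rightarrow> real) \<Rightarrow> bool" where
  "poly_fun 0 \<gamma> g \<longleftrightarrow> (\<forall>n. g n = \<gamma>)"
| "poly_fun (Suc k) \<gamma> g \<longleftrightarrow> (\<forall>h. poly_fun k (real (Suc k) * of_int h * \<gamma>) (\<lambda>n. g (n + h) - g n))"

text \<open>Differencing by \<open>h\<close> after the substitution is differencing \<open>g\<close>
  by \<open>d * h\<close>, so each degree contributes one factor \<open>d\<close>.\<close>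

lemma poly_fun_affine:
  "poly_fun k \<gamma> g \<Longrightarrow> poly_fun k (of_int d ^ k * \<gamma>) (\<lambda>n. g (c + d * n))"
proof (induction k arbitrary: \<gamma> g)
  case (Suc k)
  show ?case unfolding poly_fun.simps
  proof
    fix h
    have "poly_fun k (real (Suc k) * of_int (d * h) * \<gamma>) (\<lambda>n. g (n + d * h) - g n)"
      using Suc.prems unfolding poly_fun.simps by blast
    from Suc.IH[OF this]
    show "poly_fun k (real (Suc k) * of_int h * (of_int d ^ Suc k * \<gamma>)) (\<lambda>n. g (c + d * (n + h)) - g (c + d * n))"
      by (simp add: algebra_simps)
  qed
qed auto

lemma poly_fun_add:
  "poly_fun k \<gamma> g \<Longrightarrow> poly_fun k \<gamma>' g' \<Longrightarrow> poly_fun k (\<gamma> + \<gamma>') (\<lambda>n. g n + g' n)"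
proof (induction k arbitrary: \<gamma> g \<gamma>' g')
  case (Suc k)
  show ?case unfolding poly_fun.simps
  proof
    fix h
    from Suc.IH[OF Suc.prems(1)[unfolded poly_fun.simps, rule_format] Suc.prems(2)[unfolded poly_fun.simps, rule_format], of h h]
    show "poly_fun k (real (Suc k) * of_int h * (\<gamma> + \<gamma>')) (\<lambda>n. g (n + h) + g' (n + h) - (g n + g' n))"
      by (simp add: algebra_simps)
  qed
qed auto

lemma poly_fun_cmult:
  "poly_fun k \<gamma> g \<Longrightarrow> poly_fun k (c * \<gamma>) (\<lambda>n. c * g n)"
proof (induction k arbitrary: \<gamma> g)
  case (Suc k)
  show ?case unfolding poly_fun.simps
  proof
    fix h
    from Suc.IH[OF Suc.prems[unfolded poly_fun.simps, rule_format], of h]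
    show "poly_fun k (real (Suc k) * of_int h * (c * \<gamma>)) (\<lambda>n. c * g (n + h) - c * g n)"
      by (simp add: algebra_simps)
  qed
qed auto

lemma poly_fun_diff:
  "poly_fun k \<gamma> g \<Longrightarrow> poly_fun k \<gamma>' g' \<Longrightarrow> poly_fun k (\<gamma> - \<gamma>') (\<lambda>n. g n - g' n)"
  using poly_fun_add[of k \<gamma> g "-1 * \<gamma>'" "\<lambda>n. -1 * g' n"] poly_fun_cmult[of k \<gamma>' g' "-1"] by simp

lemma poly_fun_degree_Suc: "poly_fun k \<gamma> g \<Longrightarrow> poly_fun (Suc k) 0 g"
proof (induction k arbitrary: \<gamma> g)
  case (Suc k)
  then show ?case unfolding poly_fun.simps(2)[of "Suc k"] by auto
qed auto

text \<open>Discrete product rule: the difference of \<open>n * g n\<close> is \<open>n\<close>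
  times the difference of \<open>g\<close> plus \<open>h * g (n + h)\<close>. The two leading
  coefficients, \<open>Suc k * h * \<gamma>\<close> and \<open>h * \<gamma>\<close>, add up to the
  required one.\<close>

lemma poly_fun_mult_id: "poly_fun k \<gamma> g \<Longrightarrow> poly_fun (Suc k) \<gamma> (\<lambda>n. of_int n * g n)"
proof (induction k arbitrary: \<gamma> g)
  case 0
  then show ?case by (simp add: algebra_simps)
next
  case (Suc k)
  show ?case unfolding poly_fun.simps(2)[of "Suc k"]
  proof
    fix h
    have 1: "poly_fun (Suc k) (real (Suc k) * of_int h * \<gamma>) (\<lambda>n. of_int n * (g (n + h) - g n))"
      by (rule Suc.IH) (use Suc.prems in \<open>simp only: poly_fun.simps\<close>)
    have 2: "poly_fun (Suc k) (of_int h * \<gamma>) (\<lambda>n. of_int h * g (h + n))"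
      using poly_fun_cmult[OF poly_fun_affine[OF Suc.prems, of 1 h]] by simp
    have "(\<lambda>n. of_int n * (g (n + h) - g n) + of_int h * g (h + n))
        = (\<lambda>n. of_int (n + h) * g (n + h) - of_int n * g n)"
      by (simp add: algebra_simps)
    with poly_fun_add[OF 1 2]
    show "poly_fun (Suc k) (real (Suc (Suc k)) * of_int h * \<gamma>) (\<lambda>n. of_int (n + h) * g (n + h) - of_int n * g n)"
      by (simp add: algebra_simps)
  qed
qed

lemma poly_fun_power: "poly_fun k 1 (\<lambda>n. of_int n ^ k)"
proof (induction k)
  case (Suc k)
  from poly_fun_mult_id[OF this] show ?case by simp
qed auto

lemma poly_fun_sum: "poly_fun k (\<beta> k) (\<lambda>n. \<Sum>j\<le>k. \<beta> j * of_int n ^ j)"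
proof (induction k)
  case (Suc k)
  have "poly_fun (Suc k) (0 + \<beta> (Suc k) * 1) (\<lambda>n. (\<Sum>j\<le>k. \<beta> j * of_int n ^ j) + \<beta> (Suc k) * of_int n ^ Suc k)"
    by (intro poly_fun_add poly_fun_cmult poly_fun_power poly_fun_degree_Suc[OF Suc])
  then show ?case by simp
qed auto

section \<open>Polynomial recurrence\<close>

text \<open>Weyl differencing for sets instead of sums. For many \<open>h\<close> the set
  \<open>S\<close> meets its translate by \<open>h\<close> in a dense set, on which the difference
  of \<open>g\<close> is within \<open>2 * \<delta>\<close> of integers; the induction hypothesis
  handles \<open>Suc k * h * \<gamma>\<close>, and linear recurrence in \<open>h\<close> gains the
  last factor \<open>1 / N\<close>. That the error stays proportional to \<open>\<delta>\<close> is
  essential for the bilinear sums.\<close>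

lemma polynomial_recurrence:
  "\<exists>C::nat. \<forall>(M::real) (N::nat) (a::int) g \<gamma> \<delta> S.
     M \<ge> 2 \<longrightarrow> poly_fun k \<gamma> g \<longrightarrow> S \<subseteq> {a<..a + int N} \<longrightarrow> real (card S) \<ge> real N / M \<longrightarrow>
     (\<forall>n\<in>S. dist_nearest_int (g n) \<le> \<delta>) \<longrightarrow> 0 \<le> \<delta> \<longrightarrow> \<delta> * M ^ C \<le> 1 \<longrightarrow> real N \<ge> M ^ C \<longrightarrow>
     near_fraction (M ^ C) (M ^ C * \<delta> / real N ^ k) \<gamma>"
proof (induction k)
  case 0
  show ?case
  proof (rule exI[of _ "1::nat"], intro allI impI)
    fix M :: real and N :: nat and a :: int and g \<gamma> \<delta> S
    assume h: "M \<ge> 2" "poly_fun 0 \<gamma> g" "real (card S) \<ge> real N / M"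
      "\<forall>n\<in>S. dist_nearest_int (g n) \<le> \<delta>" "0 \<le> \<delta>" "real N \<ge> M ^ 1"
    have "real N / M \<ge> 1" using h by simp
    then have "card S \<noteq> 0" using h(3) by linarith
    then obtain n where "n \<in> S" by (metis card.empty ex_in_conv)
    then have "dist_nearest_int \<gamma> \<le> \<delta>" using h(2,4) by auto
    also have "\<delta> \<le> M * \<delta>" using h(1,5) mult_right_mono[of 1 M \<delta>] by simp
    finally show "near_fraction (M ^ 1) (M ^ 1 * \<delta> / real N ^ 0) \<gamma>"
      using h(1) by (intro exI[of _ 1]) simp
  qed
next
  case (Suc k)
  then obtain C0 where IH: "\<And>(M::real) (N::nat) (a::int) g \<gamma> \<delta> S.
     M \<ge> 2 \<Longrightarrow> poly_fun k \<gamma> g \<Longrightarrow> S \<subseteq> {a<..a + int N} \<Longrightarrow> real (card S) \<ge> real N / M \<Longrightarrow>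
     (\<forall>n\<in>S. dist_nearest_int (g n) \<le> \<delta>) \<Longrightarrow> 0 \<le> \<delta> \<Longrightarrow> \<delta> * M ^ C0 \<le> 1 \<Longrightarrow> real N \<ge> M ^ C0 \<Longrightarrow>
     near_fraction (M ^ C0) (M ^ C0 * \<delta> / real N ^ k) \<gamma>"
    by metis
  \<comment> \<open>The induction hypothesis is used with density \<open>1 / M ^ 5\<close>, which
    costs \<open>M ^ (5 * C0)\<close>; the extra 5 absorbs the factor 2 in
    \<open>2 * \<delta>\<close> and the density \<open>1 / (2 * M\<^sup>2)\<close> of the good
    differences.\<close>
  define e where "e = 5 * C0 + 5"
  show ?case
  proof (rule exI[of _ "5 * e + k + 9"], intro allI impI)
    fix M :: real and N :: nat and a :: int and g \<gamma> \<delta> S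
    assume M: "M \<ge> 2" and g: "poly_fun (Suc k) \<gamma> g" and S: "S \<subseteq> {a<..a + int N}" "real (card S) \<ge> real N / M"
      and close: "\<forall>n\<in>S. dist_nearest_int (g n) \<le> \<delta>" and \<delta>: "0 \<le> \<delta>" "\<delta> * M ^ (5 * e + k + 9) \<le> 1"
      and N: "real N \<ge> M ^ (5 * e + k + 9)"
    note pb = power_bounds[OF M]
    have N1: "real N \<ge> 1" using N pb(2) by (meson order_trans)
    have finS: "finite S" using S finite_subset by blast
    define Sh where "Sh h = {n \<in> S. n + h \<in> S}" for h
    have Sh: "Sh h \<subseteq> {a<..a + int N}" for h using S by (auto simp: Sh_def)
    have Sh_le: "real (card (Sh h)) \<le> real N" for h
      using card_mono[OF _ Sh[of h]] by simp
    have "(\<Sum>n\<in>S. \<Sum>m\<in>S. 1::nat) = (\<Sum>h\<in>{-int N..int N}. \<Sum>n\<in>Sh h. 1)"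
      unfolding Sh_def by (rule sum_pairs_by_difference[OF S(1)])
    then have "card S * card S = (\<Sum>h\<in>{-int N..int N}. card (Sh h))" by simp
    then have "real (card S * card S) = real (\<Sum>h\<in>{-int N..int N}. card (Sh h))" by (rule arg_cong)
    then have "real (\<Sum>h\<in>{-int N..int N}. card (Sh h)) = real (card S) ^ 2"
      by (simp add: power2_eq_square)
    moreover have "(real N / M)\<^sup>2 \<le> real (card S) ^ 2" using S(2) M by (intro power_mono) auto
    ultimately have sum: "(\<Sum>h\<in>{-int N..int N}. real (card (Sh h))) \<ge> (real N / M)\<^sup>2" by simp
    define H where "H = {h \<in> {-int N..int N}. real (card (Sh h)) \<ge> real N / (6 * M\<^sup>2)}"
    have cardH: "real (card H) \<ge> real N / (2 * M\<^sup>2)"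
      unfolding H_def using M N1 Sh_le sum by (intro many_large_differences) auto
    have M5: "6 * M\<^sup>2 \<le> M ^ 5" using M by (rule six_times_square_le_power)
    have e1: "(M ^ 5) ^ C0 = M ^ (5 * C0)" by (simp flip: power_mult)
    have \<delta>2: "2 * \<delta> * M ^ (5 * C0) \<le> 1"
    proof -
      have "2 * M ^ (5 * C0) \<le> M * M ^ (5 * C0)" using M pb(4) by simp
      also have "\<dots> \<le> M ^ (5 * e + k + 9)" using pb(1)[of "Suc (5 * C0)" "5 * e + k + 9"] by (simp add: e_def)
      finally show ?thesis using \<delta> mult_left_mono[of "2 * M ^ (5 * C0)" "M ^ (5 * e + k + 9)" \<delta>] by (simp add: mult_ac)
    qed
    define \<delta>'' where "\<delta>'' = M ^ (5 * C0) * (2 * \<delta>) / real N ^ k"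
    have step: "near_fraction (M ^ e) \<delta>'' (of_int h * (real (Suc k) * \<gamma>))"
      if h: "h \<in> H" for h
    proof -
      have "real N / M ^ 5 \<le> real N / (6 * M\<^sup>2)" using M5 M by (intro divide_left_mono) auto
      also have "\<dots> \<le> real (card (Sh h))" using h by (simp add: H_def)
      finally have c: "real (card (Sh h)) \<ge> real N / M ^ 5" .
      have d: "\<forall>n\<in>Sh h. dist_nearest_int (g (n + h) - g n) \<le> 2 * \<delta>"
      proof
        fix n assume n: "n \<in> Sh h"
        then have "dist_nearest_int (g (n + h)) \<le> \<delta>" "dist_nearest_int (g n) \<le> \<delta>"
          using close by (auto simp: Sh_def)
        then show "dist_nearest_int (g (n + h) - g n) \<le> 2 * \<delta>"
          using dist_nearest_int_diff[of "g (n + h)" "g n"] by linarith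
      qed
      have N5: "real N \<ge> (M ^ 5) ^ C0"
        using N pb(1)[of "5 * C0" "5 * e + k + 9"] unfolding e1 e_def by simp
      have M52: "M ^ 5 \<ge> 2" using pb(3)[of 5] by simp
      have g': "poly_fun k (real (Suc k) * of_int h * \<gamma>) (\<lambda>n. g (n + h) - g n)"
        using g by (simp only: poly_fun.simps)
      have \<delta>': "0 \<le> 2 * \<delta>" "2 * \<delta> * (M ^ 5) ^ C0 \<le> 1" using \<delta> \<delta>2 unfolding e1 by simp_all
      obtain q :: int where q: "1 \<le> q" "of_int q \<le> (M ^ 5) ^ C0"
        "dist_nearest_int (of_int q * (real (Suc k) * of_int h * \<gamma>)) \<le> (M ^ 5) ^ C0 * (2 * \<delta>) / real N ^ k"
        using IH[OF M52 g' Sh c d \<delta>' N5] by blast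
      moreover have "(M ^ 5) ^ C0 \<le> M ^ e" unfolding e1 by (rule pb(1)) (simp add: e_def)
      ultimately show ?thesis unfolding e1 \<delta>''_def by (intro exI[of _ q]) (auto simp: mult_ac)
    qed
    have Nk: "real N ^ k \<ge> 1" using N1 by simp
    have \<delta>''_le: "\<delta>'' \<le> M ^ e * \<delta> / real N ^ k" "0 \<le> \<delta>''"
    proof -
      have "2 * M ^ (5 * C0) \<le> M * M ^ (5 * C0)" using M pb(4) by simp
      also have "\<dots> \<le> M ^ e" using pb(1)[of "Suc (5 * C0)" e] by (simp add: e_def)
      finally have "2 * M ^ (5 * C0) * \<delta> \<le> M ^ e * \<delta>" using \<delta> by (intro mult_right_mono)
      then show "\<delta>'' \<le> M ^ e * \<delta> / real N ^ k" unfolding \<delta>''_def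
        using Nk by (intro divide_right_mono) (auto simp: mult_ac)
      show "0 \<le> \<delta>''" unfolding \<delta>''_def using \<delta> M by simp
    qed
    have Me: "(M ^ e) ^ j = M ^ (e * j)" for j by (simp flip: power_mult)
    have cond: "\<delta>'' * (50 * (M ^ e)\<^sup>2) \<le> 1"
    proof -
      have "\<delta>'' \<le> M ^ e * \<delta>"
      proof -
        have "M ^ e * \<delta> / real N ^ k \<le> M ^ e * \<delta> / 1" using Nk N1 \<delta> M by (intro divide_left_mono) auto
        with \<delta>''_le show ?thesis by simp
      qed
      then have "\<delta>'' * (50 * (M ^ e)\<^sup>2) \<le> M ^ e * \<delta> * (50 * (M ^ e)\<^sup>2)" by (intro mult_right_mono) auto
      also have "\<dots> = \<delta> * (50 * (M ^ e) ^ 3)" by (simp add: power2_eq_square power3_eq_cube)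
      also have "\<dots> = \<delta> * (50 * M ^ (3 * e))" by (simp only: Me mult.commute[of e 3])
      also have "\<dots> \<le> \<delta> * M ^ (5 * e + k + 9)"
      proof (intro mult_left_mono \<delta>)
        have "50 * M ^ (3 * e) \<le> M ^ 6 * M ^ (3 * e)" using pb(3)[of 6] M by (intro mult_right_mono) auto
        also have "\<dots> = M ^ (6 + 3 * e)" by (simp add: power_add)
        also have "\<dots> \<le> M ^ (5 * e + k + 9)" by (intro pb(1)) simp
        finally show "50 * M ^ (3 * e) \<le> M ^ (5 * e + k + 9)" .
      qed
      finally show ?thesis using \<delta> by simp
    qed
    have N2: "real N \<ge> 2 * (M ^ e)\<^sup>2"
    proof -
      have "2 * (M ^ e)\<^sup>2 \<le> M * (M ^ e)\<^sup>2" using M by (intro mult_right_mono) auto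
      also have "\<dots> = M ^ (1 + e * 2)" by (simp add: Me)
      also have "\<dots> \<le> M ^ (5 * e + k + 9)" by (intro pb(1)) simp
      finally show ?thesis using N by simp
    qed
    have "real N / M ^ e \<le> real N / (2 * M\<^sup>2)"
    proof (rule divide_left_mono)
      have "2 * M\<^sup>2 \<le> M ^ 5" using M5 zero_le_power2[of M] by linarith
      also have "\<dots> \<le> M ^ e" by (intro pb(1)) (simp add: e_def)
      finally show "2 * M\<^sup>2 \<le> M ^ e" .
    qed (use M in auto)
    with cardH have cardH': "real (card H) \<ge> real N / M ^ e" by linarith
    obtain q where q: "1 \<le> q" "real_of_int q \<le> 25 * (M ^ e) ^ 3"
      "dist_nearest_int (of_int q * (real (Suc k) * \<gamma>)) \<le> 200 * (M ^ e) ^ 4 * \<delta>'' / real N"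
      using linear_recurrence_multiplier[OF pb(2)[of e] N2 _ cardH' step \<delta>''_le(2) cond]
      unfolding H_def by blast
    \<comment> \<open>The factor \<open>Suc k\<close> produced by differencing is moved from the
      coefficient into the multiplier, at the price of \<open>M ^ k\<close>.\<close>
    have "dist_nearest_int (of_int (q * int (Suc k)) * \<gamma>) \<le> 200 * (M ^ e) ^ 4 * \<delta>'' / real N"
      using q(3) by (simp add: mult_ac)
    also have "\<dots> \<le> 200 * (M ^ e) ^ 4 * (M ^ e * \<delta> / real N ^ k) / real N"
      using \<delta>''_le by (intro divide_right_mono mult_left_mono) auto
    also have "\<dots> = 200 * (M ^ e) ^ 5 * \<delta> / real N ^ Suc k" by (simp add: eval_nat_numeral mult_ac)
    also have "\<dots> = 200 * M ^ (5 * e) * \<delta> / real N ^ Suc k" by (simp only: Me mult.commute[of e 5])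
    also have "\<dots> \<le> M ^ (5 * e + k + 9) * \<delta> / real N ^ Suc k"
    proof (intro divide_right_mono mult_right_mono \<delta>)
      have "200 * M ^ (5 * e) \<le> M ^ 8 * M ^ (5 * e)" using pb(3)[of 8] M by (intro mult_right_mono) auto
      also have "\<dots> = M ^ (8 + 5 * e)" by (simp add: power_add)
      also have "\<dots> \<le> M ^ (5 * e + k + 9)" by (intro pb(1)) simp
      finally show "200 * M ^ (5 * e) \<le> M ^ (5 * e + k + 9)" .
    qed auto
    finally have fin1: "dist_nearest_int (of_int (q * int (Suc k)) * \<gamma>) \<le> M ^ (5 * e + k + 9) * \<delta> / real N ^ Suc k" .
    have "real_of_int (q * int (Suc k)) = of_int q * real (Suc k)" by simp
    also have "\<dots> \<le> (25 * (M ^ e) ^ 3) * M ^ k" using q(2) Suc_le_power[OF M, of k] q(1) M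
      by (intro mult_mono) auto
    also have "\<dots> = 25 * M ^ (3 * e + k)" by (simp only: Me mult.commute[of e 3] power_add mult.assoc)
    also have "\<dots> \<le> M ^ 5 * M ^ (3 * e + k)" using pb(3)[of 5] M by (intro mult_right_mono) auto
    also have "\<dots> = M ^ (5 + (3 * e + k))" by (simp only: power_add)
    also have "\<dots> \<le> M ^ (5 * e + k + 9)" by (intro pb(1)) simp
    finally have fin2: "real_of_int (q * int (Suc k)) \<le> M ^ (5 * e + k + 9)" .
    have "1 \<le> q * int (Suc k)" using q(1) by (simp add: int_one_le_iff_zero_less)
    with fin1 fin2 show "near_fraction (M ^ (5 * e + k + 9)) (M ^ (5 * e + k + 9) * \<delta> / real N ^ Suc k) \<gamma>"
      by blast
  qed
qed

section \<open>Weyl's inequality\<close>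

text \<open>For such short ranges the allowed distance is at least 1, while no distance exceeds 1/2,
  so the multiplier 1 works.\<close>

lemma trivial_denominator:
  fixes M :: real
  assumes "M \<ge> 2" "real N \<le> M ^ a" "a * k \<le> C" "N \<ge> 1"
  shows "near_fraction (M ^ C) (M ^ C / real N ^ k) \<gamma>"
proof -
  have "real N ^ k \<le> (M ^ a) ^ k" using assms by (intro power_mono) auto
  also have "\<dots> = M ^ (a * k)" by (simp add: power_mult)
  also have "\<dots> \<le> M ^ C" using assms by (intro power_bounds(1))
  finally have "1 \<le> M ^ C / real N ^ k" using assms(4) by (simp add: le_divide_eq)
  then show ?thesis using dist_nearest_int_le_half[of \<gamma>] power_bounds(2)[OF assms(1), of C]
    by (intro exI[of _ 1]) auto
qed

text \<open>Multiplication by \<open>e2pi \<gamma> - 1\<close> telescopes the geometric sum to two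
  terms of modulus 1. The product form also covers integral \<open>\<gamma>\<close>.\<close>

lemma linear_exponential_sum:
  assumes g: "poly_fun 1 \<gamma> g"
  shows "dist_nearest_int \<gamma> * norm (\<Sum>n\<in>{u<..v}. e2pi (g n)) \<le> 2"
proof (cases "u \<le> v")
  case True
  have step: "g (n + 1) = g n + \<gamma>" for n using g[unfolded One_nat_def poly_fun.simps, rule_format, of n 1] by simp
  have tele: "(e2pi \<gamma> - 1) * (\<Sum>n\<in>{u<..v}. e2pi (g n)) = e2pi (g (v + 1)) - e2pi (g (u + 1))"
    using True
  proof (induction v rule: int_ge_induct)
    case (step i)
    have "{u<..i + 1} = insert (i + 1) {u<..i}" using step by auto
    then have "(\<Sum>n\<in>{u<..i + 1}. e2pi (g n)) = e2pi (g (i + 1)) + (\<Sum>n\<in>{u<..i}. e2pi (g n))" by simp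
    then show ?case using step \<open>\<And>n. g (n + 1) = g n + \<gamma>\<close>[of "i + 1"] by (simp add: algebra_simps e2pi_add)
  qed simp
  have "dist_nearest_int \<gamma> * norm (\<Sum>n\<in>{u<..v}. e2pi (g n)) \<le> norm (e2pi \<gamma> - 1) * norm (\<Sum>n\<in>{u<..v}. e2pi (g n))"
    by (intro mult_right_mono norm_e2pi_minus_1_ge) auto
  also have "\<dots> = norm (e2pi (g (v + 1)) - e2pi (g (u + 1)))" unfolding tele[symmetric] by (rule norm_mult[symmetric])
  also have "\<dots> \<le> 1 + 1" by (rule norm_triangle_le_diff) simp
  finally show ?thesis by simp
qed auto

text \<open>Squaring the sum gives, for many \<open>h\<close>, a large sum over the differenced
  phase, to which the induction hypothesis applies. This makes multiples of
  \<open>Suc (Suc k) * h * \<gamma>\<close> nearly integral, and recurrence in \<open>h\<close>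
  removes \<open>h\<close> while gaining a factor \<open>1 / N\<close>.\<close>

lemma weyl_inverse:
  "\<exists>C::nat. \<forall>(M::real) (N::nat) (u::int) v g \<gamma>.
     M \<ge> 2 \<longrightarrow> N \<ge> 1 \<longrightarrow> poly_fun (Suc k) \<gamma> g \<longrightarrow> v \<le> u + int N \<longrightarrow>
     norm (\<Sum>n\<in>{u<..v}. e2pi (g n)) \<ge> real N / M \<longrightarrow>
     near_fraction (M ^ C) (M ^ C / real N ^ Suc k) \<gamma>"
proof (induction k)
  case 0
  show ?case
  proof (rule exI[of _ "2::nat"], intro allI impI)
    fix M :: real and N :: nat and u v :: int and g \<gamma>
    assume M: "M \<ge> 2" and N: "N \<ge> 1" and g: "poly_fun (Suc 0) \<gamma> g"
      and large: "norm (\<Sum>n\<in>{u<..v}. e2pi (g n)) \<ge> real N / M"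
    have "dist_nearest_int \<gamma> * (real N / M) \<le> dist_nearest_int \<gamma> * norm (\<Sum>n\<in>{u<..v}. e2pi (g n))"
      using large by (intro mult_left_mono) auto
    also have "\<dots> \<le> 2" using linear_exponential_sum[of \<gamma> g u v] g by simp
    also have "2 \<le> M" by fact
    finally have "dist_nearest_int \<gamma> \<le> M\<^sup>2 / real N" using N M by (simp add: field_simps power2_eq_square)
    then show "near_fraction (M\<^sup>2) (M\<^sup>2 / real N ^ Suc 0) \<gamma>"
      using power_bounds(2)[OF M, of 2] by (intro exI[of _ 1]) simp
  qed
next
  case (Suc k)
  then obtain C0 where IH: "\<And>(M::real) (N::nat) (u::int) v g \<gamma>.
     M \<ge> 2 \<Longrightarrow> N \<ge> 1 \<Longrightarrow> poly_fun (Suc k) \<gamma> g \<Longrightarrow> v \<le> u + int N \<Longrightarrow>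
     norm (\<Sum>n\<in>{u<..v}. e2pi (g n)) \<ge> real N / M \<Longrightarrow>
     near_fraction (M ^ C0) (M ^ C0 / real N ^ Suc k) \<gamma>"
    by metis
  define e where "e = 5 * C0 + 5"
  \<comment> \<open>Recurrence needs \<open>50 * M ^ (3 * e) \<le> N\<close>, and 50 is at most
    \<open>M ^ 6\<close>. Shorter ranges are trivial, which the summand
    \<open>a * Suc (Suc k)\<close> of \<open>C\<close> pays for.\<close>
  define a where "a = 3 * e + 6"
  define C where "C = 5 * e + k + 10 + a * Suc (Suc k)"
  show ?case
  proof (rule exI[of _ C], intro allI impI)
    fix M :: real and N :: nat and u v :: int and g \<gamma>
    assume M: "M \<ge> 2" and N1: "N \<ge> 1" and g: "poly_fun (Suc (Suc k)) \<gamma> g" and uv: "v \<le> u + int N"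
      and large: "norm (\<Sum>n\<in>{u<..v}. e2pi (g n)) \<ge> real N / M"
    note pb = power_bounds[OF M]
    show "near_fraction (M ^ C) (M ^ C / real N ^ Suc (Suc k)) \<gamma>"
    proof (cases "real N \<le> M ^ a")
      case True
      then show ?thesis using M N1 by (intro trivial_denominator[of M N a]) (auto simp: C_def)
    next
      case False
      then have N: "real N \<ge> M ^ a" by simp
      define I where "I = {u<..v}"
      have I: "I \<subseteq> {u<..u + int N}" using uv by (auto simp: I_def)
      define T where "T h = (\<Sum>n\<in>{n\<in>I. n + h \<in> I}. e2pi (g (n + h) - g n))" for h
      \<comment> \<open>An interval meets its translate in an interval again, possibly a shorter
        one. The lemma admits every \<open>v \<le> u + int N\<close> for this reason.\<close>
      have Ieq: "{n\<in>I. n + h \<in> I} = {max u (u - h)<..min v (v - h)}" for h by (auto simp: I_def)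
      have T_le: "norm (T h) \<le> real N" for h
      proof -
        have "norm (T h) \<le> (\<Sum>n\<in>{n\<in>I. n + h \<in> I}. norm (e2pi (g (n + h) - g n)))"
          unfolding T_def by (rule norm_sum)
        also have "\<dots> = real (card {n\<in>I. n + h \<in> I})" by simp
        also have "\<dots> \<le> real (card {u<..u + int N})" using I by (intro of_nat_mono card_mono) auto
        finally show ?thesis by simp
      qed
      have "(\<Sum>n\<in>I. e2pi (g n)) * cnj (\<Sum>n\<in>I. e2pi (g n)) = (\<Sum>n\<in>I. \<Sum>m\<in>I. e2pi (g m - g n))"
        unfolding cnj_sum sum_product e2pi_diff by (rule sum.swap)
      also have "\<dots> = (\<Sum>h\<in>{-int N..int N}. T h)"
        unfolding T_def by (rule sum_pairs_by_difference[OF I])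
      finally have "norm (\<Sum>n\<in>I. e2pi (g n)) ^ 2 = norm (\<Sum>h\<in>{-int N..int N}. T h)"
        by (metis complex_mod_cnj norm_mult power2_eq_square)
      also have "\<dots> \<le> (\<Sum>h\<in>{-int N..int N}. norm (T h))" by (rule norm_sum)
      finally have "norm (\<Sum>n\<in>I. e2pi (g n)) ^ 2 \<le> (\<Sum>h\<in>{-int N..int N}. norm (T h))" .
      moreover have "(real N / M)\<^sup>2 \<le> norm (\<Sum>n\<in>I. e2pi (g n)) ^ 2" using large M unfolding I_def by (intro power_mono) auto
      ultimately have sum: "(\<Sum>h\<in>{-int N..int N}. norm (T h)) \<ge> (real N / M)\<^sup>2" by simp
      define H where "H = {h \<in> {-int N..int N}. norm (T h) \<ge> real N / (6 * M\<^sup>2)}"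
      have cardH: "real (card H) \<ge> real N / (2 * M\<^sup>2)"
        unfolding H_def using M N1 T_le sum by (intro many_large_differences) auto
      have M5: "6 * M\<^sup>2 \<le> M ^ 5" using M by (rule six_times_square_le_power)
      have e1: "(M ^ 5) ^ C0 = M ^ (5 * C0)" by (simp flip: power_mult)
      define \<delta> where "\<delta> = M ^ e / real N ^ Suc k"
      have step: "near_fraction (M ^ e) \<delta> (of_int h * (real (Suc (Suc k)) * \<gamma>))"
        if h: "h \<in> H" for h
      proof -
        have "real N / M ^ 5 \<le> real N / (6 * M\<^sup>2)" using M5 M by (intro divide_left_mono) auto
        also have "\<dots> \<le> norm (T h)" using h by (simp add: H_def)
        finally have c: "norm (\<Sum>n\<in>{max u (u - h)<..min v (v - h)}. e2pi (g (n + h) - g n)) \<ge> real N / M ^ 5"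
          unfolding T_def Ieq .
        have "M ^ 5 \<ge> 2" using pb(3)[of 5] by simp
        moreover have "poly_fun (Suc k) (real (Suc (Suc k)) * of_int h * \<gamma>) (\<lambda>n. g (n + h) - g n)"
          using g unfolding poly_fun.simps(2)[of "Suc k"] by blast
        moreover have "min v (v - h) \<le> max u (u - h) + int N" using uv by auto
        ultimately obtain q :: int where q: "1 \<le> q" "of_int q \<le> (M ^ 5) ^ C0"
          "dist_nearest_int (of_int q * (real (Suc (Suc k)) * of_int h * \<gamma>)) \<le> (M ^ 5) ^ C0 / real N ^ Suc k"
          using IH[of "M ^ 5"] N1 c by blast
        have le: "(M ^ 5) ^ C0 \<le> M ^ e" unfolding e1 by (rule pb(1)) (simp add: e_def)
        have "(M ^ 5) ^ C0 / real N ^ Suc k \<le> \<delta>" unfolding \<delta>_def using le by (intro divide_right_mono) auto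
        with q le show ?thesis by (intro exI[of _ q]) (auto simp: mult_ac)
      qed
      have Me: "(M ^ e) ^ j = M ^ (e * j)" for j by (simp flip: power_mult)
      have \<delta>0: "0 \<le> \<delta>" unfolding \<delta>_def using M by simp
      have cond: "\<delta> * (50 * (M ^ e)\<^sup>2) \<le> 1"
      proof -
        have "M ^ e * (50 * (M ^ e)\<^sup>2) = 50 * (M ^ e) ^ 3" by (simp add: power2_eq_square power3_eq_cube)
        also have "\<dots> = 50 * M ^ (3 * e)" by (simp only: Me mult.commute[of e 3])
        also have "\<dots> \<le> M ^ 6 * M ^ (3 * e)" using pb(3)[of 6] pb(4)[of "3 * e"] by (intro mult_right_mono) simp_all
        also have "\<dots> = M ^ a" by (simp add: power_add a_def)
        also have "\<dots> \<le> real N" by (rule N)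
        also have "\<dots> \<le> real N ^ Suc k" using N1 by (simp add: mult_le_cancel_left1)
        finally show ?thesis unfolding \<delta>_def using N1 by (simp add: divide_le_eq)
      qed
      have N2: "real N \<ge> 2 * (M ^ e)\<^sup>2"
      proof -
        have "2 * (M ^ e)\<^sup>2 \<le> M * (M ^ e)\<^sup>2" using M by (intro mult_right_mono) auto
        also have "\<dots> = M ^ (1 + e * 2)" by (simp add: Me)
        also have "\<dots> \<le> M ^ a" by (intro pb(1)) (simp add: a_def)
        finally show ?thesis using N by simp
      qed
      have "real N / M ^ e \<le> real N / (2 * M\<^sup>2)"
      proof (rule divide_left_mono)
        have "2 * M\<^sup>2 \<le> M ^ 5" using M5 zero_le_power2[of M] by linarith
        also have "\<dots> \<le> M ^ e" by (intro pb(1)) (simp add: e_def)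
        finally show "2 * M\<^sup>2 \<le> M ^ e" .
      qed (use M in auto)
      with cardH have cardH': "real (card H) \<ge> real N / M ^ e" by linarith
      obtain q where q: "1 \<le> q" "real_of_int q \<le> 25 * (M ^ e) ^ 3"
        "dist_nearest_int (of_int q * (real (Suc (Suc k)) * \<gamma>)) \<le> 200 * (M ^ e) ^ 4 * \<delta> / real N"
        using linear_recurrence_multiplier[OF pb(2)[of e] N2 _ cardH' step \<delta>0 cond]
        unfolding H_def by blast
      have "dist_nearest_int (of_int (q * int (Suc (Suc k))) * \<gamma>) \<le> 200 * (M ^ e) ^ 4 * \<delta> / real N"
        using q(3) by (simp add: mult_ac)
      also have "\<dots> = 200 * (M ^ e) ^ 5 / real N ^ Suc (Suc k)" by (simp add: \<delta>_def eval_nat_numeral mult_ac)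
      also have "\<dots> = 200 * M ^ (5 * e) / real N ^ Suc (Suc k)" by (simp only: Me mult.commute[of e 5])
      also have "\<dots> \<le> M ^ C / real N ^ Suc (Suc k)"
      proof (intro divide_right_mono mult_right_mono)
        have "200 * M ^ (5 * e) \<le> M ^ 8 * M ^ (5 * e)" using pb(3)[of 8] M by (intro mult_right_mono) auto
        also have "\<dots> = M ^ (8 + 5 * e)" by (simp add: power_add)
        also have "\<dots> \<le> M ^ C" by (intro pb(1)) (simp add: C_def)
        finally show "200 * M ^ (5 * e) \<le> M ^ C" .
      qed auto
      finally have fin1: "dist_nearest_int (of_int (q * int (Suc (Suc k))) * \<gamma>) \<le> M ^ C / real N ^ Suc (Suc k)" .
      have "real_of_int (q * int (Suc (Suc k))) = of_int q * real (Suc (Suc k))" by simp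
      also have "\<dots> \<le> (25 * (M ^ e) ^ 3) * M ^ Suc k" using q(2) Suc_le_power[OF M, of "Suc k"] q(1) M
        by (intro mult_mono) auto
      also have "\<dots> = 25 * M ^ (3 * e + Suc k)" by (simp only: Me mult.commute[of e 3] power_add mult.assoc)
      also have "\<dots> \<le> M ^ 5 * M ^ (3 * e + Suc k)" using pb(3)[of 5] M by (intro mult_right_mono) auto
      also have "\<dots> = M ^ (5 + (3 * e + Suc k))" by (simp only: power_add)
      also have "\<dots> \<le> M ^ C" by (intro pb(1)) (simp add: C_def)
      finally have fin2: "real_of_int (q * int (Suc (Suc k))) \<le> M ^ C" .
      have "1 \<le> q * int (Suc (Suc k))" using q(1) by (simp add: int_one_le_iff_zero_less)
      with fin1 fin2 show ?thesis by blast
    qed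
  qed
qed

section \<open>Vaughan's identity\<close>

definition moebius_mu :: "nat \<Rightarrow> real" where
  "moebius_mu n = (if squarefree n then (-1) ^ card (prime_factors n) else 0)"

lemma abs_moebius_mu_le: "\<bar>moebius_mu n\<bar> \<le> 1"
  by (simp add: moebius_mu_def)

lemma moebius_mu_prime_mult:
  assumes "prime p" "\<not> p dvd d"
  shows "moebius_mu (p * d) = - moebius_mu d"
proof -
  have d: "d \<noteq> 0" using assms by (intro notI) simp
  have cop: "coprime p d" using assms by (simp add: prime_imp_coprime)
  have "prime_factors (p * d) = insert p (prime_factors d)"
    using assms d by (simp add: prime_factors_product prime_prime_factors)
  moreover have "p \<notin> prime_factors d" using assms by (auto dest: in_prime_factors_imp_dvd)
  moreover have "squarefree (p * d) \<longleftrightarrow> squarefree d"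
    using cop squarefree_mult_coprime[of p d] assms(1) squarefree_multD(2)[of p d] squarefree_prime[of p] by auto
  ultimately show ?thesis by (simp add: moebius_mu_def)
qed

lemma moebius_mu_square_dvd:
  assumes "prime p" "p dvd d"
  shows "moebius_mu (p * d) = 0"
proof -
  have "p\<^sup>2 dvd p * d" using assms(2) by (simp add: power2_eq_square)
  moreover have "\<not> p dvd 1" using assms(1) by (metis not_prime_unit)
  ultimately have "\<not> squarefree (p * d)" unfolding squarefree_def by blast
  then show ?thesis by (simp add: moebius_mu_def)
qed

text \<open>Fix a prime \<open>p\<close> dividing \<open>n\<close>. A divisor \<open>d\<close> prime
  to \<open>p\<close> cancels against \<open>p * d\<close>, and the remaining divisors are divisible
  by the square of \<open>p\<close> and contribute 0.\<close>

lemma sum_moebius_mu_divisors: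
  assumes "n > 1"
  shows "(\<Sum>d | d dvd n. moebius_mu d) = 0"
proof -
  obtain p where p: "prime p" "p dvd n" using assms prime_factor_nat[of n] by auto
  have fin: "finite {d. d dvd n}" using assms by simp
  define A where "A = {d. p * d dvd n \<and> \<not> p dvd d}"
  have "A \<subseteq> {d. d dvd n}" by (auto simp: A_def elim: dvd_trans)
  then have finA: "finite A" using fin finite_subset by blast
  have p0: "p > 0" using p by (simp add: prime_gt_0_nat)
  have "(\<Sum>d | d dvd n. moebius_mu d) = (\<Sum>d | d dvd n \<and> \<not> p dvd d. moebius_mu d) + (\<Sum>d | d dvd n \<and> p dvd d. moebius_mu d)"
    using fin by (subst sum.union_disjoint[symmetric]) (auto intro: sum.cong finite_subset[OF _ fin])
  also have "(\<Sum>d | d dvd n \<and> \<not> p dvd d. moebius_mu d) = (\<Sum>d\<in>A. moebius_mu d)"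
  proof (rule sum.cong)
    show "{d. d dvd n \<and> \<not> p dvd d} = A"
      using p by (auto simp: A_def prime_imp_coprime intro: divides_mult dest: dvd_mult_right)
  qed auto
  also have "(\<Sum>d | d dvd n \<and> p dvd d. moebius_mu d) = (\<Sum>e | p * e dvd n. moebius_mu (p * e))"
    by (rule sum.reindex_bij_witness[of _ "\<lambda>e. p * e" "\<lambda>d. d div p"]) (use p0 in auto)
  also have "\<dots> = (\<Sum>e\<in>A. moebius_mu (p * e))"
  proof (rule sum.mono_neutral_right)
    have "{e. p * e dvd n} \<subseteq> {d. d dvd n}" by (auto elim: dvd_trans)
    then show "finite {e. p * e dvd n}" using fin finite_subset by blast
  qed (auto simp: A_def moebius_mu_square_dvd p)
  also have "\<dots> = - (\<Sum>e\<in>A. moebius_mu e)"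
    using p by (simp add: A_def moebius_mu_prime_mult sum_negf)
  finally show ?thesis by simp
qed

text \<open>The Dirichlet convolution of the constant 1 with the part of the Moebius function beyond
  \<open>V\<close>; it is one of the two coefficients of the type II sum.\<close>

definition vaughan_coeff :: "real \<Rightarrow> nat \<Rightarrow> real" where
  "vaughan_coeff V a = (\<Sum>d | d dvd a \<and> real d > V. moebius_mu d)"

lemma abs_vaughan_coeff_le: "a > 0 \<Longrightarrow> \<bar>vaughan_coeff V a\<bar> \<le> real (card {d. d dvd a})"
proof -
  assume a: "a > 0"
  have "\<bar>vaughan_coeff V a\<bar> \<le> (\<Sum>d | d dvd a \<and> real d > V. \<bar>moebius_mu d\<bar>)"
    unfolding vaughan_coeff_def by (rule sum_abs)
  also have "\<dots> \<le> (\<Sum>d | d dvd a \<and> real d > V. 1)" by (intro sum_mono abs_moebius_mu_le)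
  also have "\<dots> \<le> real (card {d. d dvd a})" using a by (auto intro!: card_mono)
  finally show ?thesis .
qed

lemma vaughan_coeff_eq_0:
  assumes "a > 0" "real a \<le> V" shows "vaughan_coeff V a = 0"
proof -
  have "\<not> real d > V" if "d dvd a" for d
  proof -
    have "d \<le> a" using that assms by (intro dvd_imp_le)
    then show ?thesis using assms by linarith
  qed
  then have "{d. d dvd a \<and> real d > V} = {}" by auto
  then show ?thesis unfolding vaughan_coeff_def by (simp only: sum.empty)
qed

text \<open>Both sides run over the pairs with \<open>c * d\<close> dividing
  \<open>n\<close>.\<close>

lemma sum_divisor_pairs_swap:
  fixes F :: "nat \<Rightarrow> nat \<Rightarrow> real"
  assumes "n > 0"
  shows "(\<Sum>d | d dvd n. \<Sum>c | c dvd n div d. F c d) = (\<Sum>c | c dvd n. \<Sum>d | d dvd n div c. F c d)"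
proof -
  have eq: "{c. c dvd n div d} = {c \<in> {c. c dvd n}. c * d dvd n}" if "d dvd n" for d
  proof -
    from that obtain k where k: "n = d * k" by (elim dvdE)
    with assms show ?thesis by (auto intro: dvd_mult)
  qed
  have "(\<Sum>d | d dvd n. \<Sum>c | c dvd n div d. F c d) = (\<Sum>d | d dvd n. \<Sum>c | c \<in> {c. c dvd n} \<and> c * d dvd n. F c d)"
    by (intro sum.cong refl) (use eq in auto)
  also have "\<dots> = (\<Sum>c | c dvd n. \<Sum>d | d \<in> {d. d dvd n} \<and> c * d dvd n. F c d)"
    using assms by (intro sum.swap_restrict) auto
  also have "\<dots> = (\<Sum>c | c dvd n. \<Sum>d | d dvd n div c. F c d)"
    by (intro sum.cong refl) (use eq in \<open>auto simp: mult.commute\<close>)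
  finally show ?thesis .
qed

text \<open>In the first two sums \<open>d \<le> V\<close>, and \<open>ln (n / d)\<close> minus the inner sum over \<open>c \<le> U\<close> is the sum of
  \<open>mangoldt c\<close> over \<open>c > U\<close>. The third sum supplies the remaining \<open>d > V\<close>, so that the sum over
  all \<open>d\<close> collapses by Moebius inversion.\<close>
lemma vaughan_identity:
  assumes n: "n > 0" "real n > U"
  shows "mangoldt n = (\<Sum>d | d dvd n \<and> real d \<le> V. moebius_mu d * ln (real (n div d)))
     - (\<Sum>d | d dvd n \<and> real d \<le> V. \<Sum>c | c dvd n div d \<and> real c \<le> U. moebius_mu d * mangoldt c)
     + (\<Sum>c | c dvd n \<and> real c > U. mangoldt c * vaughan_coeff V (n div c))"
proof -
  have fin: "finite {d. d dvd k}" if "k > 0" for k :: nat using that by simp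
  have divpos: "n div d > 0" if "d dvd n" for d using that n by (metis dvd_div_eq_0_iff neq0_conv)
  have split: "(\<Sum>c | c dvd k. F c) = (\<Sum>c | c dvd k \<and> real c \<le> U. F c) + (\<Sum>c | c dvd k \<and> real c > U. F c)"
    if "k > 0" for k U and F :: "nat \<Rightarrow> real"
    using fin[OF that] by (subst sum.union_disjoint[symmetric]) (auto intro: sum.cong finite_subset[OF _ fin[OF that]])
  define L where "L c = (if real c > U then mangoldt c else 0 :: real)" for c
  have 1: "moebius_mu d * ln (real (n div d)) - (\<Sum>c | c dvd n div d \<and> real c \<le> U. moebius_mu d * mangoldt c)
      = (\<Sum>c | c dvd n div d. moebius_mu d * L c)" if d: "d dvd n" for d
  proof -
    have "ln (real (n div d)) = (\<Sum>c | c dvd n div d. mangoldt c)"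
      using mangoldt_sum[of "n div d", where 'a = real] divpos[OF d] by simp
    also have "\<dots> = (\<Sum>c | c dvd n div d \<and> real c \<le> U. mangoldt c) + (\<Sum>c | c dvd n div d \<and> real c > U. mangoldt c)"
      by (rule split[OF divpos[OF d]])
    also have "(\<Sum>c | c dvd n div d \<and> real c > U. mangoldt c) = (\<Sum>c | c dvd n div d. L c)"
      unfolding L_def using fin[OF divpos[OF d]] by (simp add: sum.inter_filter[symmetric])
    finally show ?thesis by (simp add: algebra_simps sum_distrib_left)
  qed
  have 2: "(\<Sum>d | d dvd n \<and> real d \<le> V. moebius_mu d * ln (real (n div d)))
     - (\<Sum>d | d dvd n \<and> real d \<le> V. \<Sum>c | c dvd n div d \<and> real c \<le> U. moebius_mu d * mangoldt c)
     = (\<Sum>d | d dvd n \<and> real d \<le> V. \<Sum>c | c dvd n div d. moebius_mu d * L c)"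
    by (subst sum_subtractf[symmetric]) (intro sum.cong, use 1 in auto)
  have 3: "(\<Sum>c | c dvd n \<and> real c > U. mangoldt c * vaughan_coeff V (n div c))
      = (\<Sum>d | d dvd n \<and> real d > V. \<Sum>c | c dvd n div d. moebius_mu d * L c)"
  proof -
    have "(\<Sum>c | c dvd n \<and> real c > U. mangoldt c * vaughan_coeff V (n div c))
       = (\<Sum>c | c dvd n. L c * vaughan_coeff V (n div c))"
      using fin[OF n(1)] by (intro sum.mono_neutral_cong_left) (auto simp: L_def)
    also have "\<dots> = (\<Sum>c | c dvd n. \<Sum>d | d dvd n div c. (if real d > V then moebius_mu d * L c else 0))"
      unfolding vaughan_coeff_def
      by (intro sum.cong refl) (simp add: sum.inter_filter fin divpos sum_distrib_left mult.commute flip: sum.inter_filter)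
    also have "\<dots> = (\<Sum>d | d dvd n. \<Sum>c | c dvd n div d. (if real d > V then moebius_mu d * L c else 0))"
      by (rule sum_divisor_pairs_swap[OF n(1), symmetric])
    also have "\<dots> = (\<Sum>d | d dvd n. if real d > V then (\<Sum>c | c dvd n div d. moebius_mu d * L c) else 0)"
      by (intro sum.cong) auto
    also have "\<dots> = (\<Sum>d | d dvd n \<and> real d > V. \<Sum>c | c dvd n div d. moebius_mu d * L c)"
      using fin[OF n(1)] by (simp add: sum.inter_filter[symmetric])
    finally show ?thesis .
  qed
  have "(\<Sum>d | d dvd n. \<Sum>c | c dvd n div d. moebius_mu d * L c) = (\<Sum>c | c dvd n. \<Sum>d | d dvd n div c. moebius_mu d * L c)"
    by (rule sum_divisor_pairs_swap[OF n(1)])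
  \<comment> \<open>For a proper divisor \<open>c\<close> the quotient \<open>n div c\<close>
    exceeds 1 and its Moebius sum vanishes. The surviving \<open>L n\<close> equals
    \<open>mangoldt n\<close> because \<open>n\<close> is beyond the cutoff
    \<open>U\<close>.\<close>
  also have "\<dots> = (\<Sum>c | c dvd n. if c = n then L n else 0)"
  proof (intro sum.cong refl)
    fix c assume "c \<in> {c. c dvd n}"
    then have c: "c dvd n" by simp
    show "(\<Sum>d | d dvd n div c. moebius_mu d * L c) = (if c = n then L n else 0)"
    proof (cases "c = n")
      case True
      then show ?thesis using n by (simp add: moebius_mu_def)
    next
      case False
      then have "n div c > 1" using c n by (auto elim!: dvdE) 
      then show ?thesis using False sum_moebius_mu_divisors[of "n div c"] by (simp flip: sum_distrib_right)
    qed
  qed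
  also have "\<dots> = mangoldt n" using n by (simp add: L_def)
  finally show ?thesis using 2 3 split[OF n(1), of "\<lambda>d. \<Sum>c | c dvd n div d. moebius_mu d * L c" V] by simp
qed

section \<open>Second moment of the divisor function\<close>

lemma harm_le: "n > 0 \<Longrightarrow> harm n \<le> 1 + ln (real n)"
  using euler_mascheroni_sequence_decreasing[of 1 n] by (simp add: harm_def)

lemma card_multiples_le:
  assumes "l > 0"
  shows "real (card {a\<in>{1..y}. l dvd a}) \<le> real y / real l"
proof -
  have "{a\<in>{1..y}. l dvd a} \<subseteq> (\<lambda>j. l * j) ` {1..y div l}"
  proof
    fix a assume a: "a \<in> {a\<in>{1..y}. l dvd a}"
    then obtain j where j: "a = l * j" by (auto elim: dvdE)
    with a assms have "j \<in> {1..y div l}" by (auto simp: less_eq_div_iff_mult_less_eq mult.commute intro: Suc_leI)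
    with j show "a \<in> (\<lambda>j. l * j) ` {1..y div l}" by blast
  qed
  then have "card {a\<in>{1..y}. l dvd a} \<le> card {1..y div l}" by (rule surj_card_le[rotated]) simp
  then have "real (card {a\<in>{1..y}. l dvd a}) \<le> real (y div l)" by simp
  also have "\<dots> \<le> real y / real l"
  proof -
    have "real (y div l * l) \<le> real y" by (intro of_nat_mono div_times_less_eq_dividend)
    then show ?thesis using assms by (simp add: le_divide_eq)
  qed
  finally show ?thesis .
qed

text \<open>The square counts pairs of divisors, and at most \<open>y / lcm d e\<close> values of
  \<open>a\<close> admit a given pair. Dividing \<open>d\<close> and \<open>e\<close> by their gcd
  \<open>g\<close> writes the lcm as \<open>g * d' * e'\<close>; summing over all triples, without
  the coprimality condition, gives a cube of a harmonic sum.\<close>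

lemma sum_divisor_count_square_le:
  assumes y: "y > 0"
  shows "(\<Sum>a\<in>{1..y}. real (card {d. d dvd a}) ^ 2) \<le> real y * (1 + ln (real y)) ^ 3"
proof -
  define I where "I = {1..y}"
  have fI: "finite I" by (simp add: I_def)
  have "(\<Sum>a\<in>I. real (card {d. d dvd a}) ^ 2) = (\<Sum>a\<in>I. \<Sum>d\<in>I. \<Sum>e\<in>I. if d dvd a \<and> e dvd a then 1 else 0)"
  proof (rule sum.cong)
    fix a assume "a \<in> I"
    then have a: "0 < a" "a \<le> y" by (auto simp: I_def)
    have "{d. d dvd a} = {d\<in>I. d dvd a}" using a by (auto simp: I_def dest: dvd_imp_le intro: Suc_leI dvd_pos_nat)
    then have c: "real (card {d. d dvd a}) = (\<Sum>d\<in>I. if d dvd a then 1 else 0)"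
      using fI by (simp add: sum.inter_filter[symmetric])
    show "real (card {d. d dvd a}) ^ 2 = (\<Sum>d\<in>I. \<Sum>e\<in>I. if d dvd a \<and> e dvd a then 1 else 0)"
      unfolding c power2_eq_square sum_product by (intro sum.cong) auto
  qed auto
  also have "\<dots> = (\<Sum>d\<in>I. \<Sum>a\<in>I. \<Sum>e\<in>I. if d dvd a \<and> e dvd a then 1 else 0)"
    by (rule sum.swap)
  also have "\<dots> = (\<Sum>d\<in>I. \<Sum>e\<in>I. \<Sum>a\<in>I. if d dvd a \<and> e dvd a then 1 else 0)"
    by (rule sum.cong[OF refl], rule sum.swap)
  also have "\<dots> \<le> (\<Sum>d\<in>I. \<Sum>e\<in>I. real y / real (lcm d e))"
  proof (intro sum_mono)
    fix d e assume "d \<in> I" "e \<in> I"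
    then have "lcm d e > 0" by (auto simp: I_def lcm_pos_nat)
    then have "real (card {a\<in>{1..y}. lcm d e dvd a}) \<le> real y / real (lcm d e)" by (rule card_multiples_le)
    then show "(\<Sum>a\<in>I. if d dvd a \<and> e dvd a then 1 else 0) \<le> real y / real (lcm d e)"
      unfolding I_def by (simp add: sum.inter_filter[symmetric])
  qed
  also have "\<dots> = (\<Sum>(d, e)\<in>I \<times> I. real y / real (lcm d e))" by (simp add: sum.cartesian_product)
  also have "\<dots> = (\<Sum>p\<in>I \<times> I. (\<lambda>(g, d, e). real y / (real g * real d * real e)) 
      ((\<lambda>(d, e). (gcd d e, d div gcd d e, e div gcd d e)) p))"
  proof (intro sum.cong refl)
    fix p assume "p \<in> I \<times> I"
    then obtain d e where p: "p = (d, e)" "d \<in> I" "e \<in> I" by auto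
    then have pos: "d > 0" "e > 0" by (auto simp: I_def)
    then have g: "gcd d e > 0" by simp
    have "lcm d e = gcd d e * (d div gcd d e) * (e div gcd d e)"
      by (metis dvd_div_mult_self gcd_dvd1 gcd_dvd2 lcm_nat_def mult.commute div_mult_swap)
    then have "real (lcm d e) = real (gcd d e) * real (d div gcd d e) * real (e div gcd d e)"
      by (metis of_nat_mult)
    then show "(case p of (d, e) \<Rightarrow> real y / real (lcm d e)) = (\<lambda>(g, d, e). real y / (real g * real d * real e))
      ((\<lambda>(d, e). (gcd d e, d div gcd d e, e div gcd d e)) p)"
      by (simp only: p prod.case)
  qed
  also have "\<dots> = sum (\<lambda>(g, d, e). real y / (real g * real d * real e)) 
      ((\<lambda>(d, e). (gcd d e, d div gcd d e, e div gcd d e)) ` (I \<times> I))"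
  proof (rule sum.reindex[symmetric, unfolded o_def])
    show "inj_on (\<lambda>(d, e). (gcd d e, d div gcd d e, e div gcd d e)) (I \<times> I)"
      by (rule inj_onI) (auto, metis dvd_div_mult_self gcd_dvd1, metis dvd_div_mult_self gcd_dvd2)
  qed
  also have "\<dots> \<le> sum (\<lambda>(g, d, e). real y / (real g * real d * real e)) (I \<times> I \<times> I)"
  proof (rule sum_mono2)
    have "gcd d e \<in> I \<and> d div gcd d e \<in> I" if "d \<in> I" for d e
    proof -
      from that have d: "0 < d" "d \<le> y" by (auto simp: I_def)
      then have "gcd d e \<le> d" by (intro dvd_imp_le) auto
      moreover have "d div gcd d e > 0" "gcd d e > 0" using d by (auto simp: div_greater_zero_iff intro: dvd_imp_le)
      moreover have "d div gcd d e \<le> d" by simp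
      ultimately have "0 < gcd d e \<and> gcd d e \<le> y \<and> 0 < d div gcd d e \<and> d div gcd d e \<le> y"
        using d by linarith
      then show ?thesis by (simp only: I_def atLeastAtMost_iff One_nat_def Suc_le_eq)
    qed
    note * = this
    have "e div gcd d e \<in> I" if "e \<in> I" for d e using *[OF that, of d] by (simp add: gcd.commute)
    with * show "(\<lambda>(d, e). (gcd d e, d div gcd d e, e div gcd d e)) ` (I \<times> I) \<subseteq> I \<times> I \<times> I" by auto
  qed (auto simp: fI)
  also have "\<dots> = (\<Sum>g\<in>I. \<Sum>d\<in>I. \<Sum>e\<in>I. real y / (real g * real d * real e))"
    by (simp add: sum.cartesian_product)
  also have "\<dots> = real y * harm y ^ 3"
    by (simp add: harm_def I_def power3_eq_cube sum_distrib_left sum_distrib_right field_simps)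
  also have "\<dots> \<le> real y * (1 + ln (real y)) ^ 3"
    using harm_le[OF y] harm_nonneg by (intro mult_left_mono power_mono) auto
  finally show ?thesis by (simp add: I_def)
qed

section \<open>Bilinear sums\<close>

lemma poly_fun_const: "poly_fun (Suc k) 0 (\<lambda>_. c)"
proof (induction k)
  case (Suc k)
  from poly_fun_degree_Suc[OF this] show ?case .
qed simp

lemma weyl_inverse_nat:
  "\<exists>C::nat. \<forall>(M::real) (N::nat) (u::nat) v g \<gamma>.
     M \<ge> 2 \<longrightarrow> N \<ge> 1 \<longrightarrow> poly_fun (Suc k) \<gamma> g \<longrightarrow> v \<le> u + N \<longrightarrow>
     norm (\<Sum>n\<in>{u<..v}. e2pi (g (int n))) \<ge> real N / M \<longrightarrow>
     near_fraction (M ^ C) (M ^ C / real N ^ Suc k) \<gamma>"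
proof -
  obtain C where C: "\<And>(M::real) (N::nat) (u::int) v g \<gamma>.
     M \<ge> 2 \<Longrightarrow> N \<ge> 1 \<Longrightarrow> poly_fun (Suc k) \<gamma> g \<Longrightarrow> v \<le> u + int N \<Longrightarrow>
     norm (\<Sum>n\<in>{u<..v}. e2pi (g n)) \<ge> real N / M \<Longrightarrow>
     near_fraction (M ^ C) (M ^ C / real N ^ Suc k) \<gamma>"
    using weyl_inverse[of k] by metis
  show ?thesis
  proof (rule exI[of _ C], intro allI impI)
    fix M :: real and N u v :: nat and g \<gamma>
    assume h: "M \<ge> 2" "N \<ge> 1" "poly_fun (Suc k) \<gamma> g" "v \<le> u + N"
      "norm (\<Sum>n\<in>{u<..v}. e2pi (g (int n))) \<ge> real N / M"
    have "(\<Sum>n\<in>{u<..v}. e2pi (g (int n))) = (\<Sum>n\<in>{int u<..int v}. e2pi (g n))"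
      by (rule sum.reindex_bij_witness[of _ nat int]) auto
    then show "near_fraction (M ^ C) (M ^ C / real N ^ Suc k) \<gamma>"
      using h by (intro C[of M N \<gamma> g "int v" "int u"]) auto
  qed
qed

lemma div_interval_iff:
  fixes c :: nat
  assumes "c > 0"
  shows "x div c < a \<longleftrightarrow> x < a * c" "a \<le> x div c \<longleftrightarrow> a * c \<le> x"
  using assms by (auto simp: div_less_iff_less_mult less_eq_div_iff_mult_less_eq)

text \<open>Cauchy--Schwarz and an expansion of the square bring the sum over \<open>a\<close> inside, where Weyl's
  inequality applies to \<open>F (a c) - F (a c')\<close> and provides approximations to \<open>(c ^ K - c' ^ K) \<beta>\<close>,
  with \<open>K = Suc k\<close>; recurrence for the monomial \<open>c ^ K\<close> then isolates \<open>\<beta>\<close>.\<close>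
lemma bilinear_inverse:
  "\<exists>E::nat. \<forall>(P::real) (X::nat) (A::nat) X0 X1 F \<beta> (\<xi> :: nat \<Rightarrow> real) (\<eta> :: nat \<Rightarrow> real).
     P \<ge> 2 \<longrightarrow> poly_fun (Suc k) \<beta> F \<longrightarrow> real A \<ge> P ^ E \<longrightarrow> real X \<ge> real A * P ^ E \<longrightarrow> X1 \<le> X \<longrightarrow>
     (\<forall>c\<in>{1..X}. \<bar>\<eta> c\<bar> \<le> P) \<longrightarrow> (\<Sum>a\<in>{A<..2 * A}. (\<xi> a)\<^sup>2) \<le> real A * P \<longrightarrow>
     norm (\<Sum>a\<in>{A<..2 * A}. \<Sum>c\<in>{X0 div a<..X1 div a}. of_real (\<xi> a * \<eta> c) * e2pi (F (int (a * c)))) \<ge> real X / P \<longrightarrow>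
     near_fraction (P ^ E) (P ^ E / real X ^ Suc k) \<beta>"
proof -
  define K where "K = Suc k"
  obtain C0 where W: "\<And>(M::real) (N::nat) (u::nat) v g \<gamma>.
     M \<ge> 2 \<Longrightarrow> N \<ge> 1 \<Longrightarrow> poly_fun K \<gamma> g \<Longrightarrow> v \<le> u + N \<Longrightarrow>
     norm (\<Sum>n\<in>{u<..v}. e2pi (g (int n))) \<ge> real N / M \<Longrightarrow>
     near_fraction (M ^ C0) (M ^ C0 / real N ^ K) \<gamma>"
    using weyl_inverse_nat[of k] unfolding K_def by metis
  obtain C1 where R: "\<And>(M::real) (N::nat) (a::int) g \<gamma> \<delta> S.
     M \<ge> 2 \<Longrightarrow> poly_fun K \<gamma> g \<Longrightarrow> S \<subseteq> {a<..a + int N} \<Longrightarrow> real (card S) \<ge> real N / M \<Longrightarrow>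
     (\<forall>n\<in>S. dist_nearest_int (g n) \<le> \<delta>) \<Longrightarrow> 0 \<le> \<delta> \<Longrightarrow> \<delta> * M ^ C1 \<le> 1 \<Longrightarrow> real N \<ge> M ^ C1 \<Longrightarrow>
     near_fraction (M ^ C1) (M ^ C1 * \<delta> / real N ^ K) \<gamma>"
    using polynomial_recurrence[of K] by metis
  \<comment> \<open>\<open>P ^ r\<close> is the inverse density of the final set of
    \<open>c\<close>: a factor \<open>P ^ 6\<close> from demanding a large correlation with
    \<open>c'\<close>, and \<open>P ^ (6 * C0)\<close> from demanding a common multiplier.\<close>
  define r where "r = 6 + 6 * C0"
  define E where "E = r * C1 + 6 * C0 + K + 1"
  show ?thesis
  proof (rule exI[of _ E], intro allI impI, fold K_def)
    fix P :: real and X A X0 X1 :: nat and F :: "int \<Rightarrow> real" and \<beta> and \<xi> \<eta> :: "nat \<Rightarrow> real"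
    assume P: "P \<ge> 2" and F: "poly_fun K \<beta> F" and A: "real A \<ge> P ^ E" and X: "real X \<ge> real A * P ^ E"
      and X1: "X1 \<le> X" and \<eta>: "\<forall>c\<in>{1..X}. \<bar>\<eta> c\<bar> \<le> P" and \<xi>: "(\<Sum>a\<in>{A<..2 * A}. (\<xi> a)\<^sup>2) \<le> real A * P"
      and large: "norm (\<Sum>a\<in>{A<..2 * A}. \<Sum>c\<in>{X0 div a<..X1 div a}. of_real (\<xi> a * \<eta> c) * e2pi (F (int (a * c)))) \<ge> real X / P"
    note pb = power_bounds[OF P]
    have A1: "real A \<ge> 1" using A pb(2)[of E] by linarith
    then have A0: "A > 0" by simp
    define B where "B = X div A"
    have XA: "real X \<ge> real A" using X A1 pb(2)[of E] mult_left_mono[of 1 "P ^ E" "real A"] by linarith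
    then have X0: "X > 0" using A1 by (intro Nat.gr0I) simp
    have BA: "real B * real A \<le> real X" unfolding B_def by (metis of_nat_le_iff of_nat_mult div_times_less_eq_dividend)
    have BA2: "real X \<le> 2 * real A * real B"
    proof -
      have "X < A * (B + 1)" unfolding B_def using A0 by (metis Suc_eq_plus1 dividend_less_times_div mult_Suc_right add.commute)
      then have "real X \<le> real A * (real B + 1)" by (metis of_nat_le_iff of_nat_mult of_nat_add of_nat_1 less_imp_le)
      moreover have "B \<ge> 1" using XA A0 unfolding B_def by (simp add: Suc_le_eq div_greater_zero_iff)
      then have "real A * (real B + 1) \<le> real A * (real B + real B)" by (intro mult_left_mono) auto
      ultimately show ?thesis by (simp add: mult_ac)
    qed
    have B1: "B \<ge> 1" using XA A0 unfolding B_def by (simp add: Suc_le_eq div_greater_zero_iff)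
    have BX: "B \<le> X" unfolding B_def by simp
    define J where "J = {A<..2 * A}"
    \<comment> \<open>The range of \<open>c\<close> depends on \<open>a\<close>. Recording it as an
      indicator lets \<open>c\<close> run over the fixed range \<open>{1..B}\<close>, so the sums
      can be interchanged after squaring.\<close>
    define I where "I a c \<longleftrightarrow> X0 < a * c \<and> a * c \<le> X1" for a c
    define G where "G a = (\<Sum>c\<in>{1..B}. of_bool (I a c) * of_real (\<eta> c) * e2pi (F (int (a * c))))" for a
    have inner: "(\<Sum>c\<in>{X0 div a<..X1 div a}. of_real (\<xi> a * \<eta> c) * e2pi (F (int (a * c)))) = of_real (\<xi> a) * G a"
      if a: "a \<in> J" for a
    proof -
      have "X1 div a \<le> B" unfolding B_def using a X1 A0 by (auto simp: J_def intro: order_trans[OF div_le_mono div_le_mono2])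
      then have le: "c \<le> X1 div a \<Longrightarrow> c \<le> B" for c by simp
      have a0: "a > 0" using a by (simp add: J_def)
      have eq: "X0 < a * c \<longleftrightarrow> X0 div a < c" "a * c \<le> X1 \<longleftrightarrow> c \<le> X1 div a" for c
        using div_interval_iff[OF a0] by (simp_all add: mult.commute)
      have ge: "X0 div a < c \<Longrightarrow> 1 \<le> c" for c by simp
      have "{X0 div a<..X1 div a} = {c \<in> {1..B}. I a c}"
        unfolding set_eq_iff I_def greaterThanAtMost_iff mem_Collect_eq atLeastAtMost_iff eq using le ge by blast
      then show ?thesis unfolding G_def sum_distrib_left
        by (intro sum.mono_neutral_cong_left) (auto simp: mult_ac)
    qed
    define T where "T c' c = (\<Sum>a\<in>J. of_bool (I a c \<and> I a c') * e2pi (F (int (a * c)) - F (int (a * c'))))" for c' c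
    \<comment> \<open>For fixed \<open>c\<close> and \<open>c'\<close> the two indicators cut out an
      interval of \<open>a\<close>, as Weyl's inequality requires.\<close>
    have T_alt: "T c' c = (\<Sum>n\<in>{max A (max (X0 div c) (X0 div c'))<..min (2 * A) (min (X1 div c) (X1 div c'))}. e2pi (F (int n * int c) - F (int n * int c')))"
      if "c > 0" "c' > 0" for c c'
    proof -
      have "T c' c = (\<Sum>a\<in>{a\<in>J. I a c \<and> I a c'}. e2pi (F (int (a * c)) - F (int (a * c'))))"
        unfolding T_def by (intro sum.mono_neutral_cong_right) (auto simp: J_def)
      also have "{a\<in>J. I a c \<and> I a c'} = {max A (max (X0 div c) (X0 div c'))<..min (2 * A) (min (X1 div c) (X1 div c'))}"
        using that by (auto simp: J_def I_def div_interval_iff)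
      finally show ?thesis by simp
    qed
    have cardJ: "card J = A" by (simp add: J_def)
    have T_le: "norm (T c' c) \<le> real A" for c' c
    proof -
      have "norm (T c' c) \<le> (\<Sum>a\<in>J. 1)" unfolding T_def
        by (rule order_trans[OF norm_sum]) (intro sum_mono, auto simp: norm_mult)
      then show ?thesis by (simp add: cardJ)
    qed
    have "real X / P \<le> norm (\<Sum>a\<in>J. of_real (\<xi> a) * G a)"
      using large inner unfolding J_def by simp
    also have "\<dots> \<le> (\<Sum>a\<in>J. \<bar>\<xi> a\<bar> * norm (G a))"
      by (rule order_trans[OF norm_sum]) (simp add: norm_mult)
    finally have "(real X / P)\<^sup>2 \<le> (\<Sum>a\<in>J. \<bar>\<xi> a\<bar> * norm (G a))\<^sup>2" using P by (intro power_mono) auto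
    also have "\<dots> \<le> (\<Sum>a\<in>J. \<bar>\<xi> a\<bar>\<^sup>2) * (\<Sum>a\<in>J. (norm (G a))\<^sup>2)" by (rule Cauchy_Schwarz_ineq_sum)
    also have "\<dots> \<le> (real A * P) * (\<Sum>a\<in>J. (norm (G a))\<^sup>2)"
      using \<xi> by (intro mult_right_mono) (auto simp: J_def intro: sum_nonneg)
    finally have cs: "(real X / P)\<^sup>2 \<le> real A * P * (\<Sum>a\<in>J. (norm (G a))\<^sup>2)" .
    have "complex_of_real (\<Sum>a\<in>J. (norm (G a))\<^sup>2) = (\<Sum>a\<in>J. G a * cnj (G a))"
      unfolding of_real_sum by (intro sum.cong refl) (rule complex_norm_square)
    also have "\<dots> = (\<Sum>a\<in>J. \<Sum>c\<in>{1..B}. \<Sum>c'\<in>{1..B}. of_real (\<eta> c * \<eta> c') * (of_bool (I a c \<and> I a c') * e2pi (F (int (a * c)) - F (int (a * c')))))"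
      unfolding G_def cnj_sum sum_product e2pi_diff by (intro sum.cong refl) auto
    also have "\<dots> = (\<Sum>c\<in>{1..B}. \<Sum>c'\<in>{1..B}. of_real (\<eta> c * \<eta> c') * T c' c)"
      unfolding T_def sum_distrib_left by (rule trans[OF sum.swap]) (rule sum.cong[OF refl], rule sum.swap)
    finally have sq: "complex_of_real (\<Sum>a\<in>J. (norm (G a))\<^sup>2) = (\<Sum>c\<in>{1..B}. \<Sum>c'\<in>{1..B}. of_real (\<eta> c * \<eta> c') * T c' c)" .
    have "(\<Sum>a\<in>J. (norm (G a))\<^sup>2) = norm (complex_of_real (\<Sum>a\<in>J. (norm (G a))\<^sup>2))"
      by (subst norm_of_real) (simp add: sum_nonneg)
    also have "\<dots> \<le> (\<Sum>c\<in>{1..B}. \<Sum>c'\<in>{1..B}. \<bar>\<eta> c\<bar> * \<bar>\<eta> c'\<bar> * norm (T c' c))"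
      unfolding sq by (intro order_trans[OF norm_sum] sum_mono) (auto intro!: order_trans[OF norm_sum] sum_mono simp: norm_mult abs_mult)
    also have "\<dots> \<le> (\<Sum>c\<in>{1..B}. \<Sum>c'\<in>{1..B}. P * P * norm (T c' c))"
      using \<eta> BX P by (intro sum_mono mult_right_mono mult_mono) auto
    also have "\<dots> = P\<^sup>2 * (\<Sum>c'\<in>{1..B}. \<Sum>c\<in>{1..B}. norm (T c' c))"
      by (subst sum.swap) (simp add: sum_distrib_left power2_eq_square)
    finally have "(real X / P)\<^sup>2 \<le> real A * P * (P\<^sup>2 * (\<Sum>c'\<in>{1..B}. \<Sum>c\<in>{1..B}. norm (T c' c)))"
      using P by (intro order_trans[OF cs] mult_left_mono) auto
    then have "(real X)\<^sup>2 / (real A * P ^ 5) \<le> (\<Sum>c'\<in>{1..B}. \<Sum>c\<in>{1..B}. norm (T c' c))"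
      using P A1 by (simp add: field_simps power2_eq_square eval_nat_numeral)
    \<comment> \<open>Averaging fixes one good \<open>c'\<close>; from here only \<open>c\<close>
      varies, so recurrence in one variable is enough.\<close>
    then obtain c' where c': "c' \<in> {1..B}" "(\<Sum>c\<in>{1..B}. norm (T c' c)) \<ge> (real X)\<^sup>2 / (real A * P ^ 5) / real B"
      using exists_large_term[of "{1..B}" "real B" "(real X)\<^sup>2 / (real A * P ^ 5)" "\<lambda>c'. \<Sum>c\<in>{1..B}. norm (T c' c)"]
        B1 X0 A1 P by auto
    have "real A * real B / P ^ 5 \<le> (real X)\<^sup>2 / (real A * P ^ 5) / real B"
    proof -
      have "(real B * real A) ^ 2 \<le> real X ^ 2" using BA by (intro power_mono) auto
      then show ?thesis using A1 B1 P by (simp add: field_simps power2_eq_square)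
    qed
    with c' have sumT: "(\<Sum>c\<in>{1..B}. norm (T c' c)) \<ge> real A * real B / P ^ 5" by linarith
    define S where "S = {c\<in>{1..B}. norm (T c' c) \<ge> real A / (2 * P ^ 5)}"
    have "real (card S) * real A \<ge> real A * real B / P ^ 5 / 2"
      unfolding S_def by (rule many_large_terms[OF _ _ sumT]) (use T_le P in \<open>auto simp: mult_ac\<close>)
    then have cardS0: "real (card S) \<ge> real B / (2 * P ^ 5)" using A1 P by (simp add: field_simps)
    have P6: "2 * P ^ 5 \<le> P ^ 6" using P mult_right_mono[of 2 P "P ^ 5"] by (simp add: eval_nat_numeral)
    have "real B / P ^ 6 \<le> real B / (2 * P ^ 5)" using P6 P by (intro divide_left_mono) auto
    with cardS0 have cardS: "real (card S) \<ge> real B / P ^ 6" by linarith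
    define \<delta> where "\<delta> = P ^ (6 * C0) / real A ^ K"
    have step: "near_fraction (P ^ (6 * C0)) \<delta> ((of_int (int c) ^ K - of_int (int c') ^ K) * \<beta>)"
      if c: "c \<in> S" for c
    proof -
      have pos: "c > 0" "c' > 0" using c c'(1) by (auto simp: S_def)
      have g: "poly_fun K ((of_int (int c) ^ K - of_int (int c') ^ K) * \<beta>) (\<lambda>n. F (n * int c) - F (n * int c'))"
        using poly_fun_diff[OF poly_fun_affine[OF F, of "int c" 0] poly_fun_affine[OF F, of "int c'" 0]]
        by (simp add: algebra_simps)
      have "real A / P ^ 6 \<le> real A / (2 * P ^ 5)" using P6 P by (intro divide_left_mono) auto
      also have "\<dots> \<le> norm (T c' c)" using c by (simp add: S_def)
      finally have nrm: "norm (\<Sum>n\<in>{max A (max (X0 div c) (X0 div c'))<..min (2 * A) (min (X1 div c) (X1 div c'))}. e2pi (F (int n * int c) - F (int n * int c'))) \<ge> real A / P ^ 6"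
        unfolding T_alt[OF pos] .
      have P62: "P ^ 6 \<ge> 2" using pb(3)[of 6] by simp
      have len: "min (2 * A) (min (X1 div c) (X1 div c')) \<le> max A (max (X0 div c) (X0 div c')) + A" by auto
      have "1 \<le> A" using A0 by simp
      from W[OF P62 this g len nrm]
      show ?thesis by (simp add: \<delta>_def flip: power_mult)
    qed
    obtain f :: "nat \<Rightarrow> int" where f: "\<And>c. c \<in> S \<Longrightarrow> 1 \<le> f c \<and> of_int (f c) \<le> P ^ (6 * C0) \<and> dist_nearest_int (of_int (f c) * ((of_int (int c) ^ K - of_int (int c') ^ K) * \<beta>)) \<le> \<delta>"
      using step by metis
    have finS: "finite S" by (simp add: S_def)
    have "f ` S \<subseteq> {1..\<lfloor>P ^ (6 * C0)\<rfloor>}" using f by (auto simp: le_floor_iff)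
    moreover have "real (card {1..\<lfloor>P ^ (6 * C0)\<rfloor>}) \<le> P ^ (6 * C0)" using P by simp
    ultimately obtain q1 where q1: "real (card S) / P ^ (6 * C0) \<le> real (card {c \<in> S. f c = q1})"
      using pigeonhole_fiber[OF finS _, of "{1..\<lfloor>P ^ (6 * C0)\<rfloor>}" f "P ^ (6 * C0)"] P by auto
    define S' where "S' = {c \<in> S. f c = q1}"
    have cardS': "real (card (int ` S')) \<ge> real B / P ^ r"
    proof -
      have "real B / P ^ r = real B / P ^ 6 / P ^ (6 * C0)" by (simp add: r_def power_add)
      also have "\<dots> \<le> real (card S) / P ^ (6 * C0)" using cardS P by (intro divide_right_mono) auto
      also have "\<dots> \<le> real (card S')" using q1 by (simp add: S'_def)
      finally show ?thesis by (simp add: card_image)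
    qed
    have "0 < real B / P ^ r" using B1 P by simp
    with cardS' have "card (int ` S') \<noteq> 0" by linarith
    then have "int ` S' \<noteq> {}" by (metis card.empty)
    then have q1b: "1 \<le> q1" "of_int q1 \<le> P ^ (6 * C0)" using f by (auto simp: S'_def)
    \<comment> \<open>The term with \<open>c'\<close> is constant in \<open>n\<close>; as
      \<open>K\<close> is positive, it does not affect the leading coefficient.\<close>
    have g: "poly_fun K (of_int q1 * \<beta> * 1 - 0) (\<lambda>n. of_int q1 * \<beta> * of_int n ^ K - of_int q1 * \<beta> * of_int (int c') ^ K)"
      using poly_fun_const[of k] unfolding K_def
      by (intro poly_fun_diff poly_fun_cmult poly_fun_power) blast
    have close: "\<forall>n\<in>int ` S'. dist_nearest_int (of_int q1 * \<beta> * of_int n ^ K - of_int q1 * \<beta> * of_int (int c') ^ K) \<le> \<delta>"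
    proof
      fix n assume "n \<in> int ` S'"
      then obtain c where c: "c \<in> S" "f c = q1" "n = int c" by (auto simp: S'_def)
      have "of_int q1 * ((of_int n ^ K - of_int (int c') ^ K) * \<beta>) = of_int q1 * \<beta> * of_int n ^ K - of_int q1 * \<beta> * of_int (int c') ^ K"
        by (simp add: algebra_simps)
      with f[OF c(1)] c show "dist_nearest_int (of_int q1 * \<beta> * of_int n ^ K - of_int q1 * \<beta> * of_int (int c') ^ K) \<le> \<delta>" by simp
    qed
    have \<delta>0: "0 \<le> \<delta>" using P by (simp add: \<delta>_def)
    have Pr: "(P ^ r) ^ C1 = P ^ (r * C1)" by (simp flip: power_mult)
    have \<delta>_small: "\<delta> * (P ^ r) ^ C1 \<le> 1"
    proof -
      have "P ^ (6 * C0) * (P ^ r) ^ C1 = P ^ (6 * C0 + r * C1)" by (simp add: Pr power_add)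
      also have "\<dots> \<le> P ^ E" by (intro pb(1)) (simp add: E_def)
      also have "\<dots> \<le> real A ^ 1" using A by simp
      also have "\<dots> \<le> real A ^ K" using A1 by (intro power_increasing) (auto simp: K_def)
      finally show ?thesis using A1 by (simp add: \<delta>_def divide_le_eq)
    qed
    have B_large: "real B \<ge> (P ^ r) ^ C1"
    proof -
      have "real A * P ^ E \<le> real A * (2 * real B)" using X BA2 by (simp add: mult_ac)
      then have "P ^ E \<le> 2 * real B" using A1 by simp
      moreover have "2 * P ^ (r * C1) \<le> P ^ E"
      proof -
        have "2 * P ^ (r * C1) \<le> P * P ^ (r * C1)" using P by (intro mult_right_mono) auto
        also have "\<dots> = P ^ (Suc (r * C1))" by simp
        also have "\<dots> \<le> P ^ E" by (intro pb(1)) (simp add: E_def)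
        finally show ?thesis .
      qed
      ultimately show ?thesis unfolding Pr by linarith
    qed
    have r2: "P ^ r \<ge> 2" using P pb(1)[of 1 r] by (simp add: r_def)
    have sub: "int ` S' \<subseteq> {0<..0 + int B}" by (auto simp: S'_def S_def)
    obtain q2 :: int where q2: "1 \<le> q2" "of_int q2 \<le> (P ^ r) ^ C1"
      "dist_nearest_int (of_int q2 * (of_int q1 * \<beta> * 1 - 0)) \<le> (P ^ r) ^ C1 * \<delta> / real B ^ K"
      using R[OF r2 g sub cardS' close \<delta>0 \<delta>_small B_large] by blast
    have "1 \<le> q2 * q1" using q1b q2 by (simp add: int_one_le_iff_zero_less)
    moreover have "real_of_int (q2 * q1) \<le> P ^ E"
    proof -
      have "real_of_int (q2 * q1) \<le> (P ^ r) ^ C1 * P ^ (6 * C0)" unfolding of_int_mult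
        using q2 q1b P by (intro mult_mono) auto
      also have "\<dots> = P ^ (r * C1 + 6 * C0)" by (simp add: Pr power_add)
      also have "\<dots> \<le> P ^ E" by (intro pb(1)) (simp add: E_def)
      finally show ?thesis .
    qed
    moreover have "dist_nearest_int (of_int (q2 * q1) * \<beta>) \<le> P ^ E / real X ^ K"
    proof -
      have "dist_nearest_int (of_int (q2 * q1) * \<beta>) \<le> P ^ (r * C1) * \<delta> / real B ^ K"
        using q2(3) by (simp add: Pr mult_ac)
      \<comment> \<open>Weyl's inequality supplied \<open>1 / A ^ K\<close> and recurrence
        \<open>1 / B ^ K\<close>. Since \<open>A * B\<close> is at least half of \<open>X\<close>,
        their product is the desired \<open>1 / X ^ K\<close> up to the factor
        \<open>2 ^ K\<close>.\<close>
      also have "\<dots> = P ^ (r * C1 + 6 * C0) / (real A * real B) ^ K"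
        by (simp add: \<delta>_def power_add power_mult_distrib)
      also have "\<dots> = P ^ (r * C1 + 6 * C0) * 2 ^ K / (2 * real A * real B) ^ K"
        by (simp add: power_mult_distrib)
      also have "\<dots> \<le> P ^ (r * C1 + 6 * C0) * 2 ^ K / real X ^ K"
        using BA2 X0 P A1 B1 by (intro divide_left_mono power_mono mult_pos_pos zero_less_power) auto
      also have "\<dots> \<le> P ^ E / real X ^ K"
      proof (intro divide_right_mono)
        have "P ^ (r * C1 + 6 * C0) * 2 ^ K \<le> P ^ (r * C1 + 6 * C0) * P ^ K" using P pb(3)[of K] by (intro mult_left_mono) auto
        also have "\<dots> = P ^ (r * C1 + 6 * C0 + K)" by (simp add: power_add)
        also have "\<dots> \<le> P ^ E" by (intro pb(1)) (simp add: E_def)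
        finally show "P ^ (r * C1 + 6 * C0) * 2 ^ K \<le> P ^ E" .
      qed auto
      finally show ?thesis .
    qed
    ultimately show "near_fraction (P ^ E) (P ^ E / real X ^ K) \<beta>" by blast
  qed
qed

section \<open>The leading coefficient\<close>

text \<open>Partial summation with tail sums: subtracting the first weight from all weights splits
  off one full tail and leaves the same problem on a shorter range. The shift \<open>c\<close> is
  there so that this induction closes. It serves to remove the logarithm from the type I
  sums.\<close>

lemma norm_sum_monotone_weights_le:
  fixes w :: "nat \<Rightarrow> real" and z :: "nat \<Rightarrow> complex"
  assumes "mono w" "u \<le> v" "c \<le> w (Suc u)" "c \<le> w v"
    and B: "\<And>t. norm (\<Sum>n\<in>{t<..v}. z n) \<le> B"
  shows "norm (\<Sum>n\<in>{u<..v}. of_real (w n - c) * z n) \<le> (w v - c) * B"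
  using assms(2-4)
proof (induction u arbitrary: c rule: inc_induct)
  case base
  have "0 \<le> B" using B[of 0] norm_ge_zero order_trans by blast
  with base show ?case by simp
next
  case (step u)
  have ins: "{u<..v} = insert (Suc u) {Suc u<..v}" using step.hyps by auto
  have "(\<Sum>n\<in>{u<..v}. of_real (w n - c) * z n)
      = (\<Sum>n\<in>{u<..v}. of_real (w n - w (Suc u)) * z n) + of_real (w (Suc u) - c) * (\<Sum>n\<in>{u<..v}. z n)"
    by (simp add: sum_distrib_left algebra_simps flip: sum.distrib)
  also have "(\<Sum>n\<in>{u<..v}. of_real (w n - w (Suc u)) * z n) = (\<Sum>n\<in>{Suc u<..v}. of_real (w n - w (Suc u)) * z n)"
    unfolding ins by simp
  also have "norm (\<dots> + of_real (w (Suc u) - c) * (\<Sum>n\<in>{u<..v}. z n)) \<le> (w v - w (Suc u)) * B + (w (Suc u) - c) * B"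
  proof (rule order_trans[OF norm_triangle_ineq] add_mono)+
    show "norm (\<Sum>n\<in>{Suc u<..v}. of_real (w n - w (Suc u)) * z n) \<le> (w v - w (Suc u)) * B"
      using assms(1) step.hyps by (intro step.IH) (auto simp: mono_def)
    show "norm (of_real (w (Suc u) - c) * (\<Sum>n\<in>{u<..v}. z n)) \<le> (w (Suc u) - c) * B"
      using step.prems(1) B[of u] by (simp only: norm_mult norm_of_real) (simp add: mult_left_mono)
  qed
  finally show ?case by (simp add: algebra_simps)
qed

text \<open>Floors are exact for half-open intervals, since \<open>X0 < d * n\<close> holds iff
  \<open>X0 div d < n\<close>. The identity can thus be applied again to the resulting
  intervals.\<close>

lemma sum_divisors_interval:
  fixes G :: "nat \<Rightarrow> nat \<Rightarrow> complex"
  shows "(\<Sum>x\<in>{X0<..X1}. \<Sum>d | d dvd x \<and> d \<le> W. G d (x div d))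
    = (\<Sum>d\<in>{1..W}. \<Sum>n\<in>{X0 div d<..X1 div d}. G d n)"
proof -
  have fin: "finite {d. d dvd x \<and> d \<le> W}" for x :: nat by (rule finite_subset[of _ "{..W}"]) auto
  have "(\<Sum>x\<in>{X0<..X1}. \<Sum>d | d dvd x \<and> d \<le> W. G d (x div d))
    = (\<Sum>(x, d)\<in>(SIGMA x:{X0<..X1}. {d. d dvd x \<and> d \<le> W}). G d (x div d))"
    using fin by (subst sum.Sigma) auto
  also have "\<dots> = (\<Sum>(d, n)\<in>(SIGMA d:{1..W}. {X0 div d<..X1 div d}). G d n)"
  proof (rule sum.reindex_bij_witness[of _ "\<lambda>(d, n). (d * n, d)" "\<lambda>(x, d). (d, x div d)"])
    fix p assume "p \<in> (SIGMA x:{X0<..X1}. {d. d dvd x \<and> d \<le> W})"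
    then obtain x d where p: "p = (x, d)" "X0 < x" "x \<le> X1" "d dvd x" "d \<le> W" by auto
    then obtain n where n: "x = d * n" by (auto elim: dvdE)
    with p have d: "d > 0" by (intro Nat.gr0I) auto
    show "(\<lambda>(d, n). (d * n, d)) ((\<lambda>(x, d). (d, x div d)) p) = p" using p by simp
    show "(\<lambda>(x, d). (d, x div d)) p \<in> (SIGMA d:{1..W}. {X0 div d<..X1 div d})"
      using p n d by (simp add: div_interval_iff Suc_le_eq mult.commute)
    show "(case (\<lambda>(x, d). (d, x div d)) p of (d, n) \<Rightarrow> G d n) = (case p of (x, d) \<Rightarrow> G d (x div d))"
      by (simp add: p)
  next
    fix p assume "p \<in> (SIGMA d:{1..W}. {X0 div d<..X1 div d})"
    then obtain d n where p: "p = (d, n)" "d > 0" "d \<le> W" "X0 div d < n" "n \<le> X1 div d" by auto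
    show "(\<lambda>(x, d). (d, x div d)) ((\<lambda>(d, n). (d * n, d)) p) = p" using p by simp
    show "(\<lambda>(d, n). (d * n, d)) p \<in> (SIGMA x:{X0<..X1}. {d. d dvd x \<and> d \<le> W})"
      using p div_interval_iff[OF p(2)] by (simp add: mult.commute)
  qed
  also have "\<dots> = (\<Sum>d\<in>{1..W}. \<Sum>n\<in>{X0 div d<..X1 div d}. G d n)"
    by (subst sum.Sigma) auto
  finally show ?thesis .
qed

text \<open>Both cutoffs of Vaughan's identity are \<open>W\<close>, and \<open>W \<le> X0\<close>
  makes it valid at every \<open>x\<close> in the range. The last sum is indexed by the
  complementary divisor \<open>a = x div c\<close>, so that \<open>a\<close> carries the Moebius
  coefficient and \<open>c\<close> the von Mangoldt weight.\<close>

lemma vaughan_sum: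
  fixes g :: "nat \<Rightarrow> complex" and W :: nat
  defines "\<eta> \<equiv> (\<lambda>c. if c > W then mangoldt c else 0 :: real)"
  assumes W: "W \<le> X0"
  shows "(\<Sum>x\<in>{X0<..X1}. of_real (mangoldt x) * g x)
    = (\<Sum>d\<in>{1..W}. of_real (moebius_mu d) * (\<Sum>n\<in>{X0 div d<..X1 div d}. of_real (ln (real n)) * g (d * n)))
    - (\<Sum>d\<in>{1..W}. \<Sum>c\<in>{1..W}. of_real (moebius_mu d * mangoldt c) * (\<Sum>n\<in>{X0 div d div c<..X1 div d div c}. g (d * (c * n))))
    + (\<Sum>a\<in>{1..X1}. \<Sum>c\<in>{X0 div a<..X1 div a}. of_real (vaughan_coeff (real W) a * \<eta> c) * g (a * c))"
proof -
  have main: "of_real (mangoldt x) * g x = 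
      (\<Sum>d | d dvd x \<and> d \<le> W. of_real (moebius_mu d * ln (real (x div d))) * g (d * (x div d)))
      - (\<Sum>d | d dvd x \<and> d \<le> W. \<Sum>c | c dvd x div d \<and> c \<le> W. of_real (moebius_mu d * mangoldt c) * g (d * (c * (x div d div c))))
      + (\<Sum>a | a dvd x \<and> a \<le> X1. of_real (vaughan_coeff (real W) a * \<eta> (x div a)) * g (a * (x div a)))"
    if x: "x \<in> {X0<..X1}" for x
  proof -
    have x0: "x > 0" "real x > real W" using x W by auto
    have "(\<Sum>c | c dvd x \<and> c > W. mangoldt c * vaughan_coeff (real W) (x div c))
      = (\<Sum>c | c dvd x. \<eta> c * vaughan_coeff (real W) (x div c))"
      using x0 by (intro sum.mono_neutral_cong_left) (auto simp: \<eta>_def)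
    also have "\<dots> = (\<Sum>a | a dvd x. \<eta> (x div a) * vaughan_coeff (real W) a)"
    proof -
      have "x div (x div a) = a" "x div a dvd x" if "a dvd x" for a using that x0(1) by (auto elim!: dvdE)
      then show ?thesis by (intro sum.reindex_bij_witness[of _ "\<lambda>a. x div a" "\<lambda>a. x div a"]) auto
    qed
    also have "{a. a dvd x} = {a. a dvd x \<and> a \<le> X1}" using x x0 by (auto dest: dvd_imp_le)
    finally have "mangoldt x = (\<Sum>d | d dvd x \<and> d \<le> W. moebius_mu d * ln (real (x div d)))
      - (\<Sum>d | d dvd x \<and> d \<le> W. \<Sum>c | c dvd x div d \<and> c \<le> W. moebius_mu d * mangoldt c)
      + (\<Sum>a | a dvd x \<and> a \<le> X1. vaughan_coeff (real W) a * \<eta> (x div a))"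
      using vaughan_identity[OF x0, of "real W"] by (simp add: mult.commute)
    then have "of_real (mangoldt x) * g x = 
      ((\<Sum>d | d dvd x \<and> d \<le> W. of_real (moebius_mu d * ln (real (x div d))))
      - (\<Sum>d | d dvd x \<and> d \<le> W. \<Sum>c | c dvd x div d \<and> c \<le> W. of_real (moebius_mu d * mangoldt c))
      + (\<Sum>a | a dvd x \<and> a \<le> X1. of_real (vaughan_coeff (real W) a * \<eta> (x div a)))) * g x"
      by (simp only: of_real_add of_real_diff of_real_sum)
    also have "\<dots> = (\<Sum>d | d dvd x \<and> d \<le> W. of_real (moebius_mu d * ln (real (x div d))) * g x)
      - (\<Sum>d | d dvd x \<and> d \<le> W. \<Sum>c | c dvd x div d \<and> c \<le> W. of_real (moebius_mu d * mangoldt c) * g x)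
      + (\<Sum>a | a dvd x \<and> a \<le> X1. of_real (vaughan_coeff (real W) a * \<eta> (x div a)) * g x)"
      by (simp only: distrib_right left_diff_distrib sum_distrib_right)
    also have "(\<Sum>d | d dvd x \<and> d \<le> W. of_real (moebius_mu d * ln (real (x div d))) * g x)
      = (\<Sum>d | d dvd x \<and> d \<le> W. of_real (moebius_mu d * ln (real (x div d))) * g (d * (x div d)))"
      by (intro sum.cong) auto
    also have "(\<Sum>d | d dvd x \<and> d \<le> W. \<Sum>c | c dvd x div d \<and> c \<le> W. of_real (moebius_mu d * mangoldt c) * g x)
      = (\<Sum>d | d dvd x \<and> d \<le> W. \<Sum>c | c dvd x div d \<and> c \<le> W. of_real (moebius_mu d * mangoldt c) * g (d * (c * (x div d div c))))"
      by (intro sum.cong) auto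
    also have "(\<Sum>a | a dvd x \<and> a \<le> X1. of_real (vaughan_coeff (real W) a * \<eta> (x div a)) * g x)
      = (\<Sum>a | a dvd x \<and> a \<le> X1. of_real (vaughan_coeff (real W) a * \<eta> (x div a)) * g (a * (x div a)))"
      by (intro sum.cong) auto
    finally show ?thesis .
  qed
  have "(\<Sum>x\<in>{X0<..X1}. of_real (mangoldt x) * g x) = 
      (\<Sum>x\<in>{X0<..X1}. \<Sum>d | d dvd x \<and> d \<le> W. of_real (moebius_mu d * ln (real (x div d))) * g (d * (x div d)))
      - (\<Sum>x\<in>{X0<..X1}. \<Sum>d | d dvd x \<and> d \<le> W. \<Sum>c | c dvd x div d \<and> c \<le> W. of_real (moebius_mu d * mangoldt c) * g (d * (c * (x div d div c))))
      + (\<Sum>x\<in>{X0<..X1}. \<Sum>a | a dvd x \<and> a \<le> X1. of_real (vaughan_coeff (real W) a * \<eta> (x div a)) * g (a * (x div a)))"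
    using sum.cong[OF refl main] by (simp only: sum.distrib sum_subtractf)
  also have "(\<Sum>x\<in>{X0<..X1}. \<Sum>d | d dvd x \<and> d \<le> W. of_real (moebius_mu d * ln (real (x div d))) * g (d * (x div d)))
      = (\<Sum>d\<in>{1..W}. \<Sum>n\<in>{X0 div d<..X1 div d}. of_real (moebius_mu d * ln (real n)) * g (d * n))"
    by (rule sum_divisors_interval)
  also have "\<dots> = (\<Sum>d\<in>{1..W}. of_real (moebius_mu d) * (\<Sum>n\<in>{X0 div d<..X1 div d}. of_real (ln (real n)) * g (d * n)))"
    by (simp add: sum_distrib_left mult.assoc)
  also have "(\<Sum>x\<in>{X0<..X1}. \<Sum>d | d dvd x \<and> d \<le> W. \<Sum>c | c dvd x div d \<and> c \<le> W. of_real (moebius_mu d * mangoldt c) * g (d * (c * (x div d div c))))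
      = (\<Sum>d\<in>{1..W}. \<Sum>n\<in>{X0 div d<..X1 div d}. \<Sum>c | c dvd n \<and> c \<le> W. of_real (moebius_mu d * mangoldt c) * g (d * (c * (n div c))))"
    by (rule sum_divisors_interval)
  also have "\<dots> = (\<Sum>d\<in>{1..W}. \<Sum>c\<in>{1..W}. \<Sum>n\<in>{X0 div d div c<..X1 div d div c}. of_real (moebius_mu d * mangoldt c) * g (d * (c * n)))"
    by (rule sum.cong[OF refl], rule sum_divisors_interval)
  also have "\<dots> = (\<Sum>d\<in>{1..W}. \<Sum>c\<in>{1..W}. of_real (moebius_mu d * mangoldt c) * (\<Sum>n\<in>{X0 div d div c<..X1 div d div c}. g (d * (c * n))))"
    by (simp only: sum_distrib_left)
  also have "(\<Sum>x\<in>{X0<..X1}. \<Sum>a | a dvd x \<and> a \<le> X1. of_real (vaughan_coeff (real W) a * \<eta> (x div a)) * g (a * (x div a)))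
      = (\<Sum>a\<in>{1..X1}. \<Sum>c\<in>{X0 div a<..X1 div a}. of_real (vaughan_coeff (real W) a * \<eta> c) * g (a * c))"
    by (rule sum_divisors_interval)
  finally show ?thesis .
qed

lemma sum_dyadic:
  fixes h :: "nat \<Rightarrow> complex"
  shows "(\<Sum>a\<in>{W<..W * 2 ^ J}. h a) = (\<Sum>i<J. \<Sum>a\<in>{W * 2 ^ i<..2 * (W * 2 ^ i)}. h a)"
proof (induction J)
  case (Suc J)
  have union: "{a<..2 * b} = {a<..b} \<union> {b<..2 * b}" if "a \<le> b" for a b :: nat using that by auto
  have "{W<..W * 2 ^ Suc J} = {W<..W * 2 ^ J} \<union> {W * 2 ^ J<..2 * (W * 2 ^ J)}"
    using union[of W "W * 2 ^ J"] by (simp add: mult_ac)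
  then have "(\<Sum>a\<in>{W<..W * 2 ^ Suc J}. h a) = (\<Sum>a\<in>{W<..W * 2 ^ J}. h a) + (\<Sum>a\<in>{W * 2 ^ J<..2 * (W * 2 ^ J)}. h a)"
    by (simp only:) (rule sum.union_disjoint, auto)
  with Suc show ?case by simp
qed simp

text \<open>The phase in \<open>n\<close> has leading coefficient
  \<open>d ^ Suc k * \<beta>\<close>, and the power of \<open>d\<close> goes into the multiplier.
  Lengths are measured against \<open>X\<close> instead of \<open>X / d\<close>, so the error bound
  already has its final form.\<close>

lemma type_I_inverse:
  "\<exists>C::nat. \<forall>(M::real) (X::nat) d u v F \<beta>.
     M \<ge> 2 \<longrightarrow> X \<ge> 1 \<longrightarrow> d \<ge> 1 \<longrightarrow> real d \<le> M \<longrightarrow> v \<le> X \<longrightarrow> poly_fun (Suc k) \<beta> F \<longrightarrow>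
     norm (\<Sum>n\<in>{u<..v}. e2pi (F (int (d * n)))) \<ge> real X / M \<longrightarrow>
     near_fraction (M ^ C) (M ^ C / real X ^ Suc k) \<beta>"
proof -
  obtain C where C: "\<And>(M::real) (N::nat) (u::nat) v g \<gamma>.
     M \<ge> 2 \<Longrightarrow> N \<ge> 1 \<Longrightarrow> poly_fun (Suc k) \<gamma> g \<Longrightarrow> v \<le> u + N \<Longrightarrow>
     norm (\<Sum>n\<in>{u<..v}. e2pi (g (int n))) \<ge> real N / M \<Longrightarrow>
     near_fraction (M ^ C) (M ^ C / real N ^ Suc k) \<gamma>"
    using weyl_inverse_nat[of k] by metis
  show ?thesis
  proof (rule exI[of _ "C + Suc k"], intro allI impI)
    fix M :: real and X d u v :: nat and F \<beta>
    assume M: "M \<ge> 2" and X: "X \<ge> 1" and d: "d \<ge> 1" "real d \<le> M" and v: "v \<le> X" and F: "poly_fun (Suc k) \<beta> F"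
      and large: "norm (\<Sum>n\<in>{u<..v}. e2pi (F (int (d * n)))) \<ge> real X / M"
    have g: "poly_fun (Suc k) (of_int (int d) ^ Suc k * \<beta>) (\<lambda>n. F (0 + int d * n))"
      by (rule poly_fun_affine[OF F])
    have "norm (\<Sum>n\<in>{u<..v}. e2pi (F (0 + int d * int n))) \<ge> real X / M" using large by simp
    then obtain q :: int where q: "1 \<le> q" "of_int q \<le> M ^ C"
      "dist_nearest_int (of_int q * (of_int (int d) ^ Suc k * \<beta>)) \<le> M ^ C / real X ^ Suc k"
      using C[OF M X g, of v u] v by auto
    have "1 \<le> q * int d ^ Suc k" using q(1) d by (simp add: int_one_le_iff_zero_less)
    moreover have "real_of_int (q * int d ^ Suc k) \<le> M ^ (C + Suc k)"
    proof -
      have "real d ^ Suc k \<le> M ^ Suc k" using d by (intro power_mono) auto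
      then have "real_of_int q * real d ^ Suc k \<le> M ^ C * M ^ Suc k" using q M by (intro mult_mono) auto
      then show ?thesis by (simp add: power_add mult_ac)
    qed
    moreover have "dist_nearest_int (of_int (q * int d ^ Suc k) * \<beta>) \<le> M ^ (C + Suc k) / real X ^ Suc k"
    proof -
      have "dist_nearest_int (of_int (q * int d ^ Suc k) * \<beta>) \<le> M ^ C / real X ^ Suc k" using q(3) by (simp add: mult.assoc)
      also have "\<dots> \<le> M ^ (C + Suc k) / real X ^ Suc k"
        by (intro divide_right_mono power_bounds(1)[OF M]) auto
      finally show ?thesis .
    qed
    ultimately show "near_fraction (M ^ (C + Suc k)) (M ^ (C + Suc k) / real X ^ Suc k) \<beta>"
      by blast
  qed
qed

text \<open>The type II coefficients are bounded by the divisor function, which is under control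
  only in mean square; that is the form which Cauchy--Schwarz uses.\<close>

lemma vaughan_coeff_second_moment:
  assumes "A \<ge> 1" "2 * A \<le> X" "1 + ln (real X) \<le> Q" "Q \<ge> 2"
  shows "(\<Sum>a\<in>{A<..2 * A}. (vaughan_coeff V a)\<^sup>2) \<le> real A * Q ^ 4"
proof -
  have "(\<Sum>a\<in>{A<..2 * A}. (vaughan_coeff V a)\<^sup>2) \<le> (\<Sum>a\<in>{A<..2 * A}. real (card {d. d dvd a}) ^ 2)"
  proof (intro sum_mono)
    fix a assume "a \<in> {A<..2 * A}"
    then have "\<bar>vaughan_coeff V a\<bar> \<le> real (card {d. d dvd a})" by (intro abs_vaughan_coeff_le) auto
    then have "\<bar>vaughan_coeff V a\<bar>\<^sup>2 \<le> real (card {d. d dvd a}) ^ 2" by (intro power_mono) auto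
    then show "(vaughan_coeff V a)\<^sup>2 \<le> real (card {d. d dvd a}) ^ 2" by simp
  qed
  also have "\<dots> \<le> (\<Sum>a\<in>{1..2 * A}. real (card {d. d dvd a}) ^ 2)"
    by (intro sum_mono2) auto
  also have "\<dots> \<le> real (2 * A) * (1 + ln (real (2 * A))) ^ 3"
    using assms(1) by (intro sum_divisor_count_square_le) auto
  also have "\<dots> \<le> real (2 * A) * Q ^ 3"
  proof (intro mult_left_mono power_mono)
    have "ln (real (2 * A)) \<le> ln (real X)" using assms(1,2) by (subst ln_le_cancel_iff) auto
    then show "1 + ln (real (2 * A)) \<le> Q" using assms(3) by simp
    have "0 \<le> ln (real (2 * A))" using assms(1) by (intro ln_ge_zero) auto
    then show "0 \<le> 1 + ln (real (2 * A))" by simp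
  qed auto
  also have "\<dots> = real A * (2 * Q ^ 3)" by simp
  also have "\<dots> \<le> real A * (Q * Q ^ 3)" using assms(4) by (intro mult_left_mono mult_right_mono) auto
  also have "\<dots> = real A * Q ^ 4" by (simp add: eval_nat_numeral)
  finally show ?thesis .
qed

lemma log2_le_twice_ln:
  fixes x :: real
  assumes "x \<ge> 1"
  shows "log 2 x \<le> 2 * ln x"
proof -
  have "ln x * 1 \<le> ln x * (2 * ln 2)" using ln2_ge_two_thirds assms by (intro mult_left_mono) auto
  then show ?thesis by (simp add: log_def field_simps)
qed

text \<open>After the terms up to the cutoff are discarded, one of the three sums in Vaughan's
  identity is at least \<open>X / (4 * Q)\<close>. In the first two a single modulus carries a large
  share, in the third a single dyadic range of \<open>a\<close>.\<close>

lemma prime_sum_leading_coeff: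
  "\<exists>C::nat. \<forall>(Q::real) (X::nat) X0 X1 F \<beta>.
     Q \<ge> 2 \<longrightarrow> X \<ge> 1 \<longrightarrow> 1 + ln (real X) \<le> Q \<longrightarrow> X1 \<le> X \<longrightarrow> poly_fun (Suc k) \<beta> F \<longrightarrow>
     norm (\<Sum>x\<in>{X0<..X1}. of_real (mangoldt x) * e2pi (F (int x))) \<ge> real X / Q \<longrightarrow>
     near_fraction (Q ^ C) (Q ^ C / real X ^ Suc k) \<beta>"
proof -
  define K where "K = Suc k"
  obtain C1 where typeI: "\<And>(M::real) (X::nat) d u v F \<beta>.
     M \<ge> 2 \<Longrightarrow> X \<ge> 1 \<Longrightarrow> d \<ge> 1 \<Longrightarrow> real d \<le> M \<Longrightarrow> v \<le> X \<Longrightarrow> poly_fun K \<beta> F \<Longrightarrow>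
     norm (\<Sum>n\<in>{u<..v}. e2pi (F (int (d * n)))) \<ge> real X / M \<Longrightarrow>
     near_fraction (M ^ C1) (M ^ C1 / real X ^ K) \<beta>"
    by (rule exE[OF type_I_inverse[of k, folded K_def]], rule that, (drule spec)+, (drule mp, assumption)+)
  obtain E where typeII: "\<And>(P::real) (X::nat) (A::nat) X0 X1 F \<beta> (\<xi> :: nat \<Rightarrow> real) (\<eta> :: nat \<Rightarrow> real).
     P \<ge> 2 \<Longrightarrow> poly_fun K \<beta> F \<Longrightarrow> real A \<ge> P ^ E \<Longrightarrow> real X \<ge> real A * P ^ E \<Longrightarrow> X1 \<le> X \<Longrightarrow>
     (\<forall>c\<in>{1..X}. \<bar>\<eta> c\<bar> \<le> P) \<Longrightarrow> (\<Sum>a\<in>{A<..2 * A}. (\<xi> a)\<^sup>2) \<le> real A * P \<Longrightarrow>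
     norm (\<Sum>a\<in>{A<..2 * A}. \<Sum>c\<in>{X0 div a<..X1 div a}. of_real (\<xi> a * \<eta> c) * e2pi (F (int (a * c)))) \<ge> real X / P \<Longrightarrow>
     near_fraction (P ^ E) (P ^ E / real X ^ K) \<beta>"
    by (rule exE[OF bilinear_inverse[of k, folded K_def]], rule that, (drule spec)+, (drule mp, assumption)+)
  \<comment> \<open>The bilinear bound will be used with \<open>P = Q ^ 6\<close> and needs both
    variables to be at least \<open>P ^ E = Q ^ (6 * E)\<close>, which a cutoff
    \<open>W \<ge> Q ^ w\<close> guarantees.\<close>
  define w where "w = 6 * E + 1"
  define C where "C = (2 * w + 9) * C1 + 6 * E + (w + 6) * K"
  show ?thesis
  proof (rule exI[of _ C], intro allI impI, fold K_def)
    fix Q :: real and X X0' X1 :: nat and F :: "int \<Rightarrow> real" and \<beta>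
    assume Q: "Q \<ge> 2" and X: "X \<ge> 1" and lnX: "1 + ln (real X) \<le> Q" and X1: "X1 \<le> X" and F: "poly_fun K \<beta> F"
      and large: "norm (\<Sum>x\<in>{X0'<..X1}. of_real (mangoldt x) * e2pi (F (int x))) \<ge> real X / Q"
    note pb = power_bounds[OF Q]
    let ?goal = "near_fraction (Q ^ C) (Q ^ C / real X ^ K) \<beta>"
    have weaken: ?goal if "near_fraction (Q ^ c) (Q ^ c / real X ^ K) \<beta>"
      "c \<le> C" for c
    proof -
      from that obtain q :: int where q: "1 \<le> q" "of_int q \<le> Q ^ c" "dist_nearest_int (of_int q * \<beta>) \<le> Q ^ c / real X ^ K" by blast
      have le: "Q ^ c \<le> Q ^ C" by (rule pb(1)) fact
      have "Q ^ c / real X ^ K \<le> Q ^ C / real X ^ K" using le by (intro divide_right_mono) auto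
      with q le have "1 \<le> q \<and> of_int q \<le> Q ^ C \<and> dist_nearest_int (of_int q * \<beta>) \<le> Q ^ C / real X ^ K"
        by linarith
      then show ?thesis by blast
    qed
    show ?goal
    proof (cases "real X \<le> Q ^ (w + 6)")
      case True
      then show ?thesis using Q X by (intro trivial_denominator[of Q X "w + 6"]) (auto simp: C_def)
    next
      case False
      then have Xl: "real X > Q ^ (w + 6)" by simp
      define W where "W = nat \<lceil>Q ^ w\<rceil>"
      have W1: "Q ^ w \<le> real W" unfolding W_def using pb(4)[of w] by linarith
      have W2: "real W \<le> Q ^ (w + 1)"
      proof -
        have "real W \<le> Q ^ w + 1" unfolding W_def using pb(4)[of w] by linarith
        also have "\<dots> \<le> Q ^ w + Q ^ w" using pb(2)[of w] by simp
        also have "\<dots> \<le> Q * Q ^ w" using Q pb(4)[of w] mult_right_mono[of 2 Q "Q ^ w"] by simp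
        finally show ?thesis by simp
      qed
      have W_ge2: "W \<ge> 2"
      proof -
        have "Q ^ 1 \<le> Q ^ w" by (intro pb(1)) (simp add: w_def)
        with W1 Q show ?thesis by simp
      qed
      have WX: "W \<le> X"
      proof -
        have "Q ^ (w + 1) \<le> Q ^ (w + 6)" by (intro pb(1)) simp
        with W2 Xl show ?thesis by linarith
      qed
      have Lam: "mangoldt x \<le> Q" if "x \<le> X" for x
      proof (cases "x = 0")
        case False
        then have "mangoldt x \<le> ln (real x)" by (intro mangoldt_le) simp
        also have "\<dots> \<le> ln (real X)" using that False by (subst ln_le_cancel_iff) auto
        finally show ?thesis using lnX by simp
      qed (use Q in simp)
      \<comment> \<open>Vaughan's identity holds only beyond the cutoff. The discarded terms number
        at most \<open>W\<close> and cost at most \<open>X / (4 * Q)\<close>.\<close>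
      define X0 where "X0 = max X0' W"
      define g where "g x = e2pi (F (int x))" for x
      have ng: "norm (g x) = 1" for x by (simp add: g_def)
      define R where "R = (\<Sum>x\<in>{X0'<..min X1 X0}. of_real (mangoldt x) * g x)"
      define S where "S = (\<Sum>x\<in>{X0<..X1}. of_real (mangoldt x) * g x)"
      have RS: "(\<Sum>x\<in>{X0'<..X1}. of_real (mangoldt x) * g x) = R + S"
      proof -
        have "{X0'<..X1} = {X0'<..min X1 X0} \<union> {X0<..X1}" by (auto simp: X0_def)
        then show ?thesis unfolding R_def S_def by (simp only:) (rule sum.union_disjoint, auto)
      qed
      have R: "norm R \<le> real X / (4 * Q)"
      proof -
        have "norm R \<le> (\<Sum>x\<in>{X0'<..min X1 X0}. mangoldt x)"
          unfolding R_def by (rule order_trans[OF norm_sum]) (simp add: norm_mult ng)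
        also have "\<dots> \<le> (\<Sum>x\<in>{0<..W}. mangoldt x)"
          by (intro sum_mono2) (auto simp: X0_def mangoldt_nonneg max_def split: if_splits)
        also have "\<dots> \<le> (\<Sum>x\<in>{0<..W}. Q)" using WX by (intro sum_mono Lam) auto
        also have "\<dots> = real W * Q" by simp
        also have "\<dots> \<le> Q ^ (w + 1) * Q" using W2 Q by (intro mult_right_mono) auto
        also have "\<dots> \<le> real X / (4 * Q)"
        proof -
          have "Q ^ (w + 1) * Q * (4 * Q) = 4 * Q ^ (w + 3)" by (simp add: power_add power3_eq_cube)
          also have "\<dots> \<le> Q ^ 2 * Q ^ (w + 3)" using pb(3)[of 2] Q by (intro mult_right_mono) auto
          also have "\<dots> = Q ^ (2 + (w + 3))" by (simp only: power_add)
          also have "\<dots> \<le> Q ^ (w + 6)" by (intro pb(1)) simp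
          finally show ?thesis using Xl Q by (simp add: le_divide_eq)
        qed
        finally show ?thesis .
      qed
      have "real X / Q \<le> norm (R + S)" using large unfolding RS[symmetric] g_def .
      also have "\<dots> \<le> norm R + norm S" by (rule norm_triangle_ineq)
      finally have S_large: "norm S \<ge> 3 * (real X / (4 * Q))" using R Q by (simp add: field_simps)
      define \<eta> where "\<eta> c = (if c > W then mangoldt c else 0 :: real)" for c
      define T1 where "T1 d = (\<Sum>n\<in>{X0 div d<..X1 div d}. of_real (ln (real n)) * g (d * n))" for d
      define T2 where "T2 d c = (\<Sum>n\<in>{X0 div d div c<..X1 div d div c}. g (d * (c * n)))" for d c
      define T3 where "T3 a = (\<Sum>c\<in>{X0 div a<..X1 div a}. of_real (vaughan_coeff (real W) a * \<eta> c) * g (a * c))" for a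
      define S1 where "S1 = (\<Sum>d\<in>{1..W}. of_real (moebius_mu d) * T1 d)"
      define S2 where "S2 = (\<Sum>d\<in>{1..W}. \<Sum>c\<in>{1..W}. of_real (moebius_mu d * mangoldt c) * T2 d c)"
      define S3 where "S3 = (\<Sum>a\<in>{1..X1}. T3 a)"
      have "S = S1 - S2 + S3"
        unfolding S_def S1_def S2_def S3_def T1_def T2_def T3_def \<eta>_def
        by (rule vaughan_sum) (simp add: X0_def)
      then have "norm S \<le> norm S1 + norm S2 + norm S3"
        by (metis norm_triangle_ineq norm_triangle_ineq4 add_right_mono order_trans)
      then consider "norm S1 \<ge> real X / (4 * Q)" | "norm S2 \<ge> real X / (4 * Q)" | "norm S3 \<ge> real X / (4 * Q)"
        using S_large by linarith
      then show ?thesis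
      proof cases
        case 1
        \<comment> \<open>The same choice serves both type I sums. The worse one has moduli
          \<open>d * c\<close> up to \<open>Q ^ (2 * w + 2)\<close> and loses a factor of at most
          \<open>4 * Q\<^sup>2 * W\<^sup>2\<close>, which is below
          \<open>Q ^ (2 * w + 9)\<close>.\<close>
        define M where "M = Q ^ (2 * w + 9)"
        have M2: "M \<ge> 2" unfolding M_def using Q pb(1)[of 1 "2 * w + 9"] by simp
        have "real X / (4 * Q) \<le> (\<Sum>d\<in>{1..W}. norm (T1 d))"
        proof -
          note 1
          also have "norm S1 \<le> (\<Sum>d\<in>{1..W}. \<bar>moebius_mu d\<bar> * norm (T1 d))"
            unfolding S1_def by (rule order_trans[OF norm_sum]) (simp add: norm_mult)
          also have "\<dots> \<le> (\<Sum>d\<in>{1..W}. 1 * norm (T1 d))"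
            by (intro sum_mono mult_right_mono abs_moebius_mu_le) auto
          finally show ?thesis by simp
        qed
        then obtain d where d: "d \<in> {1..W}" "norm (T1 d) \<ge> real X / (4 * Q) / real W"
          using exists_large_term[of "{1..W}" "real W" "real X / (4 * Q)" "\<lambda>d. norm (T1 d)"] W_ge2 X Q by auto
        \<comment> \<open>If all tails were small, partial summation would make the sum with
          logarithmic weights small as well.\<close>
        have "\<exists>t. norm (\<Sum>n\<in>{t<..X1 div d}. g (d * n)) \<ge> real X / M"
        proof (rule ccontr)
          assume "\<not> ?thesis"
          then have small: "norm (\<Sum>n\<in>{t<..X1 div d}. g (d * n)) \<le> real X / M" for t
            by (simp add: not_le less_imp_le)
          have mono: "mono (\<lambda>n. ln (real n))"
          proof (rule monoI)
            fix a b :: nat assume "a \<le> b"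
            then show "ln (real a) \<le> ln (real b)" by (cases "a = 0"; cases "b = 0") auto
          qed
          have ln0: "0 \<le> ln (real n)" for n :: nat by (cases "n = 0") auto
          have "norm (T1 d) \<le> Q * (real X / M)"
          proof (cases "X0 div d \<le> X1 div d")
            case True
            have "norm (\<Sum>n\<in>{X0 div d<..X1 div d}. of_real (ln (real n) - 0) * g (d * n)) \<le> (ln (real (X1 div d)) - 0) * (real X / M)"
              by (rule norm_sum_monotone_weights_le[OF mono True ln0 ln0 small])
            also have "\<dots> \<le> Q * (real X / M)"
            proof (intro mult_right_mono)
              have "X1 div d \<le> X" using X1 by (meson div_le_dividend order_trans)
              then have "ln (real (X1 div d)) \<le> ln (real X)" using mono unfolding mono_def by blast
              then show "ln (real (X1 div d)) - 0 \<le> Q" using lnX by simp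
            qed (use M2 in auto)
            finally show ?thesis by (simp add: T1_def)
          qed (use Q M2 in \<open>auto simp: T1_def\<close>)
          then have "real X / (4 * Q) / real W \<le> Q * (real X / M)" using d by linarith
          then have "real X * M \<le> real X * (4 * Q\<^sup>2 * real W)" using Q W_ge2 M2 by (simp add: field_simps power2_eq_square)
          then have "M \<le> 4 * Q\<^sup>2 * real W" using X by simp
          also have "\<dots> \<le> Q\<^sup>2 * Q\<^sup>2 * Q ^ (w + 1)" using W2 pb(3)[of 2] Q by (intro mult_mono) auto
          also have "\<dots> = Q ^ (2 + 2 + (w + 1))" by (simp only: power_add)
          also have "\<dots> < Q ^ (2 * w + 9)" using Q by (intro power_strict_increasing) auto
          finally show False by (simp add: M_def)
        qed
        then obtain t where t: "norm (\<Sum>n\<in>{t<..X1 div d}. e2pi (F (int (d * n)))) \<ge> real X / M" unfolding g_def by blast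
        have dM: "real d \<le> M"
        proof -
          have "real d \<le> Q ^ (w + 1)" using d W2 by auto
          also have "\<dots> \<le> M" unfolding M_def by (intro pb(1)) simp
          finally show ?thesis .
        qed
        have "X1 div d \<le> X" using X1 by (meson div_le_dividend order_trans)
        then have "near_fraction (M ^ C1) (M ^ C1 / real X ^ K) \<beta>"
          using typeI[OF M2 X _ dM _ F t] d by auto
        then show ?thesis unfolding M_def power_mult[symmetric]
          by (rule weaken) (simp add: C_def)
      next
        case 2
        define M where "M = Q ^ (2 * w + 9)"
        have M2: "M \<ge> 2" unfolding M_def using Q pb(1)[of 1 "2 * w + 9"] by simp
        have "real X / (4 * Q) \<le> (\<Sum>d\<in>{1..W}. \<Sum>c\<in>{1..W}. \<bar>moebius_mu d\<bar> * mangoldt c * norm (T2 d c))"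
        proof -
          note 2
          also have "norm S2 \<le> (\<Sum>d\<in>{1..W}. \<Sum>c\<in>{1..W}. norm (of_real (moebius_mu d * mangoldt c) * T2 d c))"
            unfolding S2_def by (rule order_trans[OF norm_sum]) (intro sum_mono norm_sum)
          also have "\<dots> = (\<Sum>d\<in>{1..W}. \<Sum>c\<in>{1..W}. \<bar>moebius_mu d\<bar> * mangoldt c * norm (T2 d c))"
            by (simp only: norm_mult norm_of_real abs_mult abs_mangoldt)
          finally show ?thesis .
        qed
        also have "\<dots> \<le> (\<Sum>d\<in>{1..W}. \<Sum>c\<in>{1..W}. 1 * Q * norm (T2 d c))"
          using Q WX by (intro sum_mono mult_right_mono mult_mono abs_moebius_mu_le Lam) (auto simp: mangoldt_nonneg)
        also have "\<dots> = Q * (\<Sum>(d, c)\<in>{1..W} \<times> {1..W}. norm (T2 d c))"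
          by (simp add: sum_distrib_left flip: sum.cartesian_product)
        finally have "real X / (4 * Q) / Q \<le> (\<Sum>(d, c)\<in>{1..W} \<times> {1..W}. norm (T2 d c))"
          using Q by (simp add: divide_le_eq mult.commute)
        then obtain d c where dc: "d \<in> {1..W}" "c \<in> {1..W}" "norm (T2 d c) \<ge> real X / (4 * Q) / Q / (real W * real W)"
          using exists_large_term[of "{1..W} \<times> {1..W}" "real W * real W" "real X / (4 * Q) / Q" "\<lambda>(d, c). norm (T2 d c)"] W_ge2 X Q by auto
        have "real X / M \<le> real X / (4 * Q) / Q / (real W * real W)"
        proof -
          have "4 * Q * Q * (real W * real W) \<le> Q\<^sup>2 * Q * Q * (Q ^ (w + 1) * Q ^ (w + 1))"
            using W2 pb(3)[of 2] Q by (intro mult_mono) auto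
          also have "\<dots> = Q ^ (2 + 1 + 1 + ((w + 1) + (w + 1)))" by (simp only: power_add power_one_right)
          also have "\<dots> \<le> M" unfolding M_def by (intro pb(1)) simp
          finally have "real X / M \<le> real X / (4 * Q * Q * (real W * real W))"
            using Q W_ge2 M2 by (intro divide_left_mono) auto
          then show ?thesis by simp
        qed
        with dc have "norm (T2 d c) \<ge> real X / M" by linarith
        then have t: "norm (\<Sum>n\<in>{X0 div d div c<..X1 div d div c}. e2pi (F (int ((d * c) * n)))) \<ge> real X / M"
          by (simp add: T2_def g_def mult.assoc)
        have dM: "real (d * c) \<le> M"
        proof -
          have "real (d * c) \<le> Q ^ (w + 1) * Q ^ (w + 1)" unfolding of_nat_mult using dc W2 Q by (intro mult_mono) auto
          also have "\<dots> = Q ^ ((w + 1) + (w + 1))" by (simp only: power_add)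
          also have "\<dots> \<le> M" unfolding M_def by (intro pb(1)) simp
          finally show ?thesis .
        qed
        have "X1 div d div c \<le> X" using X1 by (meson div_le_dividend order_trans)
        moreover have "1 \<le> d * c" using dc by (simp add: Suc_le_eq)
        ultimately have "near_fraction (M ^ C1) (M ^ C1 / real X ^ K) \<beta>"
          using typeI[OF M2 X _ dM _ F t] by blast
        then show ?thesis unfolding M_def power_mult[symmetric]
          by (rule weaken) (simp add: C_def)
      next
        case 3
        \<comment> \<open>One parameter has to cover three losses: the division into at most
          \<open>2 * Q\<close> dyadic pieces, the second moment \<open>Q ^ 4\<close> of the
          coefficients of \<open>a\<close>, and the bound \<open>Q\<close> for the weights of
          \<open>c\<close>.\<close>
        define P where "P = Q ^ 6"
        have P2: "P \<ge> 2" unfolding P_def using Q pb(1)[of 1 6] by simp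
        define J where "J = nat \<lceil>log 2 (real X)\<rceil>"
        have log0: "0 \<le> log 2 (real X)" using X by simp
        have XJ: "X \<le> 2 ^ J"
        proof -
          have "real X = 2 powr (log 2 (real X))" using X by simp
          also have "\<dots> \<le> 2 powr (real J)" unfolding J_def using log0 by (intro powr_mono) linarith+
          also have "\<dots> = 2 ^ J" by (simp add: powr_realpow)
          finally show ?thesis by (metis of_nat_le_iff of_nat_numeral of_nat_power)
        qed
        have JQ: "real J \<le> 2 * Q"
        proof -
          have "real J \<le> log 2 (real X) + 1" unfolding J_def using log0 by linarith
          also have "log 2 (real X) \<le> 2 * ln (real X)"
            using X by (intro log2_le_twice_ln) auto
          finally show ?thesis using lnX Q by simp
        qed
        have S3_eq: "S3 = (\<Sum>i<J. \<Sum>a\<in>{W * 2 ^ i<..2 * (W * 2 ^ i)}. T3 a)"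
        proof -
          \<comment> \<open>Up to \<open>W\<close> the coefficient vanishes and beyond
            \<open>X1\<close> the inner range is empty, so the sum over \<open>a\<close> may be
            replaced by complete dyadic ranges starting at \<open>W\<close>.\<close>
          have z1: "T3 a = 0" if "a \<ge> 1" "a \<le> W" for a
            using vaughan_coeff_eq_0[of a "real W"] that by (simp add: T3_def)
          have z2: "T3 a = 0" if "a > X1" for a using that by (simp add: T3_def)
          have "X1 \<le> W * 2 ^ J"
          proof -
            have "X1 \<le> 1 * 2 ^ J" using X1 XJ by simp
            also have "\<dots> \<le> W * 2 ^ J" using W_ge2 by (intro mult_right_mono) auto
            finally show ?thesis .
          qed
          then have sub: "{W<..X1} \<subseteq> {W<..W * 2 ^ J}" by auto
          have "S3 = (\<Sum>a\<in>{W<..X1}. T3 a)" unfolding S3_def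
            by (rule sum.mono_neutral_right) (auto intro!: z1)
          also have "\<dots> = (\<Sum>a\<in>{W<..W * 2 ^ J}. T3 a)"
            using sub by (intro sum.mono_neutral_left) (auto intro!: z2)
          finally show ?thesis by (simp add: sum_dyadic)
        qed
        define D where "D i = (\<Sum>a\<in>{W * 2 ^ i<..2 * (W * 2 ^ i)}. T3 a)" for i
        have "real X / (4 * Q) \<le> norm (\<Sum>i<J. D i)" using 3 by (simp only: S3_eq D_def)
        also have "\<dots> \<le> (\<Sum>i<J. norm (D i))" by (rule norm_sum)
        finally have "real X / (4 * Q) \<le> (\<Sum>i<J. norm (D i))" .
        then obtain i where i: "i < J" "norm (D i) \<ge> real X / (4 * Q) / (2 * Q)"
          using exists_large_term[of "{..<J}" "2 * Q" "real X / (4 * Q)" "\<lambda>i. norm (D i)"] JQ X Q by auto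
        have Di: "norm (D i) \<ge> real X / P"
        proof -
          have "4 * Q * (2 * Q) = 8 * Q\<^sup>2" by (simp add: power2_eq_square)
          also have "\<dots> \<le> Q ^ 3 * Q\<^sup>2" using pb(3)[of 3] by (intro mult_right_mono) auto
          also have "\<dots> = Q ^ (3 + 2)" by (simp only: power_add)
          also have "\<dots> \<le> P" unfolding P_def by (intro pb(1)) simp
          finally have "real X / P \<le> real X / (4 * Q * (2 * Q))" using Q P2 by (intro divide_left_mono) auto
          with i show ?thesis by simp
        qed
        define A where "A = W * 2 ^ i"
        have AW: "A \<ge> W" by (simp add: A_def)
        \<comment> \<open>Nonzero weights need \<open>c > W\<close>. If \<open>A * W\<close>
          exceeded \<open>X\<close>, every product \<open>a * c\<close> would be out of range and
          the piece would vanish, although it is large.\<close>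
        have AWX: "A * W \<le> X"
        proof (rule ccontr)
          assume n: "\<not> A * W \<le> X"
          have "T3 a = 0" if a: "a \<in> {A<..2 * A}" for a
          proof -
            have "\<eta> c = 0" if c: "c \<in> {X0 div a<..X1 div a}" for c
            proof (cases "c > W")
              case True
              have "c * a \<le> X1" using c a div_interval_iff(2)[of a c X1] by auto
              moreover have "A * W \<le> a * c" using a True by (intro mult_mono) auto
              ultimately show ?thesis using n X1 by (simp add: mult.commute)
            qed (simp add: \<eta>_def)
            then show ?thesis by (simp add: T3_def)
          qed
          then have "D i = 0" by (simp add: D_def A_def)
          moreover have "0 < real X / P" using X P2 by simp
          ultimately show False using Di by simp
        qed
        have PE: "P ^ E \<le> real W"
        proof -
          have "P ^ E = Q ^ (6 * E)" by (simp add: P_def power_mult)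
          also have "\<dots> \<le> Q ^ w" by (intro pb(1)) (simp add: w_def)
          finally show ?thesis using W1 by simp
        qed
        have A1: "real A \<ge> P ^ E" using AW PE by (meson of_nat_le_iff order_trans)
        have A2: "real X \<ge> real A * P ^ E"
        proof -
          have "real A * P ^ E \<le> real A * real W" using PE by (intro mult_left_mono) auto
          also have "\<dots> \<le> real X" using AWX by (metis of_nat_le_iff of_nat_mult)
          finally show ?thesis .
        qed
        have \<eta>P: "\<forall>c\<in>{1..X}. \<bar>\<eta> c\<bar> \<le> P"
        proof
          fix c assume "c \<in> {1..X}"
          then have "mangoldt c \<le> Q" by (intro Lam) simp
          also have "Q \<le> P" unfolding P_def using pb(1)[of 1 6] by simp
          finally show "\<bar>\<eta> c\<bar> \<le> P" using P2 by (simp add: \<eta>_def)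
        qed
        have "2 * A \<le> W * A" using W_ge2 by (intro mult_right_mono) auto
        also have "\<dots> \<le> X" using AWX by (simp only: mult.commute)
        finally have "2 * A \<le> X" .
        then have "(\<Sum>a\<in>{A<..2 * A}. (vaughan_coeff (real W) a)\<^sup>2) \<le> real A * Q ^ 4"
          using AW W_ge2 lnX Q by (intro vaughan_coeff_second_moment) auto
        also have "\<dots> \<le> real A * P" unfolding P_def by (intro mult_left_mono pb(1)) auto
        finally have \<xi>P: "(\<Sum>a\<in>{A<..2 * A}. (vaughan_coeff (real W) a)\<^sup>2) \<le> real A * P" .
        have "norm (\<Sum>a\<in>{A<..2 * A}. \<Sum>c\<in>{X0 div a<..X1 div a}. of_real (vaughan_coeff (real W) a * \<eta> c) * e2pi (F (int (a * c)))) \<ge> real X / P"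
          using Di unfolding D_def T3_def g_def A_def .
        then have "near_fraction (P ^ E) (P ^ E / real X ^ K) \<beta>"
          by (rule typeII[OF P2 F A1 A2 X1 \<eta>P \<xi>P])
        then show ?thesis unfolding P_def power_mult[symmetric]
          by (rule weaken) (simp add: C_def)
      qed
    qed
  qed
qed

section \<open>All coefficients\<close>

lemma e2pi_eq_1_imp_int:
  assumes "e2pi y = 1" shows "\<exists>n. y = of_int n"
proof -
  have "dist_nearest_int y = 0" using norm_e2pi_minus_1_ge[of y] assms
    by (metis diff_self dist_nearest_int_nonneg norm_zero order_antisym)
  then have "y = of_int (round y)" by (simp add: dist_nearest_int_def)
  then show ?thesis by blast
qed

text \<open>A geometric sum whose ratio is an \<open>m\<close>-th root of unity, equal to 1 exactly
  when \<open>m\<close> divides \<open>x - s\<close>.\<close>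

lemma sum_characters:
  assumes m: "m \<ge> 1" "s < m"
  shows "(\<Sum>t<m. e2pi (real t * ((real x - real s) / real m))) = of_bool (x mod m = s) * of_nat m"
proof -
  define y where "y = (real x - real s) / real m"
  have sum: "(\<Sum>t<m. e2pi (real t * y)) = (\<Sum>t<m. e2pi y ^ t)" by (simp add: e2pi_mult_of_nat)
  show ?thesis
  proof (cases "x mod m = s")
    case True
    have "x = m * (x div m) + s" using True mult_div_mod_eq[of m x] by simp
    then have "real x = real m * real (x div m) + real s" by (metis of_nat_add of_nat_mult)
    then have "y = of_int (int (x div m))" using m by (simp add: y_def)
    then have "e2pi y = 1" by (metis e2pi_of_int)
    then show ?thesis using True sum by (simp add: y_def)
  next
    case False
    have "e2pi y \<noteq> 1"
    proof
      assume "e2pi y = 1"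
      then obtain n where "y = of_int n" using e2pi_eq_1_imp_int by blast
      then have "real x - real s = of_int n * real m" using m by (simp add: y_def field_simps)
      then have "real_of_int (int x - int s) = real_of_int (n * int m)" by simp
      then have "int x - int s = n * int m" by (simp only: of_int_eq_iff)
      then have "int x mod int m = int s mod int m" by (simp add: mod_eq_dvd_iff)
      then have "x mod m = s mod m" by (metis of_nat_eq_iff zmod_int)
      with False m show False by simp
    qed
    moreover have "e2pi y ^ m = 1"
    proof -
      have "e2pi y ^ m = e2pi (real m * y)" by (simp add: e2pi_mult_of_nat)
      also have "real m * y = of_int (int x - int s)" using m by (simp add: y_def)
      finally show ?thesis by (simp only: e2pi_of_int)
    qed
    ultimately have "(\<Sum>t<m. e2pi y ^ t) = 0" by (simp add: geometric_sum)
    then show ?thesis using False sum by (simp add: y_def)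
  qed
qed

lemma poly_fun_linear: "poly_fun (Suc k) (if k = 0 then c else 0) (\<lambda>n. c * of_int n)"
proof (induction k)
  case 0
  then show ?case using poly_fun_cmult[OF poly_fun_power[of 1], of c] by simp
next
  case (Suc k)
  from poly_fun_degree_Suc[OF this] show ?case by simp
qed

text \<open>Expanding the congruence condition into additive characters adds a linear term to the phase; for
  degree one this shifts the leading coefficient by a multiple of \<open>1 / m\<close>.\<close>
lemma prime_sum_progression_leading_coeff:
  "\<exists>C::nat. \<forall>(Q::real) (X::nat) X0 X1 F \<beta> m s.
     Q \<ge> 2 \<longrightarrow> X \<ge> 1 \<longrightarrow> 1 + ln (real X) \<le> Q \<longrightarrow> X1 \<le> X \<longrightarrow> poly_fun (Suc k) \<beta> F \<longrightarrow> m \<ge> 1 \<longrightarrow> real m \<le> Q \<longrightarrow>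
     norm (\<Sum>x | x \<in> {X0<..X1} \<and> x mod m = s. of_real (mangoldt x) * e2pi (F (int x))) \<ge> real X / Q \<longrightarrow>
     near_fraction (Q ^ C) (Q ^ C / real X ^ Suc k) \<beta>"
proof -
  obtain C where C: "\<And>(Q::real) (X::nat) X0 X1 F \<beta>.
     Q \<ge> 2 \<Longrightarrow> X \<ge> 1 \<Longrightarrow> 1 + ln (real X) \<le> Q \<Longrightarrow> X1 \<le> X \<Longrightarrow> poly_fun (Suc k) \<beta> F \<Longrightarrow>
     norm (\<Sum>x\<in>{X0<..X1}. of_real (mangoldt x) * e2pi (F (int x))) \<ge> real X / Q \<Longrightarrow>
     near_fraction (Q ^ C) (Q ^ C / real X ^ Suc k) \<beta>"
    by (rule exE[OF prime_sum_leading_coeff[of k]], rule that, (drule spec)+, (drule mp, assumption)+)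
  show ?thesis
  proof (rule exI[of _ "Suc C"], intro allI impI)
    fix Q :: real and X X0 X1 m s :: nat and F :: "int \<Rightarrow> real" and \<beta>
    assume Q: "Q \<ge> 2" and X: "X \<ge> 1" and lnX: "1 + ln (real X) \<le> Q" and X1: "X1 \<le> X" and F: "poly_fun (Suc k) \<beta> F"
      and m: "m \<ge> 1" "real m \<le> Q"
      and large: "norm (\<Sum>x | x \<in> {X0<..X1} \<and> x mod m = s. of_real (mangoldt x) * e2pi (F (int x))) \<ge> real X / Q"
    \<comment> \<open>Otherwise the residue class is empty and the sum is 0, contrary to the lower
      bound.\<close>
    have s: "s < m"
    proof (rule ccontr)
      assume "\<not> s < m"
      then have "x mod m \<noteq> s" for x using m by (metis mod_less_divisor less_le_trans zero_less_one)
      then have "norm (\<Sum>x | x \<in> {X0<..X1} \<and> x mod m = s. of_real (mangoldt x) * e2pi (F (int x))) = 0" by simp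
      moreover have "0 < real X / Q" using X Q by simp
      ultimately show False using large by linarith
    qed
    define V where "V t = (\<Sum>x\<in>{X0<..X1}. of_real (mangoldt x) * e2pi (F (int x) + (real t / real m) * of_int (int x)))" for t
    have "of_nat m * (\<Sum>x | x \<in> {X0<..X1} \<and> x mod m = s. of_real (mangoldt x) * e2pi (F (int x)))
      = (\<Sum>x\<in>{X0<..X1}. of_real (mangoldt x) * e2pi (F (int x)) * (of_bool (x mod m = s) * of_nat m))"
      unfolding sum_distrib_left by (intro sum.mono_neutral_cong_left) auto
    also have "\<dots> = (\<Sum>x\<in>{X0<..X1}. \<Sum>t<m. of_real (mangoldt x) * e2pi (F (int x)) * e2pi (real t * ((real x - real s) / real m)))"
      unfolding sum_characters[OF m(1) s, symmetric] by (simp only: sum_distrib_left)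
    also have "\<dots> = (\<Sum>t<m. \<Sum>x\<in>{X0<..X1}. of_real (mangoldt x) * e2pi (F (int x)) * e2pi (real t * ((real x - real s) / real m)))"
      by (rule sum.swap)
    also have "\<dots> = (\<Sum>t<m. e2pi (- (real t * real s / real m)) * V t)"
    proof (rule sum.cong[OF refl])
      fix t
      have "e2pi (real t * ((real x - real s) / real m)) = e2pi (- (real t * real s / real m)) * e2pi ((real t / real m) * of_int (int x))" for x
        unfolding e2pi_add[symmetric] by (simp add: field_simps diff_divide_distrib)
      then show "(\<Sum>x\<in>{X0<..X1}. of_real (mangoldt x) * e2pi (F (int x)) * e2pi (real t * ((real x - real s) / real m)))
        = e2pi (- (real t * real s / real m)) * V t"
        unfolding V_def sum_distrib_left e2pi_add by (intro sum.cong refl) (simp only: mult_ac)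
    qed
    finally have "norm (of_nat m * (\<Sum>x | x \<in> {X0<..X1} \<and> x mod m = s. of_real (mangoldt x) * e2pi (F (int x)))) \<le> (\<Sum>t<m. norm (V t))"
      using norm_sum[of "\<lambda>t. e2pi (- (real t * real s / real m)) * V t" "{..<m}"] by (simp add: norm_mult)
    then have "real m * (real X / Q) \<le> (\<Sum>t<m. norm (V t))"
      using mult_left_mono[OF large, of "real m"] by (simp only: norm_mult norm_of_nat) linarith
    then obtain t where t: "t < m" "norm (V t) \<ge> real m * (real X / Q) / real m"
      using exists_large_term[of "{..<m}" "real m" "real m * (real X / Q)" "\<lambda>t. norm (V t)"] m X Q by auto
    then have Vt: "norm (V t) \<ge> real X / Q" using m by simp
    have F': "poly_fun (Suc k) (\<beta> + (if k = 0 then real t / real m else 0)) (\<lambda>n. F n + (real t / real m) * of_int n)"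
      by (intro poly_fun_add F poly_fun_linear)
    obtain q :: int where q: "1 \<le> q" "of_int q \<le> Q ^ C"
      "dist_nearest_int (of_int q * (\<beta> + (if k = 0 then real t / real m else 0))) \<le> Q ^ C / real X ^ Suc k"
      using C[OF Q X lnX X1 F' Vt[unfolded V_def]] by blast
    \<comment> \<open>In degree one the factor \<open>m\<close> in the new multiplier clears the
      shift \<open>t / m\<close>, leaving the integer \<open>q * t\<close>, which does not change
      the distance.\<close>
    define u where "u = (if k = 0 then q * int t else 0)"
    have eq: "of_int (q * int m) * \<beta> + of_int u = of_int (int m) * (of_int q * (\<beta> + (if k = 0 then real t / real m else 0)))"
      using m by (simp add: u_def algebra_simps)
    have "dist_nearest_int (of_int (q * int m) * \<beta>) = dist_nearest_int (of_int (q * int m) * \<beta> + of_int u)" by simp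
    also have "\<dots> \<le> real m * dist_nearest_int (of_int q * (\<beta> + (if k = 0 then real t / real m else 0)))"
      unfolding eq by (rule order_trans[OF dist_nearest_int_mult]) simp
    also have "\<dots> \<le> Q * (Q ^ C / real X ^ Suc k)" using m q(3) Q by (intro mult_mono) auto
    finally have "dist_nearest_int (of_int (q * int m) * \<beta>) \<le> Q ^ Suc C / real X ^ Suc k" by simp
    moreover have "real_of_int (q * int m) \<le> Q ^ Suc C"
      using mult_mono[OF q(2) m(2)] q(1) Q by (simp add: mult.commute)
    moreover have "1 \<le> q * int m" using q(1) m(1) by (simp add: int_one_le_iff_zero_less)
    ultimately show "near_fraction (Q ^ Suc C) (Q ^ Suc C / real X ^ Suc k) \<beta>"
      by blast
  qed
qed

lemma power_Suc_diff_le: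
  fixes x y B :: real
  assumes "0 \<le> y" "y \<le> x" "x \<le> B"
  shows "x ^ Suc k - y ^ Suc k \<le> real (Suc k) * B ^ k * (x - y)"
proof (induction k)
  case (Suc k)
  have "x ^ Suc (Suc k) - y ^ Suc (Suc k) = x * (x ^ Suc k - y ^ Suc k) + y ^ Suc k * (x - y)"
    by (simp add: algebra_simps)
  also have "\<dots> \<le> B * (real (Suc k) * B ^ k * (x - y)) + B ^ Suc k * (x - y)"
    using assms Suc power_mono[of y x "Suc k"] by (intro add_mono mult_mono mult_right_mono power_mono) (auto simp del: power_Suc)
  also have "\<dots> = real (Suc (Suc k)) * B ^ Suc k * (x - y)" by (simp add: algebra_simps)
  finally show ?case .
qed simp

text \<open>With \<open>\<beta>\<^sub>k \<approx> a / q\<close> known, the top monomial is nearly constant modulo \<open>1\<close> on residue classes modulo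
  \<open>q\<close> in short intervals, so it can be dropped there, and the induction proceeds with the same
  lower coefficients.\<close>
lemma prime_sum_progression_coeffs:
  "\<exists>C::nat. \<forall>(Q::real) (X::nat) X0 X1 (\<beta> :: nat \<Rightarrow> real) m s.
     Q \<ge> 2 \<longrightarrow> X \<ge> 1 \<longrightarrow> 1 + ln (real X) \<le> Q \<longrightarrow> X1 \<le> X \<longrightarrow> m \<ge> 1 \<longrightarrow> real m \<le> Q \<longrightarrow>
     norm (\<Sum>x | x \<in> {X0<..X1} \<and> x mod m = s. of_real (mangoldt x) * e2pi (\<Sum>j\<le>k. \<beta> j * real x ^ j)) \<ge> real X / Q \<longrightarrow>
     (\<exists>q::int. 1 \<le> q \<and> of_int q \<le> Q ^ C \<and> (\<forall>j\<in>{1..k}. dist_nearest_int (of_int q * \<beta> j) \<le> Q ^ C / real X ^ j))"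
proof (induction k)
  case 0
  have "\<exists>q::int. 1 \<le> q \<and> of_int q \<le> (Q::real) ^ 0" for Q by (intro exI[of _ 1]) simp
  then show ?case by (intro exI[of _ "0::nat"]) simp
next
  case (Suc k)
  obtain C0 where IH: "\<And>(Q::real) (X::nat) X0 X1 (\<beta> :: nat \<Rightarrow> real) m s.
     Q \<ge> 2 \<Longrightarrow> X \<ge> 1 \<Longrightarrow> 1 + ln (real X) \<le> Q \<Longrightarrow> X1 \<le> X \<Longrightarrow> m \<ge> 1 \<Longrightarrow> real m \<le> Q \<Longrightarrow>
     norm (\<Sum>x | x \<in> {X0<..X1} \<and> x mod m = s. of_real (mangoldt x) * e2pi (\<Sum>j\<le>k. \<beta> j * real x ^ j)) \<ge> real X / Q \<Longrightarrow>
     (\<exists>q::int. 1 \<le> q \<and> of_int q \<le> Q ^ C0 \<and> (\<forall>j\<in>{1..k}. dist_nearest_int (of_int q * \<beta> j) \<le> Q ^ C0 / real X ^ j))"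
    by (rule exE[OF Suc.IH], rule that, (drule spec)+, (drule mp, assumption)+)
  obtain C1 where lead: "\<And>(Q::real) (X::nat) X0 X1 F \<beta> m s.
     Q \<ge> 2 \<Longrightarrow> X \<ge> 1 \<Longrightarrow> 1 + ln (real X) \<le> Q \<Longrightarrow> X1 \<le> X \<Longrightarrow> poly_fun (Suc k) \<beta> F \<Longrightarrow> m \<ge> 1 \<Longrightarrow> real m \<le> Q \<Longrightarrow>
     norm (\<Sum>x | x \<in> {X0<..X1} \<and> x mod m = s. of_real (mangoldt x) * e2pi (F (int x))) \<ge> real X / Q \<Longrightarrow>
     near_fraction (Q ^ C1) (Q ^ C1 / real X ^ Suc k) \<beta>"
    by (rule exE[OF prime_sum_progression_leading_coeff[of k]], rule that, (drule spec)+, (drule mp, assumption)+)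
  \<comment> \<open>On intervals of length \<open>X / Q ^ e\<close> the top phase moves by at most
    \<open>8 * Q ^ (k + C1) / Q ^ e\<close>. Multiplied by the total weight \<open>X * Q\<close>,
    this must not exceed \<open>X / (2 * Q)\<close>, whence the value of \<open>e\<close>. Then
    \<open>Q ^ D\<close> covers the at most \<open>Q ^ (e + C1 + 3)\<close> blocks and the lost
    factor \<open>2 * Q\<close>.\<close>
  define e where "e = C1 + k + 6"
  define D where "D = e + C1 + 5"
  define C where "C = C1 + D * C0 + e * Suc k"
  show ?case
  proof (rule exI[of _ C], intro allI impI)
    fix Q :: real and X X0 X1 m s :: nat and \<beta> :: "nat \<Rightarrow> real"
    assume Q: "Q \<ge> 2" and X: "X \<ge> 1" and lnX: "1 + ln (real X) \<le> Q" and X1: "X1 \<le> X" and m: "m \<ge> 1" "real m \<le> Q"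
      and large: "norm (\<Sum>x | x \<in> {X0<..X1} \<and> x mod m = s. of_real (mangoldt x) * e2pi (\<Sum>j\<le>Suc k. \<beta> j * real x ^ j)) \<ge> real X / Q"
    note pb = power_bounds[OF Q]
    show "\<exists>q::int. 1 \<le> q \<and> of_int q \<le> Q ^ C \<and> (\<forall>j\<in>{1..Suc k}. dist_nearest_int (of_int q * \<beta> j) \<le> Q ^ C / real X ^ j)"
    proof (cases "real X \<le> Q ^ e")
      case True
      have "dist_nearest_int (of_int 1 * \<beta> j) \<le> Q ^ C / real X ^ j" if "j \<in> {1..Suc k}" for j
      proof -
        have "real X ^ j \<le> (Q ^ e) ^ j" using True by (intro power_mono) auto
        also have "\<dots> = Q ^ (e * j)" by (simp add: power_mult)
        also have "\<dots> \<le> Q ^ C"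
        proof (rule pb(1))
          have "e * j \<le> e * Suc k" using that by (intro mult_left_mono) auto
          then show "e * j \<le> C" unfolding C_def by linarith
        qed
        finally have "1 \<le> Q ^ C / real X ^ j" using X by (simp add: le_divide_eq)
        then show ?thesis using dist_nearest_int_le_half[of "of_int 1 * \<beta> j"] by linarith
      qed
      then show ?thesis using pb(2)[of C] by (intro exI[of _ 1]) auto
    next
      case False
      then have Xl: "real X > Q ^ e" by simp
      define F where "F n = (\<Sum>j\<le>Suc k. \<beta> j * of_int n ^ j)" for n :: int
      define A where "A = {x. x \<in> {X0<..X1} \<and> x mod m = s}"
      have finA: "finite A" by (simp add: A_def)
      have F: "poly_fun (Suc k) (\<beta> (Suc k)) F" unfolding F_def by (rule poly_fun_sum)
      have "norm (\<Sum>x\<in>A. of_real (mangoldt x) * e2pi (F (int x))) \<ge> real X / Q"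
        using large unfolding F_def A_def by (simp only: of_int_of_nat_eq)
      then obtain q1 :: int where q1: "1 \<le> q1" "of_int q1 \<le> Q ^ C1"
        "dist_nearest_int (of_int q1 * \<beta> (Suc k)) \<le> Q ^ C1 / real X ^ Suc k"
        using lead[OF Q X lnX X1 F m] unfolding A_def by blast
      define a where "a = round (of_int q1 * \<beta> (Suc k))"
      define \<theta> where "\<theta> = \<beta> (Suc k) - of_int a / of_int q1"
      have q1r: "real_of_int q1 \<ge> 1" using q1 by simp
      have \<theta>: "\<bar>\<theta>\<bar> \<le> Q ^ C1 / real X ^ Suc k"
      proof -
        have "of_int q1 * \<bar>\<theta>\<bar> = \<bar>of_int q1 * \<theta>\<bar>" using q1r by (simp add: abs_mult)
        also have "of_int q1 * \<theta> = of_int q1 * \<beta> (Suc k) - of_int a" using q1r by (simp add: \<theta>_def algebra_simps)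
        finally have "of_int q1 * \<bar>\<theta>\<bar> \<le> Q ^ C1 / real X ^ Suc k" using q1(3) by (simp add: dist_nearest_int_def a_def)
        moreover have "1 * \<bar>\<theta>\<bar> \<le> of_int q1 * \<bar>\<theta>\<bar>" using q1r by (intro mult_right_mono) auto
        ultimately show ?thesis by simp
      qed
      define Y where "Y = nat \<lfloor>real X / Q ^ e\<rfloor>"
      have XQ: "real X / Q ^ e > 1" using Xl pb(4)[of e] by simp
      have Y1: "real Y \<le> real X / Q ^ e" unfolding Y_def using XQ by simp
      have Y_ge: "Y \<ge> 1" unfolding Y_def using XQ by linarith
      have Y2: "real X / Q ^ e \<le> 2 * real Y"
      proof -
        have "real_of_int \<lfloor>real X / Q ^ e\<rfloor> \<ge> 1" using XQ by simp
        moreover have "real Y = real_of_int \<lfloor>real X / Q ^ e\<rfloor>" unfolding Y_def using XQ by simp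
        ultimately show ?thesis using floor_correct[of "real X / Q ^ e"] by linarith
      qed
      \<comment> \<open>A class modulo \<open>w\<close> determines both the class modulo
        \<open>q1\<close>, which freezes the rational part of the top phase, and the class modulo
        \<open>m\<close> already prescribed.\<close>
      define w where "w = nat q1 * m"
      have w: "w \<ge> 1" "real w \<le> Q ^ (C1 + 1)"
      proof -
        show "w \<ge> 1" using q1 m by (simp add: w_def Suc_le_eq)
        have "real w = of_int q1 * real m" using q1 by (simp add: w_def)
        also have "\<dots> \<le> Q ^ C1 * Q" using q1 m Q by (intro mult_mono) auto
        finally show "real w \<le> Q ^ (C1 + 1)" by (simp add: mult.commute)
      qed
      define T where "T = {0..X div Y} \<times> {..<w}"
      have cardT: "real (card T) \<le> Q ^ (e + C1 + 3)"
      proof -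
        have "real (X div Y) \<le> real X / real Y"
        proof -
          have "real (X div Y * Y) \<le> real X" by (intro of_nat_mono div_times_less_eq_dividend)
          then show ?thesis using Y_ge by (simp add: le_divide_eq)
        qed
        also have "\<dots> \<le> 2 * Q ^ e" using Y2 Y_ge pb(4)[of e] by (simp add: divide_le_eq field_simps)
        finally have "real (X div Y) + 1 \<le> 3 * Q ^ e" using pb(2)[of e] by linarith
        also have "\<dots> \<le> Q\<^sup>2 * Q ^ e" using pb(3)[of 2] Q by (intro mult_right_mono) auto
        finally have "(real (X div Y) + 1) * real w \<le> (Q\<^sup>2 * Q ^ e) * Q ^ (C1 + 1)" using w Q by (intro mult_mono) auto
        also have "\<dots> = Q ^ (2 + e + (C1 + 1))" by (simp only: power_add)
        also have "2 + e + (C1 + 1) = e + C1 + 3" by simp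
        finally show ?thesis by (simp add: T_def algebra_simps)
      qed
      define \<phi> where "\<phi> x = (x div Y, x mod w)" for x
      have \<phi>T: "\<phi> ` A \<subseteq> T"
      proof
        fix p assume "p \<in> \<phi> ` A"
        then obtain x where x: "x \<in> A" "p = \<phi> x" by blast
        then have "x \<le> X" using X1 by (auto simp: A_def)
        then show "p \<in> T" using x w by (auto simp: T_def \<phi>_def intro: div_le_mono)
      qed
      define G where "G x = (\<Sum>j\<le>k. \<beta> j * real x ^ j)" for x
      define B where "B p = (\<Sum>x | x \<in> A \<and> \<phi> x = p. of_real (mangoldt x) * e2pi (G x))" for p
      define E where "E = 2 * pi * (\<bar>\<theta>\<bar> * (real (Suc k) * real X ^ k * real Y))"
      have block: "norm (\<Sum>x | x \<in> A \<and> \<phi> x = p. of_real (mangoldt x) * e2pi (F (int x))) 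
          \<le> norm (B p) + (\<Sum>x | x \<in> A \<and> \<phi> x = p. mangoldt x) * E" for p
      proof -
        define i where "i = fst p"
        define r where "r = snd p"
        define z where "z = e2pi (of_int a / of_int q1 * real r ^ Suc k) * e2pi (\<theta> * real (i * Y) ^ Suc k)"
        have diff: "norm (e2pi (F (int x)) - e2pi (G x) * z) \<le> E" if x: "x \<in> A" "\<phi> x = p" for x
        proof -
          have ir: "x div Y = i" "x mod w = r" using x by (auto simp: \<phi>_def i_def r_def)
          have xX: "x \<le> X" using x X1 by (auto simp: A_def)
          have "F (int x) = G x + of_int a / of_int q1 * real x ^ Suc k + \<theta> * real x ^ Suc k"
            by (simp add: F_def G_def \<theta>_def algebra_simps)
          moreover have "e2pi (of_int a / of_int q1 * real x ^ Suc k) = e2pi (of_int a / of_int q1 * real r ^ Suc k)"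
          proof -
            have "x = r + w * (x div w)" using ir by (metis mod_mult_div_eq)
            then have "int x = int r + int w * int (x div w)" by (metis of_nat_add of_nat_mult)
            then have "int x - int r = q1 * (int m * int (x div w))" using q1 by (simp add: w_def)
            then have "q1 dvd int x - int r" by simp
            then have "int x mod q1 = int r mod q1" by (simp add: mod_eq_dvd_iff)
            then have "int x ^ Suc k mod q1 = int r ^ Suc k mod q1" by (metis power_mod)
            then have "q1 dvd int x ^ Suc k - int r ^ Suc k" by (simp only: mod_eq_dvd_iff)
            then obtain n where "int x ^ Suc k - int r ^ Suc k = q1 * n" by (elim dvdE)
            then have "real_of_int (int x ^ Suc k - int r ^ Suc k) = real_of_int (q1 * n)" by (simp only:)
            then have "real x ^ Suc k = real r ^ Suc k + of_int q1 * of_int n" by (simp add: algebra_simps del: power_Suc)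
            then have "of_int a / of_int q1 * real x ^ Suc k = of_int a / of_int q1 * real r ^ Suc k + of_int (a * n)"
              using q1r by (simp add: field_simps del: power_Suc)
            then show ?thesis by (simp only: e2pi_add_int)
          qed
          ultimately have "e2pi (F (int x)) - e2pi (G x) * z
            = e2pi (G x) * e2pi (of_int a / of_int q1 * real r ^ Suc k) * (e2pi (\<theta> * real x ^ Suc k) - e2pi (\<theta> * real (i * Y) ^ Suc k))"
            by (simp only: e2pi_add z_def right_diff_distrib mult.assoc)
          then have "norm (e2pi (F (int x)) - e2pi (G x) * z) = norm (e2pi (\<theta> * real x ^ Suc k) - e2pi (\<theta> * real (i * Y) ^ Suc k))"
            by (simp only: norm_mult norm_e2pi mult_1)
          also have "\<dots> \<le> 2 * pi * \<bar>\<theta> * real x ^ Suc k - \<theta> * real (i * Y) ^ Suc k\<bar>" by (rule norm_e2pi_diff_le)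
          also have "\<dots> = 2 * pi * (\<bar>\<theta>\<bar> * \<bar>real x ^ Suc k - real (i * Y) ^ Suc k\<bar>)"
            by (simp only: right_diff_distrib[symmetric] abs_mult)
          also have "\<dots> \<le> E" unfolding E_def
          proof (intro mult_left_mono)
            have iY: "i * Y \<le> x" using ir by (metis div_times_less_eq_dividend)
            have xY: "x \<le> i * Y + Y" using ir Y_ge by (metis div_mult_mod_eq add_left_mono less_imp_le mod_less_divisor zero_less_one less_le_trans)
            have "real (i * Y) ^ Suc k \<le> real x ^ Suc k" using iY by (intro power_mono of_nat_mono) auto
            then have "\<bar>real x ^ Suc k - real (i * Y) ^ Suc k\<bar> = real x ^ Suc k - real (i * Y) ^ Suc k" by simp
            also have "\<dots> \<le> real (Suc k) * real X ^ k * (real x - real (i * Y))"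
              using iY xX by (intro power_Suc_diff_le) (simp_all del: of_nat_mult)
            also have "\<dots> \<le> real (Suc k) * real X ^ k * real Y"
            proof (intro mult_left_mono)
              have "real x \<le> real (i * Y + Y)" using xY by (rule of_nat_mono)
              then show "real x - real (i * Y) \<le> real Y" by simp
            qed simp
            finally show "\<bar>real x ^ Suc k - real (i * Y) ^ Suc k\<bar> \<le> real (Suc k) * real X ^ k * real Y" .
          qed auto
          finally show ?thesis .
        qed
        have "(\<Sum>x | x \<in> A \<and> \<phi> x = p. of_real (mangoldt x) * e2pi (F (int x))) 
          = B p * z + (\<Sum>x | x \<in> A \<and> \<phi> x = p. of_real (mangoldt x) * (e2pi (F (int x)) - e2pi (G x) * z))"
          unfolding B_def sum_distrib_right by (simp add: algebra_simps flip: sum.distrib)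
        then have "norm (\<Sum>x | x \<in> A \<and> \<phi> x = p. of_real (mangoldt x) * e2pi (F (int x))) \<le> norm (B p * z)
          + norm (\<Sum>x | x \<in> A \<and> \<phi> x = p. of_real (mangoldt x) * (e2pi (F (int x)) - e2pi (G x) * z))"
          by (simp only: norm_triangle_ineq)
        also have "norm (B p * z) = norm (B p)" by (simp add: z_def norm_mult)
        also have "norm (\<Sum>x | x \<in> A \<and> \<phi> x = p. of_real (mangoldt x) * (e2pi (F (int x)) - e2pi (G x) * z))
          \<le> (\<Sum>x | x \<in> A \<and> \<phi> x = p. mangoldt x * E)"
        proof (rule order_trans[OF norm_sum], rule sum_mono)
          fix x assume "x \<in> {x. x \<in> A \<and> \<phi> x = p}"
          then have "norm (e2pi (F (int x)) - e2pi (G x) * z) \<le> E" using diff by blast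
          then show "norm (of_real (mangoldt x) * (e2pi (F (int x)) - e2pi (G x) * z)) \<le> mangoldt x * E"
            by (simp only: norm_mult norm_of_real abs_mangoldt) (intro mult_left_mono mangoldt_nonneg)
        qed
        finally show ?thesis by (simp only: sum_distrib_right)
      qed
      have sumL: "(\<Sum>x\<in>A. mangoldt x) \<le> real X * Q"
      proof -
        have "(\<Sum>x\<in>A. mangoldt x) \<le> (\<Sum>x\<in>{1..X}. mangoldt x :: real)"
          using X1 by (intro sum_mono2) (auto simp: A_def mangoldt_nonneg)
        also have "\<dots> \<le> (\<Sum>x\<in>{1..X}. Q)"
        proof (rule sum_mono)
          fix x assume x: "x \<in> {1..X}"
          then have "mangoldt x \<le> ln (real x)" by (intro mangoldt_le) simp
          also have "\<dots> \<le> ln (real X)" using x by (subst ln_le_cancel_iff) auto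
          finally show "mangoldt x \<le> Q" using lnX by simp
        qed
        finally show ?thesis by simp
      qed
      have E_small: "real X * Q * E \<le> real X / (2 * Q)"
      proof -
        have E0: "E \<le> 2 * pi * (Q ^ C1 / real X ^ Suc k * (real (Suc k) * real X ^ k * (real X / Q ^ e)))"
          unfolding E_def using \<theta> Y1 Q by (intro mult_left_mono mult_mono) auto
        also have "\<dots> = 2 * pi * real (Suc k) * Q ^ C1 / Q ^ e" using X by simp
        also have "\<dots> \<le> 8 * Q ^ k * Q ^ C1 / Q ^ e"
          using pi_less_4 Suc_le_power[OF Q, of k] Q by (intro divide_right_mono mult_right_mono mult_mono) auto
        finally have "E \<le> 8 * Q ^ k * Q ^ C1 / Q ^ e" .
        then have "Q * E * (2 * Q) \<le> Q * (8 * Q ^ k * Q ^ C1 / Q ^ e) * (2 * Q)" using Q by (intro mult_left_mono mult_right_mono) auto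
        also have "\<dots> = (16 * Q ^ (k + C1 + 2)) / Q ^ e" by (simp add: power_add power2_eq_square mult_ac)
        also have "\<dots> \<le> (Q ^ 4 * Q ^ (k + C1 + 2)) / Q ^ e"
          using pb(3)[of 4] Q by (intro divide_right_mono mult_right_mono) auto
        also have "Q ^ 4 * Q ^ (k + C1 + 2) = Q ^ (4 + (k + C1 + 2))" by (simp only: power_add)
        also have "4 + (k + C1 + 2) = e" by (simp add: e_def)
        finally have "Q * E * (2 * Q) \<le> 1" using Q by simp
        then have "real X * (Q * E * (2 * Q)) \<le> real X * 1" by (intro mult_left_mono) auto
        then show ?thesis using Q by (simp add: le_divide_eq mult_ac)
      qed
      have E0: "0 \<le> E" by (simp add: E_def)
      have group: "(\<Sum>p\<in>T. \<Sum>x | x \<in> A \<and> \<phi> x = p. h x) = (\<Sum>x\<in>A. h x)" for h :: "nat \<Rightarrow> 'c :: comm_monoid_add"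
        using finA \<phi>T by (intro sum.group) (auto simp: T_def)
      have "real X / Q \<le> norm (\<Sum>x\<in>A. of_real (mangoldt x) * e2pi (F (int x)))" by fact
      also have "\<dots> = norm (\<Sum>p\<in>T. \<Sum>x | x \<in> A \<and> \<phi> x = p. of_real (mangoldt x) * e2pi (F (int x)))"
        by (simp only: group)
      also have "\<dots> \<le> (\<Sum>p\<in>T. norm (B p) + (\<Sum>x | x \<in> A \<and> \<phi> x = p. mangoldt x) * E)"
        by (rule order_trans[OF norm_sum]) (intro sum_mono block)
      also have "\<dots> = (\<Sum>p\<in>T. norm (B p)) + (\<Sum>x\<in>A. mangoldt x) * E"
        by (simp only: sum.distrib group flip: sum_distrib_right)
      also have "(\<Sum>x\<in>A. mangoldt x) * E \<le> real X * Q * E" using sumL E0 by (intro mult_right_mono)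
      also have "\<dots> \<le> real X / (2 * Q)" by (rule E_small)
      finally have "real X / (2 * Q) \<le> (\<Sum>p\<in>T. norm (B p))" using Q by (simp add: field_simps)
      then obtain p where p: "p \<in> T" "norm (B p) \<ge> real X / (2 * Q) / Q ^ (e + C1 + 3)"
        using exists_large_term[of T "Q ^ (e + C1 + 3)" "real X / (2 * Q)" "\<lambda>p. norm (B p)"] cardT X Q
        by (auto simp: T_def)
      have Bp: "norm (B p) \<ge> real X / Q ^ D"
      proof -
        have "2 * Q * Q ^ (e + C1 + 3) \<le> Q * Q * Q ^ (e + C1 + 3)" using Q by (intro mult_right_mono) auto
        also have "\<dots> = Q ^ (1 + 1 + (e + C1 + 3))" by (simp only: power_add power_one_right)
        also have "1 + 1 + (e + C1 + 3) = D" by (simp add: D_def)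
        finally have "real X / Q ^ D \<le> real X / (2 * Q * Q ^ (e + C1 + 3))" using Q by (intro divide_left_mono) auto
        with p show ?thesis by simp
      qed
      define i where "i = fst p"
      define r where "r = snd p"
      \<comment> \<open>An element of the block shows that \<open>r\<close> lies over
        \<open>s\<close>, so within the block the condition modulo \<open>m\<close> follows from the
        one modulo \<open>w\<close>.\<close>
      have "{x. x \<in> A \<and> \<phi> x = p} \<noteq> {}"
      proof
        assume "{x. x \<in> A \<and> \<phi> x = p} = {}"
        then have "B p = 0" unfolding B_def by (simp only: sum.empty)
        moreover have "0 < real X / Q ^ D" using X Q by simp
        ultimately show False using Bp by simp
      qed
      then obtain x0 where x0: "x0 \<in> A" "\<phi> x0 = p" by blast
      have rs: "r mod m = s"
      proof -
        have "x0 mod w mod m = x0 mod m" by (rule mod_mod_cancel) (simp add: w_def)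
        then show ?thesis using x0 by (auto simp: \<phi>_def r_def A_def)
      qed
      \<comment> \<open>The block is again a residue class in an interval. When \<open>i = 0\<close>
        the truncated \<open>i * Y - 1\<close> is 0, which is harmless because \<open>x > X0\<close>
        already excludes \<open>x = 0\<close>.\<close>
      have Aset: "{x. x \<in> A \<and> \<phi> x = p} = {x. x \<in> {max X0 (i * Y - 1)<..min X1 (i * Y + Y - 1)} \<and> x mod w = r}"
      proof (intro set_eqI iffI)
        fix x assume "x \<in> {x. x \<in> A \<and> \<phi> x = p}"
        then have x: "X0 < x" "x \<le> X1" "x div Y = i" "x mod w = r" by (auto simp: A_def \<phi>_def i_def r_def)
        have "i * Y \<le> x" using x by (metis div_times_less_eq_dividend)
        then have "i * Y - 1 < x" using x(1) by linarith
        moreover have "x < i * Y + Y" using x Y_ge by (metis div_mult_mod_eq nat_add_left_cancel_less mod_less_divisor zero_less_one less_le_trans)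
        then have "x \<le> i * Y + Y - 1" by linarith
        ultimately show "x \<in> {x. x \<in> {max X0 (i * Y - 1)<..min X1 (i * Y + Y - 1)} \<and> x mod w = r}" using x by simp
      next
        fix x assume "x \<in> {x. x \<in> {max X0 (i * Y - 1)<..min X1 (i * Y + Y - 1)} \<and> x mod w = r}"
        then have x: "X0 < x" "x \<le> X1" "i * Y \<le> x" "x < i * Y + Y" "x mod w = r" using Y_ge by auto
        have "x div Y = i" using x Y_ge by (intro div_nat_eqI) (auto simp: mult.commute)
        moreover have "x mod m = s" using rs x(5) by (metis w_def dvd_triv_right mod_mod_cancel)
        ultimately show "x \<in> {x. x \<in> A \<and> \<phi> x = p}" using x by (auto simp: A_def \<phi>_def i_def r_def)
      qed
      \<comment> \<open>The block is short, but the induction hypothesis is applied with the full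
        \<open>X\<close>: the restriction only weakens the lower bound to \<open>X / Q ^ D\<close>,
        and the errors appear at once as powers of \<open>1 / X\<close>.\<close>
      have large': "norm (\<Sum>x | x \<in> {max X0 (i * Y - 1)<..min X1 (i * Y + Y - 1)} \<and> x mod w = r. of_real (mangoldt x) * e2pi (\<Sum>j\<le>k. \<beta> j * real x ^ j)) \<ge> real X / Q ^ D"
        using Bp unfolding B_def Aset G_def .
      have QD: "Q \<le> Q ^ D" using pb(1)[of 1 D] by (simp add: D_def del: power_Suc)
      have "Q ^ D \<ge> 2" "1 + ln (real X) \<le> Q ^ D" "min X1 (i * Y + Y - 1) \<le> X" using Q QD lnX X1 by auto
      moreover have "real w \<le> Q ^ D"
      proof -
        have "Q ^ (C1 + 1) \<le> Q ^ D" by (intro pb(1)) (simp add: D_def)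
        with w show ?thesis by linarith
      qed
      ultimately obtain q2 :: int where q2: "1 \<le> q2" "of_int q2 \<le> (Q ^ D) ^ C0"
        "\<forall>j\<in>{1..k}. dist_nearest_int (of_int q2 * \<beta> j) \<le> (Q ^ D) ^ C0 / real X ^ j"
        using IH[OF _ X _ _ w(1) _ large'] by blast
      have QC: "Q ^ C1 * (Q ^ D) ^ C0 \<le> Q ^ C"
      proof -
        have "Q ^ C1 * (Q ^ D) ^ C0 = Q ^ (C1 + D * C0)" by (simp only: power_add power_mult)
        also have "\<dots> \<le> Q ^ C" by (intro pb(1)) (simp add: C_def)
        finally show ?thesis .
      qed
      have "1 \<le> q1 * q2" using q1 q2 by (simp add: int_one_le_iff_zero_less)
      moreover have "real_of_int (q1 * q2) \<le> Q ^ C"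
      proof -
        have "real_of_int (q1 * q2) \<le> Q ^ C1 * (Q ^ D) ^ C0" unfolding of_int_mult using q1 q2 Q by (intro mult_mono) auto
        with QC show ?thesis by linarith
      qed
      moreover have "dist_nearest_int (of_int (q1 * q2) * \<beta> j) \<le> Q ^ C / real X ^ j" if j: "j \<in> {1..Suc k}" for j
      proof -
        have "dist_nearest_int (of_int (q1 * q2) * \<beta> j) \<le> Q ^ C1 * (Q ^ D) ^ C0 / real X ^ j"
        proof (cases "j = Suc k")
          case True
          have "dist_nearest_int (of_int (q1 * q2) * \<beta> j) = dist_nearest_int (of_int q2 * (of_int q1 * \<beta> j))" by (simp add: mult_ac)
          also have "\<dots> \<le> of_int q2 * dist_nearest_int (of_int q1 * \<beta> j)" using dist_nearest_int_mult[of q2] q2(1) by (metis abs_of_nonneg of_int_0_le_iff order_trans zero_le_one)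
          also have "\<dots> \<le> (Q ^ D) ^ C0 * (Q ^ C1 / real X ^ j)" using q1(3) q2 Q True by (intro mult_mono) auto
          finally show ?thesis by (simp add: mult.commute)
        next
          case False
          then have "j \<in> {1..k}" using j by auto
          then have le: "dist_nearest_int (of_int q2 * \<beta> j) \<le> (Q ^ D) ^ C0 / real X ^ j" using q2 by blast
          have "dist_nearest_int (of_int (q1 * q2) * \<beta> j) = dist_nearest_int (of_int q1 * (of_int q2 * \<beta> j))" by (simp add: mult_ac)
          also have "\<dots> \<le> of_int q1 * dist_nearest_int (of_int q2 * \<beta> j)" using dist_nearest_int_mult[of q1] q1(1) by (metis abs_of_nonneg of_int_0_le_iff order_trans zero_le_one)
          also have "\<dots> \<le> Q ^ C1 * ((Q ^ D) ^ C0 / real X ^ j)" using q1 le Q by (intro mult_mono) auto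
          finally show ?thesis by simp
        qed
        also have "\<dots> \<le> Q ^ C / real X ^ j" using QC by (intro divide_right_mono) auto
        finally show ?thesis .
      qed
      ultimately show ?thesis by blast
    qed
  qed
qed

section \<open>Sums over primes\<close>

text \<open>Only proper prime powers contribute. Their base is at most \<open>sqrt X\<close> and
  their exponent at most \<open>log 2 X\<close>, so there are at most \<open>2 * Q * sqrt X\<close>
  of them, each of weight at most \<open>Q\<close>.\<close>

lemma sum_mangoldt_minus_primes_le:
  assumes X: "X \<ge> 1" and Q: "1 + ln (real X) \<le> Q"
  shows "(\<Sum>x\<in>{1..X}. \<bar>mangoldt x - (if prime x then ln (real x) else 0)\<bar>) \<le> 2 * Q\<^sup>2 * sqrt (real X)"
proof -
  have "0 \<le> ln (real X)" using X by (intro ln_ge_zero) simp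
  then have Q0: "Q \<ge> 1" using Q by simp
  define S where "S = {x \<in> {1..X}. primepow x \<and> \<not> prime x}"
  define R where "R = {1..nat \<lfloor>sqrt (real X)\<rfloor>} \<times> {1..nat \<lfloor>log 2 (real X)\<rfloor>}"
  have log0: "0 \<le> log 2 (real X)" using X by simp
  have "S \<subseteq> (\<lambda>(p, j). p ^ j) ` R"
  proof
    fix x assume x: "x \<in> S"
    then obtain p j where pj: "prime p" "j > 0" "x = p ^ j" by (auto simp: S_def primepow_def)
    then have "j \<noteq> 1" using x by (auto simp: S_def)
    with pj have j: "j \<ge> 2" by simp
    have p: "p \<ge> 2" using pj by (simp add: prime_ge_2_nat)
    have xX: "real p ^ j \<le> real X" using x pj by (simp add: S_def flip: of_nat_power)
    have "real p ^ 2 \<le> real p ^ j" using p j by (intro power_increasing) auto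
    then have "real p \<le> sqrt (real X)" using xX by (intro real_le_rsqrt) linarith
    then have p2: "p \<le> nat \<lfloor>sqrt (real X)\<rfloor>" by (simp add: le_nat_floor)
    have "2 ^ j \<le> real p ^ j" using p by (intro power_mono) auto
    then have "2 ^ j \<le> real X" using xX by linarith
    then have "2 powr real j \<le> real X" by (simp only: powr_realpow zero_less_numeral)
    then have "real j \<le> log 2 (real X)" using X by (simp add: le_log_iff)
    then have "j \<le> nat \<lfloor>log 2 (real X)\<rfloor>" by (simp add: le_nat_floor)
    then have "(p, j) \<in> R" using p p2 j by (simp add: R_def)
    then show "x \<in> (\<lambda>(p, j). p ^ j) ` R" using pj by (intro image_eqI[of _ _ "(p, j)"]) auto
  qed
  then have "card S \<le> card R" by (intro surj_card_le) (auto simp: R_def)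
  then have "real (card S) \<le> real (card R)" by simp
  also have "\<dots> = real (nat \<lfloor>sqrt (real X)\<rfloor>) * real (nat \<lfloor>log 2 (real X)\<rfloor>)" by (simp add: R_def)
  also have "\<dots> \<le> sqrt (real X) * (2 * Q)"
  proof (intro mult_mono)
    show "real (nat \<lfloor>sqrt (real X)\<rfloor>) \<le> sqrt (real X)" by simp
    have "real (nat \<lfloor>log 2 (real X)\<rfloor>) \<le> log 2 (real X)" using log0 by simp
    also have "\<dots> \<le> 2 * ln (real X)" using X by (intro log2_le_twice_ln) auto
    finally show "real (nat \<lfloor>log 2 (real X)\<rfloor>) \<le> 2 * Q" using Q by simp
  qed auto
  finally have cardS: "real (card S) \<le> sqrt (real X) * (2 * Q)" .
  have "(\<Sum>x\<in>{1..X}. \<bar>mangoldt x - (if prime x then ln (real x) else 0)\<bar>) = (\<Sum>x\<in>S. mangoldt x)"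
  proof (rule sum.mono_neutral_cong_right)
    show "\<forall>x\<in>{1..X} - S. \<bar>mangoldt x - (if prime x then ln (real x) else 0)\<bar> = 0"
      by (auto simp: S_def mangoldt_def)
  qed (auto simp: S_def)
  also have "\<dots> \<le> (\<Sum>x\<in>S. Q)"
  proof (rule sum_mono)
    fix x assume "x \<in> S"
    then have x: "x \<in> {1..X}" by (simp add: S_def)
    then have "mangoldt x \<le> ln (real x)" by (intro mangoldt_le) simp
    also have "\<dots> \<le> ln (real X)" using x by (subst ln_le_cancel_iff) auto
    finally show "mangoldt x \<le> Q" using Q by simp
  qed
  also have "\<dots> = real (card S) * Q" by simp
  also have "\<dots> \<le> sqrt (real X) * (2 * Q) * Q" using cardS Q0 by (intro mult_right_mono) auto
  also have "\<dots> = 2 * Q\<^sup>2 * sqrt (real X)" by (simp add: power2_eq_square)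
  finally show ?thesis .
qed

text \<open>Passing to the variable \<open>m * x + b\<close> makes the argument of the prime weight
  the summation variable. The new coefficients involve powers of \<open>1 / m\<close>, but the old
  ones are integer combinations of the new ones, so closeness to integers carries back from
  \<open>\<beta>\<close> to \<open>\<alpha>\<close> with the same multiplier.\<close>

lemma polynomial_affine_substitution:
  fixes \<alpha> :: "nat \<Rightarrow> real" and m b :: nat
  assumes m: "m \<ge> 1"
  shows "\<exists>\<beta>. (\<forall>x. (\<Sum>j=1..k. \<alpha> j * x ^ j) = (\<Sum>i\<le>k. \<beta> i * (real m * x + real b) ^ i)) \<and>
    (\<forall>j\<in>{1..k}. \<alpha> j = (\<Sum>i=1..k. of_nat ((i choose j) * m ^ j * b ^ (i - j)) * \<beta> i))"
proof -
  define P where "P = (\<Sum>j=1..k. monom (\<alpha> j) j)"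
  define F where "F = pcompose P [:- real b / real m, 1 / real m:]"
  define \<beta> where "\<beta> = coeff F"
  have P: "poly P x = (\<Sum>j=1..k. \<alpha> j * x ^ j)" for x by (simp add: P_def poly_sum poly_monom)
  have "degree P \<le> k" unfolding P_def by (rule degree_sum_le) (auto intro: order_trans[OF degree_monom_le])
  then have "degree F \<le> k" using m by (simp add: F_def degree_pcompose)
  then have F: "poly F y = (\<Sum>i\<le>k. \<beta> i * y ^ i)" for y
    unfolding \<beta>_def poly_altdef by (intro sum.mono_neutral_left) (auto simp: coeff_eq_0)
  have "(- real b / real m) + (real m * x + real b) * (1 / real m) = x" for x using m by (simp add: field_simps)
  then have FP: "poly F (real m * x + real b) = poly P x" for x by (simp add: F_def poly_pcompose mult.commute)
  define R where "R = (\<Sum>i\<le>k. smult (\<beta> i) ([:real b, real m:] ^ i))"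
  have "poly R x = poly P x" for x
    using FP[of x] by (simp add: R_def poly_sum F algebra_simps)
  then have RP: "R = P" by (simp add: poly_eq_poly_eq_iff[symmetric] fun_eq_iff)
  have "\<alpha> j = (\<Sum>i=1..k. of_nat ((i choose j) * m ^ j * b ^ (i - j)) * \<beta> i)" if j: "j \<in> {1..k}" for j
  proof -
    have "\<alpha> j = coeff P j" using j by (simp add: P_def coeff_sum)
    also have "\<dots> = (\<Sum>i\<le>k. \<beta> i * coeff ([:real b, real m:] ^ i) j)" unfolding RP[symmetric] by (simp add: R_def coeff_sum)
    also have "\<dots> = (\<Sum>i\<le>k. of_nat ((i choose j) * m ^ j * b ^ (i - j)) * \<beta> i)"
    proof (rule sum.cong[OF refl])
      fix i
      show "\<beta> i * coeff ([:real b, real m:] ^ i) j = of_nat ((i choose j) * m ^ j * b ^ (i - j)) * \<beta> i"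
      proof (cases "j \<le> i")
        case True
        then show ?thesis by (simp add: coeff_linear_poly_power)
      next
        case False
        have "degree ([:real b, real m:] ^ i) \<le> i" by (rule order_trans[OF degree_power_le]) simp
        with False have "coeff ([:real b, real m:] ^ i) j = 0" by (intro coeff_eq_0) simp
        with False show ?thesis by simp
      qed
    qed
    also have "\<dots> = (\<Sum>i=1..k. of_nat ((i choose j) * m ^ j * b ^ (i - j)) * \<beta> i)"
    proof (rule sum.mono_neutral_right)
      have "i = 0" if "i \<in> {..k} - {1..k}" for i using that by auto
      then show "\<forall>i\<in>{..k} - {1..k}. of_nat ((i choose j) * m ^ j * b ^ (i - j)) * \<beta> i = 0" using j by fastforce
    qed auto
    finally show ?thesis .
  qed
  then show ?thesis using FP unfolding P F by (intro exI[of _ \<beta>]) auto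
qed

lemma prime_weight_sum_coeffs:
  "\<exists>C::nat. C > 0 \<and> (\<forall>(Q::real) (N::nat) (m::nat) (b::nat) (M::real) (\<alpha> :: nat \<Rightarrow> real).
     Q \<ge> 2 \<longrightarrow> N \<ge> 1 \<longrightarrow> m \<ge> 1 \<longrightarrow> b < m \<longrightarrow> M \<ge> 1 \<longrightarrow> 4 * M * real m \<le> Q \<longrightarrow> 1 + ln (2 * real m * real N) \<le> Q \<longrightarrow>
     norm (\<Sum>n=1..N. of_real (prime_weight m b n) * e2pi (\<Sum>j=1..k. \<alpha> j * real n ^ j)) \<ge> real N / M \<longrightarrow>
     (\<exists>q::int. 1 \<le> q \<and> of_int q \<le> Q ^ C \<and>
       (\<forall>j\<in>{1..k}. dist_nearest_int (of_int q * \<alpha> j) \<le> real (Suc k) * 2 ^ k * Q ^ C / real N ^ j)))"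
proof -
  obtain C0 where C0: "\<And>(Q::real) (X::nat) X0 X1 (\<beta> :: nat \<Rightarrow> real) m s.
     Q \<ge> 2 \<Longrightarrow> X \<ge> 1 \<Longrightarrow> 1 + ln (real X) \<le> Q \<Longrightarrow> X1 \<le> X \<Longrightarrow> m \<ge> 1 \<Longrightarrow> real m \<le> Q \<Longrightarrow>
     norm (\<Sum>x | x \<in> {X0<..X1} \<and> x mod m = s. of_real (mangoldt x) * e2pi (\<Sum>j\<le>k. \<beta> j * real x ^ j)) \<ge> real X / Q \<Longrightarrow>
     (\<exists>q::int. 1 \<le> q \<and> of_int q \<le> Q ^ C0 \<and> (\<forall>j\<in>{1..k}. dist_nearest_int (of_int q * \<beta> j) \<le> Q ^ C0 / real X ^ j))"
    by (rule exE[OF prime_sum_progression_coeffs[of k]], rule that, (drule spec)+, (drule mp, assumption)+)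
  define C where "C = C0 + 8 * k + 1"
  show ?thesis
  proof (intro exI[of _ C] conjI allI impI)
    show "C > 0" by (simp add: C_def)
    fix Q :: real and N m b :: nat and M :: real and \<alpha> :: "nat \<Rightarrow> real"
    assume Q: "Q \<ge> 2" and N: "N \<ge> 1" and m: "m \<ge> 1" and b: "b < m" and M: "M \<ge> 1" and MmQ: "4 * M * real m \<le> Q"
      and lnQ: "1 + ln (2 * real m * real N) \<le> Q"
      and large: "norm (\<Sum>n=1..N. of_real (prime_weight m b n) * e2pi (\<Sum>j=1..k. \<alpha> j * real n ^ j)) \<ge> real N / M"
    note pb = power_bounds[OF Q]
    define X where "X = m * N + b"
    have mN: "real m * real N \<le> real X" by (simp add: X_def)
    have mN1: "1 \<le> m * N" using m N by (simp add: Suc_le_eq)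
    have X2: "real X \<le> 2 * real m * real N"
    proof -
      have "m * 1 \<le> m * N" using N by (intro mult_le_mono2) simp
      then have "b \<le> m * N" using b by linarith
      then have "X \<le> 2 * (m * N)" unfolding X_def by linarith
      then have "real X \<le> real (2 * (m * N))" by (rule of_nat_mono)
      then show ?thesis by simp
    qed
    have X1: "X \<ge> 1" using mN1 unfolding X_def by linarith
    have NX: "real N \<le> real X"
    proof -
      have "1 * real N \<le> real m * real N" using m by (intro mult_right_mono) auto
      with mN show ?thesis by simp
    qed
    have lnX: "1 + ln (real X) \<le> Q"
    proof -
      have "ln (real X) \<le> ln (2 * real m * real N)" using X1 X2 m N by (subst ln_le_cancel_iff) auto
      with lnQ show ?thesis by simp
    qed
    have mQ: "real m \<le> Q"
    proof -
      have "1 * real m \<le> (4 * M) * real m" using M by (intro mult_right_mono) auto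
      with MmQ show ?thesis by simp
    qed
    have k1: "1 \<le> real (Suc k) * 2 ^ k"
    proof -
      have "1 * 1 \<le> real (Suc k) * 2 ^ k" by (intro mult_mono) auto
      then show ?thesis by simp
    qed
    show "\<exists>q::int. 1 \<le> q \<and> of_int q \<le> Q ^ C \<and>
       (\<forall>j\<in>{1..k}. dist_nearest_int (of_int q * \<alpha> j) \<le> real (Suc k) * 2 ^ k * Q ^ C / real N ^ j)"
    \<comment> \<open>Beyond this threshold the prime powers, at most
      \<open>2 * Q\<^sup>2 * sqrt X\<close>, stay below \<open>X / Q\<close>. Below it
      \<open>X \<le> Q ^ 8\<close>, and the multiplier 1 suffices.\<close>
    proof (cases "sqrt (real X) \<le> 2 * Q ^ 3")
      case True
      have "real X \<le> Q ^ 8"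
      proof -
        have "real X = (sqrt (real X))\<^sup>2" by simp
        also have "\<dots> \<le> (2 * Q ^ 3)\<^sup>2" using True by (intro power_mono) auto
        also have "\<dots> = 2 ^ 2 * Q ^ 6" by (simp add: power_mult_distrib flip: power_mult)
        also have "\<dots> \<le> Q ^ 2 * Q ^ 6" using pb(3)[of 2] Q by (intro mult_right_mono) auto
        also have "\<dots> = Q ^ (2 + 6)" by (simp only: power_add)
        finally show ?thesis by simp
      qed
      have "dist_nearest_int (of_int 1 * \<alpha> j) \<le> real (Suc k) * 2 ^ k * Q ^ C / real N ^ j" if j: "j \<in> {1..k}" for j
      proof -
        have "real N ^ j \<le> (Q ^ 8) ^ j" using NX \<open>real X \<le> Q ^ 8\<close> by (intro power_mono) auto
        also have "\<dots> = Q ^ (8 * j)" by (simp only: power_mult)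
        also have "\<dots> \<le> Q ^ C" using j by (intro pb(1)) (simp add: C_def)
        also have "\<dots> \<le> real (Suc k) * 2 ^ k * Q ^ C" using mult_right_mono[OF k1, of "Q ^ C"] Q by simp
        finally have "1 \<le> real (Suc k) * 2 ^ k * Q ^ C / real N ^ j" using N by (simp add: le_divide_eq)
        then show ?thesis using dist_nearest_int_le_half[of "of_int 1 * \<alpha> j"] by linarith
      qed
      then show ?thesis using pb(2)[of C] by (intro exI[of _ 1]) auto
    next
      case False
      obtain \<beta> where \<beta>: "\<And>x. (\<Sum>j=1..k. \<alpha> j * x ^ j) = (\<Sum>i\<le>k. \<beta> i * (real m * x + real b) ^ i)"
        "\<And>j. j \<in> {1..k} \<Longrightarrow> \<alpha> j = (\<Sum>i=1..k. of_nat ((i choose j) * m ^ j * b ^ (i - j)) * \<beta> i)"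
        using polynomial_affine_substitution[OF m, where k = k and \<alpha> = \<alpha> and b = b] by blast
      define F where "F x = (\<Sum>i\<le>k. \<beta> i * real x ^ i)" for x
      \<comment> \<open>The left end is open because \<open>b\<close> itself corresponds to
        \<open>n = 0\<close>, while the sum starts at \<open>n = 1\<close>.\<close>
      define A where "A = {x. x \<in> {b<..X} \<and> x mod m = b}"
      define l where "l x = (if prime x then ln (real x) else 0)" for x
      have sum_eq: "(\<Sum>n=1..N. of_real (prime_weight m b n) * e2pi (\<Sum>j=1..k. \<alpha> j * real n ^ j)) = (\<Sum>x\<in>A. of_real (l x) * e2pi (F x))"
      proof (rule sum.reindex_bij_witness[of _ "\<lambda>x. x div m" "\<lambda>n. m * n + b"])
        fix n assume n: "n \<in> {1..N}"
        show "(m * n + b) div m = n" using b by simp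
        show "m * n + b \<in> A" using n b m by (auto simp: A_def X_def)
        show "of_real (l (m * n + b)) * e2pi (F (m * n + b)) = of_real (prime_weight m b n) * e2pi (\<Sum>j=1..k. \<alpha> j * real n ^ j)"
          unfolding l_def F_def prime_weight_def \<beta>(1) by simp
      next
        fix x assume "x \<in> A"
        then have x: "b < x" "x \<le> X" "x mod m = b" by (auto simp: A_def)
        show eq: "m * (x div m) + b = x" using x(3) mult_div_mod_eq[of m x] by simp
        have "x div m \<noteq> 0"
        proof
          assume "x div m = 0"
          with eq x(1) show False by simp
        qed
        moreover have "x div m \<le> N"
        proof -
          have "m * (x div m) + b \<le> m * N + b" using x(2) by (simp only: eq X_def)
          then have "m * (x div m) \<le> m * N" by (simp only: add_le_cancel_right)
          with m show ?thesis by simp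
        qed
        ultimately show "x div m \<in> {1..N}" by simp
      qed
      define Z where "Z = (\<Sum>x\<in>A. of_real (mangoldt x) * e2pi (F x))"
      have AX: "A \<subseteq> {1..X}" by (auto simp: A_def)
      have err: "norm (Z - (\<Sum>x\<in>A. of_real (l x) * e2pi (F x))) \<le> 2 * Q\<^sup>2 * sqrt (real X)"
      proof -
        have "Z - (\<Sum>x\<in>A. of_real (l x) * e2pi (F x)) = (\<Sum>x\<in>A. of_real (mangoldt x - l x) * e2pi (F x))"
          by (simp add: Z_def left_diff_distrib sum_subtractf)
        also have "norm \<dots> \<le> (\<Sum>x\<in>A. \<bar>mangoldt x - l x\<bar>)"
          by (rule order_trans[OF norm_sum]) (simp only: norm_mult norm_of_real norm_e2pi mult_1_right order.refl)
        also have "\<dots> \<le> (\<Sum>x\<in>{1..X}. \<bar>mangoldt x - l x\<bar>)" using AX by (intro sum_mono2) auto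
        also have "\<dots> \<le> 2 * Q\<^sup>2 * sqrt (real X)" unfolding l_def by (rule sum_mangoldt_minus_primes_le[OF X1 lnX])
        finally show ?thesis .
      qed
      have "2 * Q\<^sup>2 * sqrt (real X) \<le> real X / Q"
      proof -
        have "2 * Q ^ 3 * sqrt (real X) \<le> sqrt (real X) * sqrt (real X)" using False by (intro mult_right_mono) auto
        then have "2 * Q ^ 3 * sqrt (real X) \<le> real X" by simp
        then show ?thesis using Q by (simp add: le_divide_eq eval_nat_numeral mult_ac)
      qed
      \<comment> \<open>The factor 4 in \<open>4 * M * m \<le> Q\<close> is spent here: one 2
        compensates \<open>X \<le> 2 * m * N\<close>, the other leaves \<open>X / Q\<close> after
        the prime powers are removed.\<close>
      moreover have "2 * (real X / Q) \<le> real N / M"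
      proof -
        have "2 * (real X / Q) \<le> 2 * (2 * real m * real N / (4 * M * real m))"
          using X2 MmQ M m N by (intro mult_left_mono frac_le) auto
        also have "\<dots> = real N / M" using m by simp
        finally show ?thesis .
      qed
      moreover have "norm (\<Sum>x\<in>A. of_real (l x) * e2pi (F x)) \<le> norm Z + norm (Z - (\<Sum>x\<in>A. of_real (l x) * e2pi (F x)))"
        using norm_triangle_ineq4[of Z "Z - (\<Sum>x\<in>A. of_real (l x) * e2pi (F x))"] by simp
      ultimately have "norm Z \<ge> real X / Q" using large err unfolding sum_eq by linarith
      then obtain q :: int where q: "1 \<le> q" "of_int q \<le> Q ^ C0" "\<forall>j\<in>{1..k}. dist_nearest_int (of_int q * \<beta> j) \<le> Q ^ C0 / real X ^ j"
        using C0[OF Q X1 lnX order.refl m mQ] unfolding Z_def A_def F_def by blast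
      have QC: "Q ^ C0 \<le> Q ^ C" by (intro pb(1)) (simp add: C_def)
      have "dist_nearest_int (of_int q * \<alpha> j) \<le> real (Suc k) * 2 ^ k * Q ^ C / real N ^ j" if j: "j \<in> {1..k}" for j
      proof -
        define c where "c i = (i choose j) * m ^ j * b ^ (i - j)" for i
        have "of_int q * \<alpha> j = (\<Sum>i=1..k. of_int (int (c i)) * (of_int q * \<beta> i))"
          unfolding \<beta>(2)[OF j] c_def sum_distrib_left by (intro sum.cong) (simp_all add: mult_ac)
        then have "dist_nearest_int (of_int q * \<alpha> j) \<le> (\<Sum>i=1..k. dist_nearest_int (of_int (int (c i)) * (of_int q * \<beta> i)))"
          by (simp only:) (rule dist_nearest_int_sum, simp)
        also have "\<dots> \<le> (\<Sum>i=1..k. 2 ^ k * Q ^ C0 / real N ^ j)"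
        proof (rule sum_mono)
          fix i assume i: "i \<in> {1..k}"
          show "dist_nearest_int (of_int (int (c i)) * (of_int q * \<beta> i)) \<le> 2 ^ k * Q ^ C0 / real N ^ j"
          proof (cases "j \<le> i")
            case False
            then have "c i = 0" by (simp add: c_def)
            moreover have "dist_nearest_int 0 \<le> 0" using dist_nearest_int_le[of 0 0] by simp
            ultimately show ?thesis using Q by (simp add: order_trans)
          next
            case True
            have "real (c i) \<le> 2 ^ k * real m ^ i"
            proof -
              have "i choose j \<le> 2 ^ i" by (rule binomial_le_pow2)
              also have "(2::nat) ^ i \<le> 2 ^ k" using i by (intro power_increasing) auto
              finally have "c i \<le> 2 ^ k * m ^ j * m ^ (i - j)"
                unfolding c_def using b by (intro mult_mono power_mono) auto
              also have "\<dots> = 2 ^ k * m ^ i" using True by (simp add: mult.assoc flip: power_add)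
              finally have "real (c i) \<le> real (2 ^ k * m ^ i)" by (rule of_nat_mono)
              then show ?thesis by simp
            qed
            then have "real (c i) * dist_nearest_int (of_int q * \<beta> i) \<le> (2 ^ k * real m ^ i) * (Q ^ C0 / real X ^ i)"
              using q(3) i Q by (intro mult_mono) auto
            also have "\<dots> = 2 ^ k * Q ^ C0 * (real m ^ i / real X ^ i)" by simp
            \<comment> \<open>Since \<open>X \<ge> m * N\<close>, the power \<open>X ^ i\<close>
              cancels the \<open>m ^ i\<close> in the bound for \<open>c i\<close>, and what remains
              is at most \<open>1 / N ^ j\<close> because \<open>i \<ge> j\<close>.\<close>
            also have "\<dots> \<le> 2 ^ k * Q ^ C0 * (1 / real N ^ j)"
            proof (intro mult_left_mono)
              have "real N ^ j * real m ^ i \<le> real N ^ i * real m ^ i" using N True by (intro mult_right_mono power_increasing) auto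
              also have "\<dots> = (real m * real N) ^ i" by (simp add: power_mult_distrib)
              also have "\<dots> \<le> real X ^ i" using mN by (intro power_mono) auto
              finally show "real m ^ i / real X ^ i \<le> 1 / real N ^ j" using X1 N by (simp add: field_simps)
            qed (use Q in auto)
            finally show ?thesis using dist_nearest_int_mult[of "int (c i)" "of_int q * \<beta> i"] by simp
          qed
        qed
        also have "\<dots> = real k * (2 ^ k * Q ^ C0 / real N ^ j)" by simp
        also have "\<dots> \<le> real (Suc k) * (2 ^ k * Q ^ C / real N ^ j)"
        proof (rule mult_mono)
          show "2 ^ k * Q ^ C0 / real N ^ j \<le> 2 ^ k * Q ^ C / real N ^ j"
            by (intro divide_right_mono mult_left_mono QC) simp_all
        qed (use Q in simp_all)
        finally show ?thesis by (simp add: mult_ac)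
      qed
      moreover have "of_int q \<le> Q ^ C" using q QC by linarith
      ultimately show ?thesis using q(1) by blast
    qed
  qed
qed

section \<open>Choice of the parameter and the final constants\<close>

theorem theorem6:
  fixes k :: nat
  assumes "k \<ge> 1"
  shows "\<exists>c C :: real. c > 0 \<and> C > 0 \<and>
    (\<forall>\<epsilon> :: real. \<epsilon> > 0 \<longrightarrow>
      (\<exists>K :: real. K > 0 \<and>
        (\<forall>(\<alpha> :: nat \<Rightarrow> real) (f :: real \<Rightarrow> real) (N :: nat) (m :: nat) (M :: real) (b :: nat).
          f = (\<lambda>x. \<Sum>j=1..k. \<alpha> j * x ^ j) \<longrightarrow> \<alpha> k \<noteq> 0 \<longrightarrow>
          N \<ge> 1 \<longrightarrow> m \<ge> 1 \<longrightarrow> M \<ge> 1 \<longrightarrow>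
          real m \<le> real N powr c \<longrightarrow> M \<le> real N powr c \<longrightarrow>
          b < m \<longrightarrow> coprime b m \<longrightarrow>
          norm (\<Sum>n=1..N. of_real (prime_weight m b n) * e2pi (f (real n))) \<ge> real N / M \<longrightarrow>
          (\<exists>q :: int. 1 \<le> q \<and>
            of_int q \<le> K * (M * real m) powr C * real N powr \<epsilon> \<and>
            (\<forall>j\<in>{1..k}. dist_nearest_int (of_int q * \<alpha> j)
                \<le> K * (M * real m) powr C * real N powr (\<epsilon> - real j))))))"
proof -
  obtain C :: nat where "C > 0" and C: "\<And>(Q::real) (N::nat) (m::nat) (b::nat) (M::real) (\<alpha> :: nat \<Rightarrow> real).
     Q \<ge> 2 \<Longrightarrow> N \<ge> 1 \<Longrightarrow> m \<ge> 1 \<Longrightarrow> b < m \<Longrightarrow> M \<ge> 1 \<Longrightarrow> 4 * M * real m \<le> Q \<Longrightarrow> 1 + ln (2 * real m * real N) \<le> Q \<Longrightarrow>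
     norm (\<Sum>n=1..N. of_real (prime_weight m b n) * e2pi (\<Sum>j=1..k. \<alpha> j * real n ^ j)) \<ge> real N / M \<Longrightarrow>
     (\<exists>q::int. 1 \<le> q \<and> of_int q \<le> Q ^ C \<and>
       (\<forall>j\<in>{1..k}. dist_nearest_int (of_int q * \<alpha> j) \<le> real (Suc k) * 2 ^ k * Q ^ C / real N ^ j))"
    by (rule exE[OF prime_weight_sum_coeffs[of k]], erule conjE, rule that, assumption, (drule spec)+, (drule mp, assumption)+)
  have main: "\<exists>K>0. \<forall>(\<alpha> :: nat \<Rightarrow> real) (N :: nat) (m :: nat) (M :: real) (b :: nat).
          N \<ge> 1 \<longrightarrow> m \<ge> 1 \<longrightarrow> M \<ge> 1 \<longrightarrow> b < m \<longrightarrow>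
          norm (\<Sum>n=1..N. of_real (prime_weight m b n) * e2pi (\<Sum>j=1..k. \<alpha> j * real n ^ j)) \<ge> real N / M \<longrightarrow>
          (\<exists>q :: int. 1 \<le> q \<and>
            of_int q \<le> K * (M * real m) powr C * real N powr \<epsilon> \<and>
            (\<forall>j\<in>{1..k}. dist_nearest_int (of_int q * \<alpha> j)
                \<le> K * (M * real m) powr C * real N powr (\<epsilon> - real j)))" if \<epsilon>: "\<epsilon> > 0" for \<epsilon> :: real
  proof -
    define \<eta> where "\<eta> = \<epsilon> / real C"
    have \<eta>: "\<eta> > 0" using \<epsilon> \<open>C > 0\<close> by (simp add: \<eta>_def)
    \<comment> \<open>The 4 secures \<open>4 * M * m \<le> Q\<close>. In the logarithmic condition
      \<open>1 + ln 2 \<le> 2\<close> and \<open>ln m \<le> m\<close> use up 3, and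
      \<open>ln N \<le> N powr \<eta> / \<eta>\<close> uses \<open>1 / \<eta>\<close>.\<close>
    define L where "L = 4 + 1 / \<eta>"
    have L: "L \<ge> 4" using \<eta> by (simp add: L_def)
    define K where "K = real (Suc k) * 2 ^ k * L ^ C"
    have k1: "1 \<le> real (Suc k) * 2 ^ k"
    proof -
      have "1 * 1 \<le> real (Suc k) * 2 ^ k" by (intro mult_mono) auto
      then show ?thesis by simp
    qed
    have K: "K > 0" unfolding K_def using L by (intro mult_pos_pos) auto
    show ?thesis
    proof (rule exI[of _ K], intro conjI K allI impI)
      fix \<alpha> :: "nat \<Rightarrow> real" and N m :: nat and M :: real and b :: nat
      assume N: "N \<ge> 1" and m: "m \<ge> 1" and M: "M \<ge> 1" and b: "b < m"
        and large: "norm (\<Sum>n=1..N. of_real (prime_weight m b n) * e2pi (\<Sum>j=1..k. \<alpha> j * real n ^ j)) \<ge> real N / M"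
      define Q where "Q = L * (M * real m) * real N powr \<eta>"
      have N\<eta>: "real N powr \<eta> \<ge> 1" using N \<eta> by (intro ge_one_powr_ge_zero) auto
      have Mm: "M * real m \<ge> 1" "M * real m \<ge> real m"
      proof -
        show "M * real m \<ge> real m" using mult_right_mono[OF M, of "real m"] by simp
        with m show "M * real m \<ge> 1" by linarith
      qed
      have MmN: "M * real m * 1 \<le> M * real m * real N powr \<eta>" using Mm N\<eta> by (intro mult_left_mono) auto
      have Q4: "4 * M * real m \<le> Q"
      proof -
        have "4 * (M * real m * 1) \<le> L * (M * real m * real N powr \<eta>)" by (rule mult_mono[OF L MmN]) (use L Mm in auto)
        then show ?thesis by (simp add: Q_def mult_ac)
      qed
      have Q2: "Q \<ge> 2" using Q4 Mm by (simp add: mult.assoc)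
      have lnQ: "1 + ln (2 * real m * real N) \<le> Q"
      proof -
        have "ln (2 * real m * real N) = ln 2 + ln (real m) + ln (real N)" using m N by (simp add: ln_mult)
        moreover have "ln (2::real) \<le> 1" using ln_le_minus_one[of "2::real"] by simp
        moreover have "ln (real m) \<le> real m" using ln_le_minus_one[of "real m"] m by simp
        moreover have "ln (real N) \<le> real N powr \<eta> / \<eta>" using N \<eta> by (intro ln_powr_bound) auto
        ultimately have "1 + ln (2 * real m * real N) \<le> 2 + real m + (1 / \<eta>) * real N powr \<eta>" by simp
        also have "\<dots> \<le> 2 * (M * real m * real N powr \<eta>) + 1 * (M * real m * real N powr \<eta>) + (1 / \<eta>) * (M * real m * real N powr \<eta>)"
        proof (intro add_mono)
          show "2 \<le> 2 * (M * real m * real N powr \<eta>)" using MmN Mm by linarith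
          show "real m \<le> 1 * (M * real m * real N powr \<eta>)" using MmN Mm by linarith
          have "1 * real N powr \<eta> \<le> M * real m * real N powr \<eta>" using Mm by (intro mult_right_mono) auto
          then show "1 / \<eta> * real N powr \<eta> \<le> 1 / \<eta> * (M * real m * real N powr \<eta>)" using \<eta> by (intro mult_left_mono) auto
        qed
        also have "\<dots> = (3 + 1 / \<eta>) * (M * real m * real N powr \<eta>)" by (simp add: algebra_simps)
        also have "\<dots> \<le> L * (M * real m * real N powr \<eta>)" unfolding L_def using Mm M by (intro mult_right_mono) auto
        finally show ?thesis by (simp add: Q_def mult_ac)
      qed
      obtain q :: int where q: "1 \<le> q" "of_int q \<le> Q ^ C"
        "\<forall>j\<in>{1..k}. dist_nearest_int (of_int q * \<alpha> j) \<le> real (Suc k) * 2 ^ k * Q ^ C / real N ^ j"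
        using C[OF Q2 N m b M Q4 lnQ large] by blast
      have QC: "Q ^ C = L ^ C * (M * real m) powr C * real N powr \<epsilon>"
      proof -
        have "(real N powr \<eta>) ^ C = real N powr \<epsilon>" using N \<open>C > 0\<close> by (simp add: powr_power \<eta>_def)
        moreover have "(M * real m) ^ C = (M * real m) powr C" using Mm by (subst powr_realpow) auto
        ultimately show ?thesis by (simp only: Q_def power_mult_distrib)
      qed
      have "of_int q \<le> K * (M * real m) powr C * real N powr \<epsilon>"
      proof -
        have "1 * Q ^ C \<le> real (Suc k) * 2 ^ k * Q ^ C" using k1 Q2 by (intro mult_right_mono) auto
        also have "\<dots> = K * (M * real m) powr C * real N powr \<epsilon>" by (simp only: QC K_def mult.assoc)
        finally show ?thesis using q(2) by linarith
      qed
      moreover have "dist_nearest_int (of_int q * \<alpha> j) \<le> K * (M * real m) powr C * real N powr (\<epsilon> - real j)" if "j \<in> {1..k}" for j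
      proof -
        have "dist_nearest_int (of_int q * \<alpha> j) \<le> real (Suc k) * 2 ^ k * Q ^ C / real N ^ j" using q(3) that by blast
        also have "\<dots> = K * (M * real m) powr C * (real N powr \<epsilon> / real N ^ j)" by (simp only: QC K_def mult.assoc times_divide_eq_right)
        also have "real N powr \<epsilon> / real N ^ j = real N powr (\<epsilon> - real j)" using N by (simp add: powr_diff powr_realpow)
        finally show ?thesis .
      qed
      ultimately show "\<exists>q :: int. 1 \<le> q \<and>
            of_int q \<le> K * (M * real m) powr C * real N powr \<epsilon> \<and>
            (\<forall>j\<in>{1..k}. dist_nearest_int (of_int q * \<alpha> j)
                \<le> K * (M * real m) powr C * real N powr (\<epsilon> - real j))"
        using q(1) by blast
    qed
  qed
  show ?thesis
  \<comment> \<open>The exponent \<open>C\<close> counts powers of \<open>Q\<close> and was fixed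
    before \<open>\<epsilon>\<close>; the latter enters only through \<open>\<eta>\<close> and
    \<open>L\<close>, hence only through \<open>K\<close>.\<close>
  proof (rule exI[of _ 1], rule exI[of _ "real C"], intro conjI allI impI)
    show "0 < real C" using \<open>C > 0\<close> by simp
    fix \<epsilon> :: real
    assume "\<epsilon> > 0"
    from main[OF this] obtain K where K: "K > 0" "\<And>\<alpha> N m M b. N \<ge> 1 \<Longrightarrow> m \<ge> 1 \<Longrightarrow> M \<ge> 1 \<Longrightarrow> b < m \<Longrightarrow>
          norm (\<Sum>n=1..N. of_real (prime_weight m b n) * e2pi (\<Sum>j=1..k. \<alpha> j * real n ^ j)) \<ge> real N / M \<Longrightarrow>
          (\<exists>q :: int. 1 \<le> q \<and>
            of_int q \<le> K * (M * real m) powr C * real N powr \<epsilon> \<and>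
            (\<forall>j\<in>{1..k}. dist_nearest_int (of_int q * \<alpha> j)
                \<le> K * (M * real m) powr C * real N powr (\<epsilon> - real j)))" by blast
    show "\<exists>K :: real. K > 0 \<and>
        (\<forall>(\<alpha> :: nat \<Rightarrow> real) (f :: real \<Rightarrow> real) (N :: nat) (m :: nat) (M :: real) (b :: nat).
          f = (\<lambda>x. \<Sum>j=1..k. \<alpha> j * x ^ j) \<longrightarrow> \<alpha> k \<noteq> 0 \<longrightarrow>
          N \<ge> 1 \<longrightarrow> m \<ge> 1 \<longrightarrow> M \<ge> 1 \<longrightarrow>
          real m \<le> real N powr 1 \<longrightarrow> M \<le> real N powr 1 \<longrightarrow>
          b < m \<longrightarrow> coprime b m \<longrightarrow>
          norm (\<Sum>n=1..N. of_real (prime_weight m b n) * e2pi (f (real n))) \<ge> real N / M \<longrightarrow>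
          (\<exists>q :: int. 1 \<le> q \<and>
            of_int q \<le> K * (M * real m) powr real C * real N powr \<epsilon> \<and>
            (\<forall>j\<in>{1..k}. dist_nearest_int (of_int q * \<alpha> j)
                \<le> K * (M * real m) powr real C * real N powr (\<epsilon> - real j))))"
      by (rule exI[of _ K], intro conjI K(1) allI impI, rule K(2)) simp_all
  qed simp
qed

end
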